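(* Let $A(z)\in\mathcal H(S^1)^{n\times n}$ be a para-Hermitian matrix. Then there exists a decomposition $A(z)=U(z)D(z)U(z)^P$ with $U(z),D(z)\in\mathcal H(S^1)^{n\times n}$, where $U(z)$ is para-unitary and $D(z)$ is block diagonal with pseudo-circulant diagonal blocks.
   Context: $S^1=\{z\in\mathbb C:|z|=1\}$. $\mathcal H(S^1)$ is the ring of functions holomorphic on $S^1$, i.e. admitting a holomorphic extension to some open neighbourhood of $S^1$ (equivalently, Laurent series $\sum_{k\in\mathbb Z}a_kz^k$ converging in an open annulus containing $S^1$). For $A(z)=[a_{i,j}(z)]\in\mathcal H(S^1)^{m\times n}$, the para-Hermitian conjugate $A(z)^P\in\mathcal H(S^1)^{n\times m}$ is the matrix whose $(i,j)$ entry is $\overline{a_{j,i}(\overline z^{-1})}$; on $S^1$ it coincides with the conjugate transpose $A(z)^*$. A square matrix $A(z)\in\mathcal H(S^1)^{n\times n}$ is para-Hermitian if $A(z)=A(z)^P$, and $U(z)\in\mathcal H(S^1)^{n\times n}$ is para-unitary if $U(z)U(z)^P=U(z)^PU(z)=I$. A matrix $C(z)\in\mathcal H(S^1)^{N\times N}$ is pseudo-circulant if there are functions $\phi_0(z),\dots,\phi_{N-1}(z)\in\mathcal H(S^1)$ such that $C(z)_{i,j}=\phi_{i-j}(z)$ for $i\ge j$ and $C(z)_{i,j}=z^{-1}\phi_{N+i-j}(z)$ for $i<j$, that is, $$C(z)=\begin{bmatrix}\phi_0(z)&z^{-1}\phi_{N-1}(z)&\cdots&z^{-1}\phi_1(z)\\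 \phi_1(z)&\phi_0(z)&\ddots&\vdots\\ \vdots&\ddots&\ddots&z^{-1}\phi_{N-1}(z)\\ \phi_{N-1}(z)&\cdots&\phi_1(z)&\phi_0(z)\end{bmatrix}.$$ *)

theory Defs
  imports "HOL-Complex_Analysis.Complex_Analysis" "Jordan_Normal_Form.Matrix"
begin

text \<open>
  A matrix over the ring of functions holomorphic on the unit circle is represented by a
  matrix-valued function of \<open>z\<close> whose entries are analytic on (a neighbourhood of)
  \<open>sphere 0 1\<close>; values far away from the circle are junk. Accordingly, two elements are
  identified iff they agree on the circle. By the identity theorem this is the same as agreeing
  on a neighbourhood of the circle, see \<open>hol_circle_eq_iff\<close> below.
\<close>

definition hol_circle :: "(complex \<Rightarrow> complex) set" where
  "hol_circle = {f. f analytic_on sphere 0 1}"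

definition hol_circle_mat :: "nat \<Rightarrow> nat \<Rightarrow> (complex \<Rightarrow> complex mat) set" where
  "hol_circle_mat m n =
     {A. (\<forall>z. A z \<in> carrier_mat m n) \<and> (\<forall>i<m. \<forall>j<n. (\<lambda>z. A z $$ (i, j)) \<in> hol_circle)}"

definition para_conj :: "(complex \<Rightarrow> complex mat) \<Rightarrow> complex \<Rightarrow> complex mat" where
  "para_conj A z = map_mat cnj (transpose_mat (A (inverse (cnj z))))"

definition para_hermitian :: "nat \<Rightarrow> (complex \<Rightarrow> complex mat) \<Rightarrow> bool" where
  "para_hermitian n A \<longleftrightarrow>
     A \<in> hol_circle_mat n n \<and> (\<forall>z\<in>sphere 0 1. A z = para_conj A z)"

definition para_unitary :: "nat \<Rightarrow> (complex \<Rightarrow> complex mat) \<Rightarrow> bool" where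
  "para_unitary n U \<longleftrightarrow>
     U \<in> hol_circle_mat n n \<and>
     (\<forall>z\<in>sphere 0 1. U z * para_conj U z = 1\<^sub>m n \<and> para_conj U z * U z = 1\<^sub>m n)"

definition pseudo_circulant :: "nat \<Rightarrow> (complex \<Rightarrow> complex mat) \<Rightarrow> bool" where
  "pseudo_circulant N C \<longleftrightarrow>
     C \<in> hol_circle_mat N N \<and>
     (\<exists>\<phi>. (\<forall>k<N. \<phi> k \<in> hol_circle) \<and>
        (\<forall>z\<in>sphere 0 1. \<forall>i<N. \<forall>j<N.
           C z $$ (i, j) = (if i \<ge> j then \<phi> (i - j) z else inverse z * \<phi> (N + i - j) z)))"

definition block_diag_pseudo_circulant :: "nat \<Rightarrow> (complex \<Rightarrow> complex mat) \<Rightarrow> bool" where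
  "block_diag_pseudo_circulant n D \<longleftrightarrow>
     D \<in> hol_circle_mat n n \<and>
     (\<exists>Cs. (\<forall>C\<in>set Cs. \<exists>N>0. pseudo_circulant N C) \<and>
        (\<forall>z\<in>sphere 0 1. D z = diag_block_mat (map (\<lambda>C. C z) Cs)))"

lemma hol_circle_iff_extension:
  "f \<in> hol_circle \<longleftrightarrow> (\<exists>V. open V \<and> sphere 0 1 \<subseteq> V \<and> f holomorphic_on V)"
  by (auto simp: hol_circle_def analytic_on_holomorphic)

lemma hol_circle_eq_iff:
  assumes "f \<in> hol_circle" "g \<in> hol_circle"
  shows "(\<forall>z\<in>sphere 0 1. f z = g z) \<longleftrightarrow>
           (\<exists>V. open V \<and> sphere 0 1 \<subseteq> V \<and> (\<forall>z\<in>V. f z = g z))"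
proof
  assume eq: "\<forall>z\<in>sphere 0 1. f z = g z"
  have an: "(\<lambda>z. f z - g z) analytic_on sphere 0 1"
    using assms by (auto simp: hol_circle_def intro: analytic_on_diff)
  have "\<exists>e>0. \<forall>z\<in>ball p e. f z = g z" if p: "p \<in> sphere 0 1" for p
  proof -
    obtain e where e: "e > 0" "(\<lambda>z. f z - g z) holomorphic_on ball p e"
      using an p unfolding analytic_on_def by blast
    have "1 \<in> sphere (0::complex) 1" "- 1 \<in> sphere (0::complex) 1"
      by auto
    then have "\<nexists>x. sphere (0::complex) 1 = {x}"
      by (metis one_neq_neg_one singletonD)
    then have "p islimpt sphere 0 1"
      using p by (intro connected_imp_perfect connected_sphere) auto
    then have lim: "p islimpt (sphere 0 1 \<inter> ball p e)"
      using e(1) by (auto intro!: islimpt_Int_eventually eventually_at_in_open')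
    have "f z - g z = 0" if "z \<in> ball p e" for z
      by (rule analytic_continuation[OF e(2) _ _ _ _ lim _ that]) (use e(1) eq in auto)
    then show ?thesis using e(1) by auto
  qed
  then obtain e where "\<And>p. p \<in> sphere 0 1 \<Longrightarrow> e p > 0 \<and> (\<forall>z\<in>ball p (e p). f z = g z)"
    by metis
  then show "\<exists>V. open V \<and> sphere 0 1 \<subseteq> V \<and> (\<forall>z\<in>V. f z = g z)"
    by (intro exI[of _ "\<Union>p\<in>sphere 0 1. ball p (e p)"]) force
qed auto

end

theory Submission
  imports Defs "Subresultants.Subresultant_Gcd" "Jordan_Normal_Form.Char_Poly"
    "HOL-Computational_Algebra.Field_as_Ring"
begin

text \<open>
Along the circle write \<open>z = exp (\<i> * t)\<close>, so that \<open>A\<close> becomes a \<open>2 * pi\<close>-periodic Hermitian matrix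
depending analytically on the real variable \<open>t\<close>. Its eigenvalues can be followed analytically in
\<open>t\<close>, but after one turn they may come back permuted. A cycle of length \<open>N\<close> of this permutation is
one analytic function \<open>ell\<close> of an \<open>N\<close>-th root \<open>w\<close> of \<open>z\<close>, and its \<open>N\<close> branches are the values
\<open>ell (root_unity N ^ k * w)\<close>. On the span of the corresponding eigenvectors \<open>A\<close> is diagonal, but only
over the variable \<open>w\<close>; a discrete Fourier transform over the \<open>N\<close> branches returns to the variable
\<open>z\<close> and turns the diagonal matrix of the branches into a pseudo-circulant block.

The proof splits off invariant subspaces until this picture applies to the whole space. Call \<open>A\<close>
reducible if some proper nonzero family of vectors over the ring, orthonormal at every point of the
circle, spans an invariant subspace. A reducible \<open>A\<close> is para-unitarily similar to a block diagonal
matrix (\<open>reducible_splits\<close>) and the blocks are treated by induction. For an irreducible \<open>A\<close> the orbit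
of the first basis vector under \<open>A\<close> must span the whole space at some point \<open>z0\<close>
(\<open>reducible_if_krylov_degenerate\<close>). A Hermitian matrix with a cyclic vector has simple spectrum
(\<open>hermitian_multiple_eigenvalue\<close>), so the discriminant of the characteristic polynomial is not
identically zero.

It remains to find one analytic eigenvalue (\<open>analytic_eigenvalue_on_line\<close>). The zeros of the
discriminant near the circle lie on the circle, so the roots of the characteristic polynomial are
simple over a thin strip above the real line. The roots form a covering space of that strip, which is
simply connected, so there is a holomorphic root function on it. It extends continuously to the real
line, because its cluster values at a boundary point form a connected subset of a finite set, and it is
real there, because the matrix is Hermitian. Schwarz reflection then continues it holomorphically
across the real line, including the points where eigenvalues cross. Periodicity with some period
\<open>2 * pi * N\<close> follows from the pigeonhole principle, as at each point there are only finitely many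
eigenvalues.

All linear algebra over the ring rests on one fact (\<open>unit_kernel_vector\<close>): a system of linear
equations over the ring that has a nonzero solution at each point of the circle has a solution over
the ring of norm 1 at each point. Elimination gives a nonzero solution, its common zeros on the circle
can be divided out, and its squared norm is then a positive analytic function with an analytic
square root. This yields the eigenvector for the eigenvalue \<open>ell\<close>, periodic as \<open>ell\<close> is, and the
completion of an orthonormal family to a para-unitary matrix.
\<close>

section \<open>The ring of functions holomorphic on the circle\<close>

abbreviation S1 :: "complex set" where "S1 \<equiv> sphere 0 1"

lemma infinite_S1: "infinite S1"
proof
  assume "finite S1"
  moreover have "connected S1" by (intro connected_sphere) auto
  ultimately have "\<exists>x. S1 = {x} \<or> S1 = {}"
    using connected_finite_iff_sing by metis
  moreover have "1 \<in> S1" "- 1 \<in> S1" by auto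
  ultimately show False by (metis empty_iff one_neq_neg_one singletonD)
qed

lemma hol_circle_const [simp]: "(\<lambda>_. c) \<in> hol_circle"
  and hol_circle_ident [simp]: "(\<lambda>z. z) \<in> hol_circle"
  by (auto simp: hol_circle_def)

lemma hol_circle_add: "f \<in> hol_circle \<Longrightarrow> g \<in> hol_circle \<Longrightarrow> (\<lambda>z. f z + g z) \<in> hol_circle"
  and hol_circle_diff: "f \<in> hol_circle \<Longrightarrow> g \<in> hol_circle \<Longrightarrow> (\<lambda>z. f z - g z) \<in> hol_circle"
  and hol_circle_mult: "f \<in> hol_circle \<Longrightarrow> g \<in> hol_circle \<Longrightarrow> (\<lambda>z. f z * g z) \<in> hol_circle"
  and hol_circle_uminus: "f \<in> hol_circle \<Longrightarrow> (\<lambda>z. - f z) \<in> hol_circle"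
  and hol_circle_power: "f \<in> hol_circle \<Longrightarrow> (\<lambda>z. f z ^ k) \<in> hol_circle"
  and hol_circle_sum: "(\<And>i. i \<in> I \<Longrightarrow> h i \<in> hol_circle) \<Longrightarrow> (\<lambda>z. \<Sum>i\<in>I. h i z) \<in> hol_circle"
  and hol_circle_prod: "(\<And>i. i \<in> I \<Longrightarrow> h i \<in> hol_circle) \<Longrightarrow> (\<lambda>z. \<Prod>i\<in>I. h i z) \<in> hol_circle"
  by (auto simp: hol_circle_def intro!: analytic_intros)

lemma hol_circle_divide:
  "f \<in> hol_circle \<Longrightarrow> g \<in> hol_circle \<Longrightarrow> (\<And>z. z \<in> S1 \<Longrightarrow> g z \<noteq> 0) \<Longrightarrow> (\<lambda>z. f z / g z) \<in> hol_circle"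
  by (auto simp: hol_circle_def intro!: analytic_intros)

lemma hol_circle_inverse_ident [simp]: "inverse \<in> hol_circle" "(\<lambda>z. inverse z) \<in> hol_circle"
  by (auto simp: hol_circle_def intro!: analytic_intros)

lemma hol_circle_compose:
  "f \<in> hol_circle \<Longrightarrow> g \<in> hol_circle \<Longrightarrow> (\<And>z. z \<in> S1 \<Longrightarrow> f z \<in> S1) \<Longrightarrow> (\<lambda>z. g (f z)) \<in> hol_circle"
  unfolding hol_circle_def using analytic_on_compose_gen[of f S1 g S1] by (simp add: o_def)

lemmas hol_circle_intros = hol_circle_const hol_circle_ident hol_circle_add hol_circle_diff
  hol_circle_mult hol_circle_uminus hol_circle_power hol_circle_sum hol_circle_prod
  hol_circle_inverse_ident

text \<open>
Analytic continuation needs a connected domain; the component of the domain that contains the circle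
is one.
\<close>
lemma hol_circle_connected_domain:
  assumes "f \<in> hol_circle"
  obtains V where "open V" "connected V" "S1 \<subseteq> V" "f holomorphic_on V"
proof -
  obtain W where W: "open W" "S1 \<subseteq> W" "f holomorphic_on W"
    using assms by (auto simp: hol_circle_iff_extension)
  let ?V = "connected_component_set W 1"
  have "connected S1" by (intro connected_sphere) auto
  then have "S1 \<subseteq> ?V"
    using W(2) by (intro connected_component_maximal) auto
  then show ?thesis
    using W connected_component_subset[of W 1]
    by (intro that[of ?V] open_connected_component holomorphic_on_subset[OF W(3)]) auto
qed

text \<open>
The zeros accumulate by compactness of the circle, and the identity theorem applies.
\<close>
lemma hol_circle_eq_0I:
  assumes f: "f \<in> hol_circle" and inf: "infinite {z\<in>S1. f z = 0}" and z: "z \<in> S1"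
  shows "f z = 0"
proof -
  obtain V where V: "open V" "connected V" "S1 \<subseteq> V" "f holomorphic_on V"
    using hol_circle_connected_domain[OF f] .
  have "compact S1" by auto
  then obtain p where p: "p \<in> S1" "p islimpt {z\<in>S1. f z = 0}"
    using Heine_Borel_imp_Bolzano_Weierstrass[OF _ inf] by (metis (no_types, lifting) mem_Collect_eq subsetI)
  show ?thesis
    by (rule analytic_continuation[OF V(4,1,2) _ _ p(2)]) (use V p z in auto)
qed

lemma hol_circle_finite_zeros:
  assumes "f \<in> hol_circle" "z0 \<in> S1" "f z0 \<noteq> 0"
  shows "finite {z\<in>S1. f z = 0}"
  using hol_circle_eq_0I assms by blast

text \<open>
This says that the ring is an integral domain: a factor that is not identically zero vanishes only at
finitely many points.
\<close>
lemma hol_circle_cancel: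
  assumes "f \<in> hol_circle" "g \<in> hol_circle" "z0 \<in> S1" "f z0 \<noteq> 0"
    and "\<And>z. z \<in> S1 \<Longrightarrow> f z * g z = 0" and "z \<in> S1"
  shows "g z = 0"
proof (rule hol_circle_eq_0I[OF assms(2) _ assms(6)])
  have "S1 - {z\<in>S1. f z = 0} \<subseteq> {z\<in>S1. g z = 0}" using assms(5) by fastforce
  moreover have "infinite (S1 - {z\<in>S1. f z = 0})"
    using infinite_S1 hol_circle_finite_zeros[OF assms(1,3,4)] by simp
  ultimately show "infinite {z\<in>S1. g z = 0}" using finite_subset by blast
qed

lemma inverse_cnj_S1: "z \<in> S1 \<Longrightarrow> inverse (cnj z) = z"
proof -
  assume "z \<in> S1"
  then have "cnj z * z = 1" by (simp add: complex_norm_square[symmetric] mult.commute)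
  then show ?thesis by (rule inverse_unique)
qed

text \<open>
Complex conjugation leaves the ring, but \<open>inverse (cnj z) = z\<close> on the circle, so this function has
the same values there as \<open>cnj \<circ> f\<close> and is holomorphic. Every conjugate that has to be analytic is
written in this form below.
\<close>
lemma hol_circle_cnj:
  assumes "f \<in> hol_circle"
  shows "(\<lambda>z. cnj (f (inverse (cnj z)))) \<in> hol_circle"
proof -
  obtain V where V: "open V" "S1 \<subseteq> V" "f holomorphic_on V"
    using assms by (auto simp: hol_circle_iff_extension)
  have op: "open (cnj ` V)" 
  proof -
    have "cnj ` V = cnj -` V" by (auto simp: image_iff) (metis complex_cnj_cnj)
    moreover have "open (cnj -` V)" by (intro continuous_open_vimage V(1)) (intro continuous_intros)
    ultimately show ?thesis by simp
  qed
  have "cnj ` cnj ` V = V" by (simp add: image_image)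
  then have "(cnj \<circ> f \<circ> cnj) holomorphic_on (cnj ` V)"
    using holomorphic_on_compose_cnj_cnj[of f "cnj ` V"] V op by simp
  moreover have "S1 \<subseteq> cnj ` V"
  proof
    fix z assume "z \<in> S1"
    then have "cnj z \<in> V" using V(2) by (auto simp: dist_norm)
    then show "z \<in> cnj ` V" by (metis complex_cnj_cnj imageI)
  qed
  ultimately have "(cnj \<circ> f \<circ> cnj) \<in> hol_circle"
    using op hol_circle_iff_extension by blast
  from hol_circle_compose[OF hol_circle_inverse_ident(2) this]
  show ?thesis by (simp add: norm_inverse o_def)
qed

section \<open>Unit vectors in the kernel of a matrix of functions\<close>

lemma hol_circle_divide_linear:
  assumes f: "f \<in> hol_circle" and b: "f b = 0"
  obtains g where "g \<in> hol_circle" "\<And>z. f z = (z - b) * g z"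
proof
  let ?g = "\<lambda>z. if z = b then deriv f b else f z / (z - b)"
  show "?g \<in> hol_circle"
    unfolding hol_circle_def mem_Collect_eq
    by (rule pole_theorem_analytic_0[of f _ b])
       (use f b in \<open>auto simp: hol_circle_def intro!: exI[of _ 1]\<close>)
  show "f z = (z - b) * ?g z" for z using b by auto
qed

text \<open>
A function that does not vanish identically has a finite order of vanishing at \<open>b\<close>, and this order is
the bound.
\<close>
lemma hol_circle_order_bound:
  assumes f: "f \<in> hol_circle" and b: "b \<in> S1" and nz: "z0 \<in> S1" "f z0 \<noteq> 0"
  shows "\<exists>M. \<forall>k h. h \<in> hol_circle \<and> (\<forall>z. f z = (z - b) ^ k * h z) \<longrightarrow> k \<le> M"
proof (cases "f b = 0")
  case False
  have "k \<le> 0" if "\<forall>z. f z = (z - b) ^ k * h z" for k h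
    using that[rule_format, of b] False by (cases k) auto
  then show ?thesis by (intro exI[of _ 0]) blast
next
  case True
  obtain V where V: "open V" "connected V" "S1 \<subseteq> V" "f holomorphic_on V"
    using hol_circle_connected_domain[OF f] .
  have nc: "\<not> f constant_on V"
  proof
    assume "f constant_on V"
    then obtain c where "\<And>v. v \<in> V \<Longrightarrow> f v = c" by (auto simp: constant_on_def)
    then have "f z0 = f b" using subsetD[OF V(3) nz(1)] subsetD[OF V(3) b] by simp
    then show False using True nz(2) by simp
  qed
  then obtain g r n where g: "0 < r" "ball b r \<subseteq> V" "g holomorphic_on ball b r"
    "\<And>w. w \<in> ball b r \<Longrightarrow> f w = (w - b) ^ n * g w" "\<And>w. w \<in> ball b r \<Longrightarrow> g w \<noteq> 0"
    using holomorphic_factor_zero_nonconstant[OF V(4,1,2) subsetD[OF V(3) b] True nc] by metis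
  have "k \<le> n" if h: "h \<in> hol_circle" "\<And>z. f z = (z - b) ^ k * h z" for k h
  proof (rule ccontr)
    assume "\<not> k \<le> n"
    then have kn: "k = n + (k - n)" "k - n > 0" by auto
    have "isCont g b"
      using g(1,3) holomorphic_on_imp_continuous_on continuous_on_interior
      by (metis centre_in_ball interior_ball)
    then have 1: "g \<midarrow>b\<rightarrow> g b" by (simp add: isCont_def)
    have "isCont h b"
      using h(1) b unfolding hol_circle_def
      by (metis analytic_at_imp_isCont analytic_on_analytic_at mem_Collect_eq)
    then have "isCont (\<lambda>w. (w - b) ^ (k - n) * h w) b"
      by (intro continuous_intros)
    then have 2: "(\<lambda>w. (w - b) ^ (k - n) * h w) \<midarrow>b\<rightarrow> 0"
      using kn(2) by (simp add: isCont_def power_0_left)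
    have "\<forall>\<^sub>F w in at b. w \<in> ball b r - {b}"
      using g(1) by (intro eventually_at_in_open) auto
    then have "\<forall>\<^sub>F w in at b. g w = (w - b) ^ (k - n) * h w"
    proof eventually_elim
      case (elim w)
      then have "(w - b) ^ n * g w = (w - b) ^ n * ((w - b) ^ (k - n) * h w)"
        using g(4)[of w] h(2)[of w] kn(1) by (simp add: power_add[symmetric] mult.assoc[symmetric])
      with elim show ?case by auto
    qed
    then have "g \<midarrow>b\<rightarrow> 0" using 2 by (simp add: tendsto_cong)
    with 1 have "g b = 0" using LIM_unique by blast
    with g(1,5) show False by auto
  qed
  then show ?thesis by blast
qed

text \<open>
All entries are divided by the highest power of \<open>z - b\<close> that divides each of them; after that some
entry is nonzero at \<open>b\<close>.
\<close>
lemma remove_zero_at: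
  assumes J: "finite J" "\<And>j. j \<in> J \<Longrightarrow> x j \<in> hol_circle" and b: "b \<in> S1"
    and nz: "i \<in> J" "z0 \<in> S1" "x i z0 \<noteq> 0"
  obtains m y where "\<And>j. j \<in> J \<Longrightarrow> y j \<in> hol_circle"
    "\<And>j z. j \<in> J \<Longrightarrow> x j z = (z - b) ^ m * y j z" "\<exists>j\<in>J. y j b \<noteq> 0"
proof -
  define P where "P k \<longleftrightarrow> (\<exists>y. \<forall>j\<in>J. y j \<in> hol_circle \<and> (\<forall>z. x j z = (z - b) ^ k * y j z))" for k
  obtain M where M: "\<And>k h. h \<in> hol_circle \<Longrightarrow> (\<forall>z. x i z = (z - b) ^ k * h z) \<Longrightarrow> k \<le> M"
    using hol_circle_order_bound[OF J(2)[OF nz(1)] b nz(2,3)] by blast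
  have bd: "\<forall>k. P k \<longrightarrow> k \<le> M" unfolding P_def using M nz(1) by blast
  have P0: "P 0" unfolding P_def using J by auto
  define m where "m = (GREATEST k. P k)"
  have "P m" unfolding m_def by (rule GreatestI_nat[of P 0 M]) (use P0 bd in auto)
  then obtain y where y: "\<And>j. j \<in> J \<Longrightarrow> y j \<in> hol_circle"
      "\<And>j z. j \<in> J \<Longrightarrow> x j z = (z - b) ^ m * y j z"
    unfolding P_def by blast
  have "\<exists>j\<in>J. y j b \<noteq> 0"
  proof (rule ccontr)
    assume "\<not> (\<exists>j\<in>J. y j b \<noteq> 0)"
    then have "\<forall>j\<in>J. \<exists>g. g \<in> hol_circle \<and> (\<forall>z. y j z = (z - b) * g z)"
      using hol_circle_divide_linear y(1) by metis
    then obtain g where "\<forall>j\<in>J. g j \<in> hol_circle \<and> (\<forall>z. y j z = (z - b) * g j z)" by metis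
    then have "P (Suc m)" unfolding P_def using y(2) by (intro exI[of _ g]) (auto simp: mult.assoc)
    then have "Suc m \<le> m" unfolding m_def by (intro Greatest_le_nat[of P _ M]) (use bd in auto)
    then show False by simp
  qed
  then show ?thesis using that y by blast
qed

text \<open>
Each step removes one common zero from the vector without creating a new one, and there are only finitely
many of them.
\<close>
lemma remove_common_zeros:
  assumes J: "finite J" "\<And>j. j \<in> J \<Longrightarrow> x j \<in> hol_circle"
    and nz: "i \<in> J" "z0 \<in> S1" "x i z0 \<noteq> 0"
  shows "\<exists>f y. f \<in> hol_circle \<and> (\<forall>j\<in>J. y j \<in> hol_circle \<and> (\<forall>z\<in>S1. x j z = f z * y j z))
     \<and> (\<forall>z\<in>S1. \<exists>j\<in>J. y j z \<noteq> 0)"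
  using J(2) nz(3)
proof (induction "card {z\<in>S1. \<forall>j\<in>J. x j z = 0}" arbitrary: x rule: less_induct)
  case less
  let ?Z = "\<lambda>x. {z\<in>S1. \<forall>j\<in>J. x j z = (0::complex)}"
  have fin: "finite (?Z x)"
    by (rule finite_subset[OF _ hol_circle_finite_zeros[OF less.prems(1)[OF nz(1)] nz(2) less.prems(2)]])
       (use nz in auto)
  show ?case
  proof (cases "?Z x = {}")
    case True
    then show ?thesis using less.prems by (intro exI[of _ "\<lambda>_. 1"] exI[of _ x]) auto
  next
    case False
    then obtain b where b: "b \<in> S1" "\<And>j. j \<in> J \<Longrightarrow> x j b = 0" by auto
    obtain m y where y: "\<And>j. j \<in> J \<Longrightarrow> y j \<in> hol_circle"
      "\<And>j z. j \<in> J \<Longrightarrow> x j z = (z - b) ^ m * y j z" "\<exists>j\<in>J. y j b \<noteq> 0"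
      using remove_zero_at[where x=x, OF J(1) less.prems(1) b(1) nz(1,2) less.prems(2)] by metis
    have yi: "y i z0 \<noteq> 0" using y(2)[OF nz(1), of z0] less.prems(2) by auto
    have "b \<notin> ?Z y" "b \<in> ?Z x" using y(3) b by auto
    moreover have "?Z y \<subseteq> ?Z x" using y(2) by auto
    ultimately have "?Z y \<subset> ?Z x" by blast
    then have "card (?Z y) < card (?Z x)" by (rule psubset_card_mono[OF fin])
    then have "\<exists>f v. f \<in> hol_circle \<and> (\<forall>j\<in>J. v j \<in> hol_circle \<and> (\<forall>z\<in>S1. y j z = f z * v j z)) \<and>
        (\<forall>z\<in>S1. \<exists>j\<in>J. v j z \<noteq> 0)"
      by (rule less.hyps[of y, OF _ y(1) yi])
    then obtain f v where
      f: "f \<in> hol_circle" "\<forall>j\<in>J. v j \<in> hol_circle \<and> (\<forall>z\<in>S1. y j z = f z * v j z)"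
      "\<forall>z\<in>S1. \<exists>j\<in>J. v j z \<noteq> 0" by (elim exE conjE)
    show ?thesis
    proof (intro exI[of _ "\<lambda>z. (z - b) ^ m * f z"] exI[of _ v] conjI ballI)
      show "(\<lambda>z. (z - b) ^ m * f z) \<in> hol_circle" using f(1) by (intro hol_circle_intros)
      show "v j \<in> hol_circle" if "j \<in> J" for j using f(2) that by simp
      show "x j z = (z - b) ^ m * f z * v j z" if "j \<in> J" "z \<in> S1" for j z
        using f(2) y(2) that by (simp add: mult.assoc)
      show "\<exists>j\<in>J. v j z \<noteq> 0" if "z \<in> S1" for z using f(3) that by (rule bspec)
    qed
  qed
qed

text \<open>
Once the common zeros are gone, the squared norm is positive on the circle and analytic, so the
principal square root of it is analytic as well. Dividing by it preserves every linear relation with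
coefficients in the ring, up to the factor \<open>f\<close>, which can be cancelled.
\<close>
lemma normalize_vector:
  assumes J: "finite J" "\<And>j. j \<in> J \<Longrightarrow> x j \<in> hol_circle"
    and nz: "i \<in> J" "z0 \<in> S1" "x i z0 \<noteq> 0"
  obtains f u where "f \<in> hol_circle" "f z0 \<noteq> 0" "\<And>j. j \<in> J \<Longrightarrow> u j \<in> hol_circle"
    "\<And>j z. j \<in> J \<Longrightarrow> z \<in> S1 \<Longrightarrow> x j z = f z * u j z"
    "\<And>z. z \<in> S1 \<Longrightarrow> (\<Sum>j\<in>J. cnj (u j z) * u j z) = 1"
proof -
  have "\<exists>f y. f \<in> hol_circle \<and> (\<forall>j\<in>J. y j \<in> hol_circle \<and> (\<forall>z\<in>S1. x j z = f z * y j z)) \<and>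
      (\<forall>z\<in>S1. \<exists>j\<in>J. y j z \<noteq> 0)"
    by (rule remove_common_zeros[where x=x, OF assms])
  then obtain f y where f: "f \<in> hol_circle" and
    fy: "\<forall>j\<in>J. y j \<in> hol_circle \<and> (\<forall>z\<in>S1. x j z = f z * y j z)" "\<forall>z\<in>S1. \<exists>j\<in>J. y j z \<noteq> 0"
    by (elim exE conjE)
  have y: "\<And>j. j \<in> J \<Longrightarrow> y j \<in> hol_circle"
     "\<And>j z. j \<in> J \<Longrightarrow> z \<in> S1 \<Longrightarrow> x j z = f z * y j z"
     "\<And>z. z \<in> S1 \<Longrightarrow> \<exists>j\<in>J. y j z \<noteq> 0"
    using fy by simp_all
  define s where "s z = (\<Sum>j\<in>J. cnj (y j (inverse (cnj z))) * y j z)" for z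
  have s: "s \<in> hol_circle"
    unfolding s_def using y by (intro hol_circle_intros hol_circle_cnj) auto
  have s_eq: "s z = of_real (\<Sum>j\<in>J. (cmod (y j z))\<^sup>2)" if "z \<in> S1" for z
    using that by (simp add: s_def inverse_cnj_S1 complex_norm_square[unfolded of_real_power] mult.commute)
  have s_pos: "(\<Sum>j\<in>J. (cmod (y j z))\<^sup>2) > 0" if z: "z \<in> S1" for z
  proof -
    obtain j where "j \<in> J" "y j z \<noteq> 0" using y(3)[OF z] by blast
    then show ?thesis by (intro sum_pos2[OF J(1)]) auto
  qed
  have nn: "s z \<notin> \<real>\<^sub>\<le>\<^sub>0" if "z \<in> S1" for z
    unfolding s_eq[OF that] nonpos_Reals_of_real_iff using s_pos[OF that] by simp
  define c where "c z = csqrt (s z)" for z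
  have c: "c \<in> hol_circle" 
    unfolding c_def hol_circle_def mem_Collect_eq
    by (rule analytic_on_csqrt') (use s nn in \<open>auto simp: hol_circle_def\<close>)
  have cnz: "c z \<noteq> 0" if "z \<in> S1" for z
    using s_eq[OF that] s_pos[OF that] by (auto simp: c_def)
  have c2: "cnj (c z) * c z = s z" if "z \<in> S1" for z
  proof -
    define r where "r = (\<Sum>j\<in>J. (cmod (y j z))\<^sup>2)"
    have "r > 0" using s_pos[OF that] by (simp add: r_def)
    moreover have "s z = of_real r" using s_eq[OF that] by (simp add: r_def)
    ultimately have "c z = of_real (sqrt r)" "sqrt r * sqrt r = r" by (simp_all add: c_def)
    then show ?thesis using \<open>s z = of_real r\<close> by (simp flip: of_real_mult)
  qed
  show ?thesis
  proof (rule that[of "\<lambda>z. f z * c z" "\<lambda>j z. y j z / c z"])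
    show "(\<lambda>z. f z * c z) \<in> hol_circle" using f c by (intro hol_circle_intros)
    show "f z0 * c z0 \<noteq> 0" using nz y(2)[OF nz(1,2)] cnz by auto
    show "(\<lambda>z. y j z / c z) \<in> hol_circle" if "j \<in> J" for j
      using that y c cnz by (intro hol_circle_divide) auto
    show "x j z = f z * c z * (y j z / c z)" if "j \<in> J" "z \<in> S1" for j z
      using that y cnz by simp
    show "(\<Sum>j\<in>J. cnj (y j z / c z) * (y j z / c z)) = 1" if z: "z \<in> S1" for z
    proof -
      have "(\<Sum>j\<in>J. cnj (y j z / c z) * (y j z / c z)) = (\<Sum>j\<in>J. cnj (y j z) * y j z) / (cnj (c z) * c z)"
        by (simp add: sum_divide_distrib)
      also have "(\<Sum>j\<in>J. cnj (y j z) * y j z) = s z" using z by (simp add: s_def inverse_cnj_S1)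
      finally show ?thesis using c2[OF z] cnz[OF z] by auto
    qed
  qed
qed

text \<open>
Fraction-free Gaussian elimination by induction on the set of unknowns. A coefficient that does not
vanish identically eliminates its unknown at all points except its finitely many zeros; this is why the
hypothesis allows a finite exceptional set. The rows are indexed by an arbitrary, possibly infinite, set
because the orbit of a vector under all powers of a matrix is used as a system of equations later.
\<close>
lemma analytic_kernel_vector:
  assumes "finite J" "\<And>i j. i \<in> I \<Longrightarrow> j \<in> J \<Longrightarrow> a i j \<in> hol_circle" "finite F"
    and "\<And>z. z \<in> S1 - F \<Longrightarrow> \<exists>x. (\<exists>j\<in>J. x j \<noteq> 0) \<and> (\<forall>i\<in>I. (\<Sum>j\<in>J. a i j z * x j) = 0)"
  shows "\<exists>x. (\<forall>j\<in>J. x j \<in> hol_circle) \<and> (\<exists>j\<in>J. \<exists>z\<in>S1. x j z \<noteq> 0) \<and>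
     (\<forall>i\<in>I. \<forall>z\<in>S1. (\<Sum>j\<in>J. a i j z * x j z) = 0)"
  using assms
proof (induction J arbitrary: a F rule: finite_psubset_induct)
  case (psubset J)
  have "infinite (S1 - F)" using infinite_S1 psubset.prems(2) by simp
  then obtain z1 where z1: "z1 \<in> S1 - F" using infinite_imp_nonempty by blast
  show ?case
  proof (cases "\<forall>i\<in>I. \<forall>j\<in>J. \<forall>z\<in>S1. a i j z = 0")
    case True
    obtain j where "j \<in> J" using psubset.prems(3)[OF z1] by (elim exE conjE bexE)
    have "(\<Sum>j\<in>J. a i j z * 1) = 0" if "i \<in> I" "z \<in> S1" for i z
      using True that by (intro sum.neutral) simp
    moreover have "\<exists>j\<in>J. \<exists>z\<in>S1. (1::complex) \<noteq> 0" using z1 \<open>j \<in> J\<close> by auto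
    ultimately show ?thesis
      by (intro exI[of _ "\<lambda>_ _. 1"]) (simp only: hol_circle_const ball_simps simp_thms, simp)
  next
    case False
    then obtain i0 j0 z0 where i0: "i0 \<in> I" "j0 \<in> J" "z0 \<in> S1" "a i0 j0 z0 \<noteq> 0" by blast
    let ?p = "a i0 j0"
    let ?J = "J - {j0}"
    \<comment> \<open>coefficients of the system from which the unknown \<open>j0\<close> has been eliminated\<close>
    define b where "b i j z = ?p z * a i j z - a i j0 z * a i0 j z" for i j z
    define F' where "F' = F \<union> {z\<in>S1. ?p z = 0}"
    have split: "(\<Sum>j\<in>J. h j) = h j0 + (\<Sum>j\<in>?J. h j)" for h :: "_ \<Rightarrow> complex"
      by (rule sum.remove[OF psubset.hyps i0(2)])
    have "\<exists>y. (\<forall>j\<in>?J. y j \<in> hol_circle) \<and> (\<exists>j\<in>?J. \<exists>z\<in>S1. y j z \<noteq> 0) \<and>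
     (\<forall>i\<in>I. \<forall>z\<in>S1. (\<Sum>j\<in>?J. b i j z * y j z) = 0)"
    proof (rule psubset.IH)
      show "?J \<subset> J" using i0 by auto
      show "b i j \<in> hol_circle" if "i \<in> I" "j \<in> ?J" for i j
        unfolding b_def using that i0 psubset.prems(1) by (intro hol_circle_intros) auto
      show "finite F'" unfolding F'_def
        using psubset.prems(2) hol_circle_finite_zeros[OF psubset.prems(1)[OF i0(1,2)] i0(3,4)] by simp
      fix z assume "z \<in> S1 - F'"
      then have z: "z \<in> S1 - F" "?p z \<noteq> 0" by (auto simp: F'_def)
      obtain x where x0: "(\<exists>j\<in>J. x j \<noteq> 0) \<and> (\<forall>i\<in>I. (\<Sum>j\<in>J. a i j z * x j) = 0)"
        using psubset.prems(3)[OF z(1)] ..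
      have x: "\<exists>j\<in>J. x j \<noteq> 0" "\<And>i. i \<in> I \<Longrightarrow> (\<Sum>j\<in>J. a i j z * x j) = 0" 
        using x0 by auto
      have "\<exists>j\<in>?J. x j \<noteq> 0"
      proof (rule ccontr)
        assume *: "\<not> (\<exists>j\<in>?J. x j \<noteq> 0)"
        then have "x j0 \<noteq> 0" using x(1) by auto
        moreover have "(\<Sum>j\<in>?J. a i0 j z * x j) = 0" using * by (intro sum.neutral) auto
        ultimately show False using x(2)[OF i0(1)] z(2) by (simp only: split) simp
      qed
      moreover have "(\<Sum>j\<in>?J. b i j z * x j) = 0" if "i \<in> I" for i
      proof -
        have "(\<Sum>j\<in>?J. b i j z * x j) = (\<Sum>j\<in>J. b i j z * x j)"
          unfolding split by (simp add: b_def)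
        also have "\<dots> = ?p z * (\<Sum>j\<in>J. a i j z * x j) - a i j0 z * (\<Sum>j\<in>J. a i0 j z * x j)"
          by (simp add: b_def sum_distrib_left left_diff_distrib sum_subtractf mult.assoc)
        finally show ?thesis using x(2) i0 that by simp
      qed
      ultimately show "\<exists>x. (\<exists>j\<in>?J. x j \<noteq> 0) \<and> (\<forall>i\<in>I. (\<Sum>j\<in>?J. b i j z * x j) = 0)"
        by (intro exI[of _ x] conjI ballI)
    qed
    then obtain y where y0: "(\<forall>j\<in>?J. y j \<in> hol_circle) \<and> (\<exists>j\<in>?J. \<exists>z\<in>S1. y j z \<noteq> 0) \<and>
     (\<forall>i\<in>I. \<forall>z\<in>S1. (\<Sum>j\<in>?J. b i j z * y j z) = 0)" ..
    then obtain j1 z2 where y: "\<And>j. j \<in> ?J \<Longrightarrow> y j \<in> hol_circle" "j1 \<in> ?J" "z2 \<in> S1" "y j1 z2 \<noteq> 0"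
      by blast
    have y5: "\<And>i z. i \<in> I \<Longrightarrow> z \<in> S1 \<Longrightarrow> (\<Sum>j\<in>?J. b i j z * y j z) = 0" using y0 by blast
    define x where "x j z = (if j = j0 then - (\<Sum>j\<in>?J. a i0 j z * y j z) else ?p z * y j z)" for j z
    have "x j \<in> hol_circle" if "j \<in> J" for j
    proof (cases "j = j0")
      case True
      then have "x j = (\<lambda>z. - (\<Sum>j\<in>?J. a i0 j z * y j z))" by (auto simp: x_def)
      then show ?thesis using y(1) psubset.prems(1) i0 by (auto intro!: hol_circle_intros)
    next
      case False
      then have "x j = (\<lambda>z. ?p z * y j z)" by (auto simp: x_def)
      then show ?thesis using False that y(1) psubset.prems(1) i0 by (auto intro!: hol_circle_intros)
    qed
    moreover have "\<exists>j\<in>J. \<exists>z\<in>S1. x j z \<noteq> 0"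
    proof -
      have "\<exists>z\<in>S1. x j1 z \<noteq> 0"
      proof (rule ccontr)
      assume "\<not> (\<exists>z\<in>S1. x j1 z \<noteq> 0)"
      then have "\<And>z. z \<in> S1 \<Longrightarrow> ?p z * y j1 z = 0" using y(2) unfolding x_def by simp
      then have "y j1 z2 = 0"
        using hol_circle_cancel[OF psubset.prems(1)[OF i0(1,2)] y(1)[OF y(2)] i0(3,4) _ y(3)] by simp
      with y show False by simp
      qed
      then show ?thesis using y(2) by blast
    qed
    moreover have "(\<Sum>j\<in>J. a i j z * x j z) = 0" if "i \<in> I" "z \<in> S1" for i z
    proof -
      have "(\<Sum>j\<in>J. a i j z * x j z) = (\<Sum>j\<in>?J. b i j z * y j z)"
      proof -
        have "(\<Sum>j\<in>?J. a i j z * x j z) = (\<Sum>j\<in>?J. ?p z * a i j z * y j z)"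
          by (intro sum.cong) (auto simp: x_def)
        moreover have "a i j0 z * x j0 z = - (\<Sum>j\<in>?J. a i j0 z * a i0 j z * y j z)"
          by (simp add: x_def sum_distrib_left mult.assoc)
        ultimately show ?thesis
          by (simp only: split b_def left_diff_distrib sum_subtractf) simp
      qed
      then show ?thesis using y5 that by simp
    qed
    ultimately show ?thesis by (intro exI[of _ x] conjI ballI)
  qed
qed

lemma unit_kernel_vector:
  assumes J: "finite J" and a: "\<And>i j. i \<in> I \<Longrightarrow> j \<in> J \<Longrightarrow> a i j \<in> hol_circle"
    and ker: "\<And>z. z \<in> S1 \<Longrightarrow> \<exists>x. (\<exists>j\<in>J. x j \<noteq> 0) \<and> (\<forall>i\<in>I. (\<Sum>j\<in>J. a i j z * x j) = 0)"
  obtains u where "\<And>j. j \<in> J \<Longrightarrow> u j \<in> hol_circle"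
    "\<And>z. z \<in> S1 \<Longrightarrow> (\<Sum>j\<in>J. cnj (u j z) * u j z) = 1"
    "\<And>i z. i \<in> I \<Longrightarrow> z \<in> S1 \<Longrightarrow> (\<Sum>j\<in>J. a i j z * u j z) = 0"
proof -
  have "\<exists>x. (\<forall>j\<in>J. x j \<in> hol_circle) \<and> (\<exists>j\<in>J. \<exists>z\<in>S1. x j z \<noteq> 0) \<and>
     (\<forall>i\<in>I. \<forall>z\<in>S1. (\<Sum>j\<in>J. a i j z * x j z) = 0)"
    by (rule analytic_kernel_vector[where F = "{}", OF J a]) (use ker in auto)
  then obtain x j0 z0 where x: "\<forall>j\<in>J. x j \<in> hol_circle" "j0 \<in> J" "z0 \<in> S1" "x j0 z0 \<noteq> 0"
     "\<forall>i\<in>I. \<forall>z\<in>S1. (\<Sum>j\<in>J. a i j z * x j z) = 0" by (elim exE conjE bexE)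
  have xh: "\<And>j. j \<in> J \<Longrightarrow> x j \<in> hol_circle" using x(1) by simp
  show ?thesis
  proof (rule normalize_vector[where x=x, OF J xh x(2,3,4)])
    fix f u
    assume f: "f \<in> hol_circle" "f z0 \<noteq> 0" and u: "\<And>j. j \<in> J \<Longrightarrow> u j \<in> hol_circle"
    "\<And>j z. j \<in> J \<Longrightarrow> z \<in> S1 \<Longrightarrow> x j z = f z * u j z"
    "\<And>z. z \<in> S1 \<Longrightarrow> (\<Sum>j\<in>J. cnj (u j z) * u j z) = 1"
    have ker_u: "(\<Sum>j\<in>J. a i j z * u j z) = 0" if i: "i \<in> I" and z: "z \<in> S1" for i z
    proof (rule hol_circle_cancel[OF f(1) _ x(3) f(2) _ z, of "\<lambda>z. \<Sum>j\<in>J. a i j z * u j z"])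
      show "(\<lambda>z. \<Sum>j\<in>J. a i j z * u j z) \<in> hol_circle"
        by (intro hol_circle_sum hol_circle_mult a i u(1))
      fix z assume z: "z \<in> S1"
      have "f z * (\<Sum>j\<in>J. a i j z * u j z) = (\<Sum>j\<in>J. a i j z * x j z)"
        unfolding sum_distrib_left by (intro sum.cong refl) (simp add: u(2)[OF _ z])
      then show "f z * (\<Sum>j\<in>J. a i j z * u j z) = 0" using x(5) i z by simp
    qed
    show thesis by (rule that[OF u(1,3) ker_u])
  qed
qed

section \<open>Root functions of a monic family with simple roots\<close>

text \<open>
The modulus of the value at \<open>x\<close> is the product of the distances from \<open>x\<close> to the roots, so one of
them is small.
\<close>
lemma monic_root_near:
  fixes p :: "complex poly"
  assumes "lead_coeff p = 1" "degree p > 0" "r > 0" "cmod (poly p x) < r ^ degree p"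
  obtains a where "poly p a = 0" "dist a x < r"
proof -
  obtain as where as: "Polynomial.smult (coeff p (degree p)) (\<Prod>a\<leftarrow>as. [:- a, 1:]) = p" "length as = degree p"
    using fundamental_theorem_algebra_factorized[of p] by blast
  have ev: "poly p y = (\<Prod>a\<leftarrow>as. y - a)" for y
  proof -
    have "p = (\<Prod>a\<leftarrow>as. [:- a, 1:])" using as assms(1) by simp
    then show ?thesis by (simp add: poly_prod_list o_def)
  qed
  have "\<exists>a\<in>set as. dist a x < r"
  proof (rule ccontr)
    assume "\<not> (\<exists>a\<in>set as. dist a x < r)"
    then have "\<forall>a\<in>set as. r \<le> cmod (x - a)" by (auto simp: dist_norm norm_minus_commute)
    then have "r ^ length as \<le> cmod (\<Prod>a\<leftarrow>as. x - a)"
    proof (induction as)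
      case (Cons a as)
      then show ?case using assms(3) by (auto simp: norm_mult intro!: mult_mono)
    qed simp
    with assms(4) as(2) ev show False by simp
  qed
  then obtain a where a: "a \<in> set as" "dist a x < r" by blast
  then have "poly p a = 0" unfolding ev by (auto simp: prod_list_zero_iff)
  with a(2) show ?thesis using that by blast
qed

text \<open>
For a root \<open>x\<close> of modulus above 1, dividing the equation by \<open>x ^ (n - 1)\<close> bounds \<open>cmod x\<close> by the sum
of the moduli of the lower coefficients.
\<close>
lemma monic_root_bound:
  fixes p :: "complex poly"
  assumes "degree p = n" "n > 0" "coeff p n = 1" "poly p x = 0"
  shows "cmod x \<le> 1 + (\<Sum>k<n. cmod (coeff p k))"
proof (cases "cmod x \<le> 1")
  case True
  then show ?thesis using sum_nonneg[of "{..<n}" "\<lambda>k. cmod (coeff p k)"] by simp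
next
  case False
  have "poly p x = (\<Sum>k<n. coeff p k * x ^ k) + x ^ n"
    using assms by (simp add: poly_altdef flip: lessThan_Suc_atMost)
  then have "x ^ n = - (\<Sum>k<n. coeff p k * x ^ k)" using assms(4) by (simp add: eq_neg_iff_add_eq_0 add.commute)
  then have "cmod x ^ n = cmod (\<Sum>k<n. coeff p k * x ^ k)" by (simp flip: norm_power)
  also have "\<dots> \<le> (\<Sum>k<n. cmod (coeff p k) * cmod x ^ (n - 1))"
  proof (rule sum_norm_le)
    fix k assume "k \<in> {..<n}"
    then have "cmod x ^ k \<le> cmod x ^ (n - 1)" using False by (intro power_increasing) auto
    then show "cmod (coeff p k * x ^ k) \<le> cmod (coeff p k) * cmod x ^ (n - 1)"
      by (simp add: norm_mult norm_power mult_left_mono)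
  qed
  finally have "cmod x * cmod x ^ (n - 1) \<le> (\<Sum>k<n. cmod (coeff p k)) * cmod x ^ (n - 1)"
    using assms(2) by (simp add: sum_distrib_right flip: power_Suc)
  moreover have "cmod x ^ (n - 1) > 0" using False by (intro zero_less_power) linarith
  ultimately have "cmod x \<le> (\<Sum>k<n. cmod (coeff p k))" by simp
  then show ?thesis by simp
qed

text \<open>
Half the least distance of two distinct points will do.
\<close>
lemma finite_separation:
  fixes R :: "complex set"
  assumes "finite R"
  obtains r where "r > 0"
    "\<And>a b x. a \<in> R \<Longrightarrow> b \<in> R \<Longrightarrow> dist a x < r \<Longrightarrow> dist b x < r \<Longrightarrow> a = b"
proof -
  \<comment> \<open>the element 1 keeps \<open>D\<close> nonempty when \<open>R\<close> has fewer than two points\<close>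
  define D where "D = insert 1 ((\<lambda>(a,b). dist a b) ` {(a,b) \<in> R \<times> R. a \<noteq> b})"
  have "finite {(a,b) \<in> R \<times> R. a \<noteq> b}"
    by (rule finite_subset[of _ "R \<times> R"]) (use assms in auto)
  then have fin: "finite D" unfolding D_def by simp
  have "Min D > 0" using fin by (subst Min_gr_iff) (auto simp: D_def)
  moreover have "Min D \<le> dist a b" if "a \<in> R" "b \<in> R" "a \<noteq> b" for a b
    by (rule Min_le[OF fin]) (use that in \<open>auto simp: D_def\<close>)
  moreover have "dist a b \<le> dist a x + dist b x" for a b x :: complex by (rule dist_triangle2)
  ultimately show ?thesis by (intro that[of "Min D / 2"]) (auto, smt (verit))
qed

text \<open>
Degree and leading coefficient are fixed for all parameters, as they are for characteristic polynomials,
while holomorphy is a condition on the open set \<open>S\<close> alone.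
\<close>
locale monic_family =
  fixes P :: "complex \<Rightarrow> complex poly" and n :: nat and S :: "complex set"
  assumes n: "n > 0" and S: "open S"
    and deg: "\<And>t. degree (P t) = n" and monic: "\<And>t. coeff (P t) n = 1"
    and hol: "\<And>k. (\<lambda>t. coeff (P t) k) holomorphic_on S"
begin

lemma poly_eq: "poly (P t) x = (\<Sum>k\<le>n. coeff (P t) k * x ^ k)"
  by (simp add: poly_altdef deg)

lemma P_nonzero: "P t \<noteq> 0" using deg n by (metis degree_0 less_irrefl)

lemma holomorphic_value: "(\<lambda>t. poly (P t) x) holomorphic_on S"
  unfolding poly_eq by (intro holomorphic_intros hol)

lemma continuous_value:
  assumes "continuous_on T f" "continuous_on T g" "f ` T \<subseteq> S"
  shows "continuous_on T (\<lambda>t. poly (P (f t)) (g t))"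
proof -
  have "continuous_on T (\<lambda>t. coeff (P (f t)) k)" for k
    by (rule continuous_on_compose2[OF holomorphic_on_imp_continuous_on[OF hol] assms(1,3)])
  then show ?thesis unfolding poly_eq by (intro continuous_intros assms)
qed

text \<open>
Roots persist under small changes of the parameter, since \<open>poly (P t) x0\<close> is continuous in \<open>t\<close>.
\<close>
lemma eventually_root_near:
  assumes "t0 \<in> S" "poly (P t0) x0 = 0" "r > 0"
  shows "\<forall>\<^sub>F t in nhds t0. \<exists>x. poly (P t) x = 0 \<and> dist x x0 < r"
proof -
  have "isCont (\<lambda>t. poly (P t) x0) t0"
    using holomorphic_on_imp_continuous_on[OF holomorphic_value] S assms(1)
    by (simp add: continuous_on_eq_continuous_at)
  then have "((\<lambda>t. poly (P t) x0) \<longlongrightarrow> 0) (nhds t0)"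
    using assms(2) by (simp add: continuous_at tendsto_nhds_iff)
  moreover have "0 < r ^ n" using assms(3) by simp
  ultimately have "\<forall>\<^sub>F t in nhds t0. dist (poly (P t) x0) 0 < r ^ n"
    by (rule tendstoD)
  then show ?thesis
  proof eventually_elim
    case (elim t)
    then show ?case
      using monic_root_near[of "P t" r x0] deg monic n assms(3) by auto metis
  qed
qed

text \<open>
Over a point with \<open>n\<close> distinct roots, disjoint balls around them each contain a root for nearby
parameters; as there are at most \<open>n\<close> roots, each ball contains exactly one and there are no others. These
roots are the sheets.
\<close>
lemma covering_roots:
  assumes H: "open H" "H \<subseteq> S" and simple: "\<And>t. t \<in> H \<Longrightarrow> rsquarefree (P t)"
  shows "covering_space {(t, x). t \<in> H \<and> poly (P t) x = 0} fst H"
proof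
  let ?C = "{(t, x). t \<in> H \<and> poly (P t) x = 0}"
  show "continuous_on ?C fst" by (intro continuous_intros)
  show "fst ` ?C = H"
  proof -
    have "\<exists>x. poly (P t) x = 0" for t
      using fundamental_theorem_of_algebra[of "P t"] deg n by (simp add: constant_degree)
    then show ?thesis by (force simp: image_iff)
  qed
  fix t0 assume t0: "t0 \<in> H"
  define R where "R = {x. poly (P t0) x = 0}"
  have finR: "finite R" unfolding R_def by (rule poly_roots_finite[OF P_nonzero])
  have cardR: "card R = n"
    unfolding R_def using simple[OF t0] deg[of t0] rsquarefree_card_degree[OF P_nonzero[of t0]] by simp
  obtain r where r: "r > 0"
      "\<And>a b x. a \<in> R \<Longrightarrow> b \<in> R \<Longrightarrow> dist a x < r \<Longrightarrow> dist b x < r \<Longrightarrow> a = b"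
    using finite_separation[OF finR] by blast
  have "\<forall>\<^sub>F t in nhds t0. t \<in> H \<and> (\<forall>a\<in>R. \<exists>x. poly (P t) x = 0 \<and> dist x a < r)"
    using t0 H r finR unfolding R_def
    by (intro eventually_conj eventually_nhds_in_open eventually_ball_finite) 
       (auto intro!: eventually_root_near)
  then obtain T where T: "open T" "t0 \<in> T" "\<And>t. t \<in> T \<Longrightarrow> t \<in> H"
    "\<And>t a. t \<in> T \<Longrightarrow> a \<in> R \<Longrightarrow> \<exists>x. poly (P t) x = 0 \<and> dist x a < r"
    unfolding eventually_nhds by auto
  define s where "s t a = (SOME x. poly (P t) x = 0 \<and> dist x a < r)" for t a
  have s: "poly (P t) (s t a) = 0" "dist (s t a) a < r" if "t \<in> T" "a \<in> R" for t a
    using someI_ex[OF T(4)[OF that]] by (auto simp: s_def)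
  have same: "a = b" if "a \<in> R" "b \<in> R" "dist x a < r" "dist x b < r" for a b x
    using r(2)[OF that(1,2)] that(3,4) by (simp add: dist_commute)
  have onto: "\<exists>a\<in>R. x = s t a" if "t \<in> T" "poly (P t) x = 0" for t x
  proof -
    have inj: "inj_on (s t) R"
    proof (rule inj_onI)
      fix a b assume "a \<in> R" "b \<in> R" "s t a = s t b"
      then show "a = b" using same[of a b "s t a"] s(2)[OF that(1)] by metis
    qed
    have "s t ` R = {x. poly (P t) x = 0}"
    proof (rule card_seteq)
      show "finite {x. poly (P t) x = 0}" by (rule poly_roots_finite[OF P_nonzero])
      show "s t ` R \<subseteq> {x. poly (P t) x = 0}" using s(1) that(1) by auto
      show "card {x. poly (P t) x = 0} \<le> card (s t ` R)"
        using card_image[OF inj] cardR card_poly_roots_bound[OF P_nonzero, of t] deg by simp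
    qed
    with that(2) show ?thesis by auto
  qed
  have uniq: "x = s t a" if "t \<in> T" "a \<in> R" "poly (P t) x = 0" "dist x a < r" for t a x
  proof -
    from onto[OF that(1,3)] obtain b where b: "b \<in> R" "x = s t b" by blast
    then have "a = b" using same[of a b x] s(2)[of t b] that by simp
    with b show ?thesis by simp
  qed
  define u where "u a = {(t, x). t \<in> T \<and> poly (P t) x = 0 \<and> dist x a < r}" for a
  show "\<exists>T. t0 \<in> T \<and> openin (top_of_set H) T \<and> (\<exists>v. \<Union>v = ?C \<inter> fst -` T \<and>
         (\<forall>u\<in>v. openin (top_of_set ?C) u) \<and> pairwise disjnt v \<and> (\<forall>u\<in>v. \<exists>q. homeomorphism u T fst q))"
  proof (intro exI[of _ T] conjI exI[of _ "u ` R"] ballI)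
    show "t0 \<in> T" by fact
    show "openin (top_of_set H) T" using T H by (auto intro: openin_open_eq[THEN iffD2])
    show "\<Union> (u ` R) = ?C \<inter> fst -` T"
    proof
      show "\<Union> (u ` R) \<subseteq> ?C \<inter> fst -` T" using T(3) by (auto simp: u_def)
      show "?C \<inter> fst -` T \<subseteq> \<Union> (u ` R)"
      proof
        fix y assume "y \<in> ?C \<inter> fst -` T"
        then obtain t x where y: "y = (t, x)" "t \<in> T" "poly (P t) x = 0" by auto
        obtain a where "a \<in> R" "x = s t a" using onto[OF y(2,3)] by blast
        then show "y \<in> \<Union> (u ` R)" using y s(2) by (auto simp: u_def)
      qed
    qed
    show "pairwise disjnt (u ` R)"
    proof (rule pairwiseI)
      fix U V assume "U \<in> u ` R" "V \<in> u ` R" "U \<noteq> V"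
      then obtain a b where ab: "a \<in> R" "b \<in> R" "U = u a" "V = u b" "a \<noteq> b" by auto
      then show "disjnt U V" using same[of a b] by (auto simp: disjnt_def u_def)
    qed
    fix U assume "U \<in> u ` R"
    then obtain a where a: "a \<in> R" "U = u a" by blast
    have Ueq: "u a = ?C \<inter> (T \<times> ball a r)"
      using T(3) by (auto simp: u_def dist_commute)
    show "openin (top_of_set ?C) U"
      unfolding a Ueq using T(1) by (auto intro!: openin_open_Int open_Times)
    have cont: "continuous_on T (\<lambda>t. s t a)"
      unfolding continuous_on_eq_continuous_at[OF T(1)]
    proof
      fix t1 assume t1: "t1 \<in> T"
      have t1S: "t1 \<in> S" using T(3)[OF t1] H by auto
      show "isCont (\<lambda>t. s t a) t1"
        unfolding continuous_at tendsto_iff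
      proof (intro allI impI)
        fix e :: real assume e: "e > 0"
        \<comment> \<open>within distance \<open>e'\<close> of \<open>s t1 a\<close> one is still in the ball around \<open>a\<close>, where the root is unique\<close>
        define e' where "e' = min e (r - dist (s t1 a) a)"
        have e': "e' > 0" using e s(2)[OF t1 a(1)] by (simp add: e'_def)
        have "\<forall>\<^sub>F t in nhds t1. \<exists>x. poly (P t) x = 0 \<and> dist x (s t1 a) < e'"
          by (rule eventually_root_near[OF t1S s(1)[OF t1 a(1)] e'])
        moreover have "\<forall>\<^sub>F t in nhds t1. t \<in> T"
          using T(1) t1 by (rule eventually_nhds_in_open)
        ultimately have "\<forall>\<^sub>F t in nhds t1. dist (s t a) (s t1 a) < e"
        proof eventually_elim
          case (elim t)
          then obtain x where x: "poly (P t) x = 0" "dist x (s t1 a) < e'" by blast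
          have "dist x a \<le> dist x (s t1 a) + dist (s t1 a) a" by (rule dist_triangle)
          also have "\<dots> < r" using x(2) by (simp add: e'_def)
          finally have "x = s t a" using uniq[of t a x] elim(2) a(1) x(1) by blast
          then show ?case using x(2) by (simp add: e'_def)
        qed
        then show "\<forall>\<^sub>F t in at t1. dist (s t a) (s t1 a) < e"
          by (rule filter_leD[rotated]) (simp add: at_within_le_nhds)
      qed
    qed
    show "\<exists>q. homeomorphism U T fst q"
    proof (intro exI[of _ "\<lambda>t. (t, s t a)"])
      show "homeomorphism U T fst (\<lambda>t. (t, s t a))"
        unfolding homeomorphism_def
      proof (intro conjI ballI)
        show "continuous_on U fst" by (intro continuous_intros)
        show "continuous_on T (\<lambda>t. (t, s t a))" by (intro continuous_intros cont)
        show "fst ` U = T" using s a by (force simp: u_def image_iff)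
        show "(\<lambda>t. (t, s t a)) ` T = U"
          using s a uniq by (auto simp: u_def image_iff)
        show "(fst y, s (fst y) a) = y" if "y \<in> U" for y
          using that a uniq by (auto simp: u_def)
        show "fst (y, s y a) = y" for y by simp
      qed
    qed
  qed
qed

text \<open>
The identity map of the simply connected set \<open>H\<close> lifts to the covering space of roots.
\<close>
lemma continuous_root_exists:
  assumes H: "open H" "H \<subseteq> S" "simply_connected H" and simple: "\<And>t. t \<in> H \<Longrightarrow> rsquarefree (P t)"
  obtains f where "continuous_on H f" "\<And>t. t \<in> H \<Longrightarrow> poly (P t) (f t) = 0"
proof -
  have lp: "locally path_connected H" using H(1) by (rule open_imp_locally_path_connected)
  have "(\<lambda>t. t) \<in> H \<rightarrow> H" "continuous_on H (\<lambda>t. t)" by (auto intro: continuous_intros)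
  then obtain g where g: "continuous_on H g" "g \<in> H \<rightarrow> {(t, x). t \<in> H \<and> poly (P t) x = 0}"
      "\<And>t. t \<in> H \<Longrightarrow> fst (g t) = t"
    using covering_space_lift[OF covering_roots[OF H(1,2) simple] H(3) lp, of "\<lambda>t. t"] by blast
  show ?thesis
  proof (rule that[of "\<lambda>t. snd (g t)"])
    show "continuous_on H (\<lambda>t. snd (g t))" using g(1) by (intro continuous_intros)
    show "poly (P t) (snd (g t)) = 0" if "t \<in> H" for t
    proof -
      have "g t \<in> {(t, x). t \<in> H \<and> poly (P t) x = 0}" using g(2) that by (rule funcset_mem)
      then show ?thesis using g(3)[OF that] by (auto split: prod.splits)
    qed
  qed
qed

text \<open>
The divided difference of \<open>poly (P t)\<close> at \<open>f t\<close> and \<open>f t0\<close> tends to the derivative of the polynomial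
at \<open>f t0\<close>, which is nonzero at a simple root, so the difference quotient of \<open>f\<close> converges.
\<close>
lemma holomorphic_root:
  assumes H: "open H" "H \<subseteq> S" and simple: "\<And>t. t \<in> H \<Longrightarrow> rsquarefree (P t)"
    and f: "continuous_on H f" "\<And>t. t \<in> H \<Longrightarrow> poly (P t) (f t) = 0"
  shows "f holomorphic_on H"
  unfolding holomorphic_on_open[OF H(1)]
proof
  fix t0 assume t0: "t0 \<in> H"
  define q where "q t = (\<Sum>k\<le>n. coeff (P t) k * (\<Sum>i<k. f t ^ i * f t0 ^ (k - Suc i)))" for t
  have key: "poly (P t) (f t) - poly (P t) (f t0) = (f t - f t0) * q t" for t
  proof -
    have pd: "x ^ k - y ^ k = (x - y) * (\<Sum>i<k. x ^ i * y ^ (k - Suc i))" for x y :: complex and k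
      using power_diff_sumr2[of x k y] by (simp add: mult.commute)
    have "poly (P t) (f t) - poly (P t) (f t0) = (\<Sum>k\<le>n. coeff (P t) k * (f t ^ k - f t0 ^ k))"
      by (simp add: poly_eq sum_subtractf right_diff_distrib)
    also have "\<dots> = (\<Sum>k\<le>n. (f t - f t0) * (coeff (P t) k * (\<Sum>i<k. f t ^ i * f t0 ^ (k - Suc i))))"
      by (intro sum.cong refl) (simp only: pd mult.left_commute)
    finally show ?thesis by (simp only: q_def sum_distrib_left)
  qed
  have "continuous_on H q"
    unfolding q_def
    by (intro continuous_intros f holomorphic_on_imp_continuous_on holomorphic_on_subset[OF hol] H)
  then have qc: "isCont q t0" using H(1) t0 by (simp add: continuous_on_eq_continuous_at)
  have "q t0 = poly (pderiv (P t0)) (f t0)"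
  proof -
    have "q t0 = (\<Sum>k\<le>n. of_nat k * coeff (P t0) k * f t0 ^ (k - 1))"
      unfolding q_def
    proof (intro sum.cong refl)
      fix k
      have "(\<Sum>i<k. f t0 ^ i * f t0 ^ (k - Suc i)) = (\<Sum>i<k. f t0 ^ (k - 1))"
        by (intro sum.cong refl) (simp flip: power_add)
      then show "coeff (P t0) k * (\<Sum>i<k. f t0 ^ i * f t0 ^ (k - Suc i)) = 
         of_nat k * coeff (P t0) k * f t0 ^ (k - 1)" by simp
    qed
    moreover have "((\<lambda>x. poly (P t0) x) has_field_derivative
        (\<Sum>k\<le>n. of_nat k * coeff (P t0) k * f t0 ^ (k - 1))) (at (f t0))"
      unfolding poly_eq by (auto intro!: derivative_eq_intros sum.cong)
    ultimately show ?thesis using DERIV_unique[OF poly_DERIV] by metis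
  qed
  moreover have "poly (pderiv (P t0)) (f t0) \<noteq> 0"
    using simple[OF t0] f(2)[OF t0] by (auto simp: rsquarefree_roots)
  ultimately have q0: "q t0 \<noteq> 0" by simp
  have "(\<lambda>t. poly (P t) (f t0)) field_differentiable (at t0)"
    using holomorphic_value[of "f t0"] S H t0 by (auto simp: holomorphic_on_open field_differentiable_def)
  then obtain d where d: "((\<lambda>t. poly (P t) (f t0)) has_field_derivative d) (at t0)"
    by (auto simp: field_differentiable_def)
  then have d': "(\<lambda>t. (poly (P t) (f t0) - poly (P t0) (f t0)) / (t - t0)) \<midarrow>t0\<rightarrow> d"
    by (simp add: has_field_derivative_iff)
  have "(\<lambda>t. - ((poly (P t) (f t0) - poly (P t0) (f t0)) / (t - t0)) / q t) \<midarrow>t0\<rightarrow> - d / q t0"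
    using qc q0 by (intro tendsto_intros d') (auto simp: isCont_def)
  moreover have "\<forall>\<^sub>F t in at t0. - ((poly (P t) (f t0) - poly (P t0) (f t0)) / (t - t0)) / q t = (f t - f t0) / (t - t0)"
  proof -
    have "\<forall>\<^sub>F t in at t0. q t \<noteq> 0"
      using qc q0 by (simp add: isCont_def tendsto_imp_eventually_ne)
    moreover have "\<forall>\<^sub>F t in at t0. t \<in> H" using H(1) t0 by (rule eventually_at_in_open')
    ultimately show ?thesis
    proof eventually_elim
      case (elim t)
      have "poly (P t) (f t0) = - (f t - f t0) * q t"
        using key[of t] f(2)[OF elim(2)] by (simp add: algebra_simps)
      then have "- ((poly (P t) (f t0) - poly (P t0) (f t0)) / (t - t0)) / q t = - ((f t0 - f t) / (t - t0))"
        using elim(1) f(2)[OF t0] by simp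
      also have "\<dots> = (f t - f t0) / (t - t0)" by (metis minus_diff_eq minus_divide_left)
      finally show ?case .
    qed
  qed
  ultimately have "(\<lambda>t. (f t - f t0) / (t - t0)) \<midarrow>t0\<rightarrow> - d / q t0"
    by (rule Lim_transform_eventually)
  then show "\<exists>f'. (f has_field_derivative f') (at t0)"
    by (auto simp: has_field_derivative_iff)
qed

section \<open>Extending a root function across the real line\<close>

text \<open>
At parameters close to \<open>t1\<close> the roots are bounded, so they almost annul the polynomial at \<open>t1\<close> and
are close to its roots. The root at \<open>t1\<close> depends on \<open>t\<close> here; that it can be chosen constant is the
matter of the next lemma.
\<close>
lemma root_tends_to_roots:
  assumes t1: "t1 \<in> S" and f: "\<And>t. t \<in> H \<Longrightarrow> poly (P t) (f t) = 0" and r: "r > 0"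
  shows "\<forall>\<^sub>F t in nhds t1. t \<in> H \<longrightarrow> (\<exists>a. poly (P t1) a = 0 \<and> dist a (f t) < r)"
proof -
  \<comment> \<open>\<open>B t\<close> bounds the roots at \<open>t\<close>, and \<open>E t\<close> bounds the value of \<open>P t1\<close> at them\<close>
  define B where "B t = 1 + (\<Sum>k<n. cmod (coeff (P t) k))" for t
  define E where "E t = (\<Sum>k\<le>n. cmod (coeff (P t1) k - coeff (P t) k) * B t ^ k)" for t
  have c: "continuous_on S (\<lambda>t. coeff (P t) k)" for k
    by (rule holomorphic_on_imp_continuous_on[OF hol])
  have "continuous_on S E" unfolding E_def B_def by (intro continuous_intros c)
  then have "isCont E t1" using S t1 by (simp add: continuous_on_eq_continuous_at)
  then have "(E \<longlongrightarrow> E t1) (nhds t1)" by (simp add: continuous_at tendsto_nhds_iff)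
  moreover have "E t1 = 0" by (simp add: E_def)
  ultimately have "\<forall>\<^sub>F t in nhds t1. dist (E t) 0 < r ^ n" using tendstoD[of E 0] r by simp
  then show ?thesis
  proof eventually_elim
    case (elim t)
    show ?case
    proof
      assume t: "t \<in> H"
      have "poly (P t1) (f t) = (\<Sum>k\<le>n. (coeff (P t1) k - coeff (P t) k) * f t ^ k)"
        using f[OF t] by (simp add: poly_eq left_diff_distrib sum_subtractf)
      also have "cmod \<dots> \<le> E t"
        unfolding E_def
      proof (rule sum_norm_le)
        fix k
        have "cmod (f t) \<le> B t" unfolding B_def
          by (rule monic_root_bound[OF deg n monic f[OF t]])
        then have "cmod (f t) ^ k \<le> B t ^ k" by (intro power_mono) auto
        then show "cmod ((coeff (P t1) k - coeff (P t) k) * f t ^ k) \<le> cmod (coeff (P t1) k - coeff (P t) k) * B t ^ k"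
          by (simp add: norm_mult norm_power mult_left_mono)
      qed
      also have "\<dots> < r ^ n" using elim by (auto simp: dist_norm)
      finally have "cmod (poly (P t1) (f t)) < r ^ degree (P t1)" by (simp add: deg)
      then obtain a where "poly (P t1) a = 0" "dist a (f t) < r"
        using monic_root_near[of "P t1" r "f t"] deg monic n r by auto
      then show "\<exists>a. poly (P t1) a = 0 \<and> dist a (f t) < r" by blast
    qed
  qed
qed

text \<open>
Near \<open>t1\<close> the values of \<open>f\<close> lie in disjoint balls around the roots at \<open>t1\<close>. The part of the convex set
\<open>H\<close> near \<open>t1\<close> is connected, hence so is its image, which therefore stays in a single ball.
\<close>
lemma root_boundary_limit:
  assumes t1: "t1 \<in> S" and H: "convex H" and clo: "t1 \<in> closure H"
    and f: "continuous_on H f" "\<And>t. t \<in> H \<Longrightarrow> poly (P t) (f t) = 0"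
  shows "\<exists>l. (f \<longlongrightarrow> l) (at t1 within H)"
proof -
  define R where "R = {x. poly (P t1) x = 0}"
  have finR: "finite R" unfolding R_def by (rule poly_roots_finite[OF P_nonzero])
  obtain r where r: "r > 0" and
      same: "\<And>a b x. a \<in> R \<Longrightarrow> b \<in> R \<Longrightarrow> dist a x < r \<Longrightarrow> dist b x < r \<Longrightarrow> a = b"
    using finite_separation[OF finR] by blast
  have near: "\<forall>\<^sub>F t in nhds t1. t \<in> H \<longrightarrow> (\<exists>a\<in>R. dist a (f t) < r')" if "r' > 0" for r'
    using root_tends_to_roots[OF t1 f(2) that] unfolding R_def by simp
  obtain e where e: "e > 0" "\<And>t. dist t t1 < e \<Longrightarrow> t \<in> H \<Longrightarrow> \<exists>a\<in>R. dist a (f t) < r"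
    using near[OF r] unfolding eventually_nhds_metric by blast
  define K where "K = ball t1 e \<inter> H"
  have K: "\<exists>a\<in>R. dist a (f t) < r" if "t \<in> K" for t
    using e(2)[of t] that by (auto simp: K_def dist_commute)
  have "K \<noteq> {}" using clo e(1) unfolding K_def by (metis closure_approachable disjoint_iff mem_ball dist_commute)
  then obtain t2 where t2: "t2 \<in> K" by blast
  obtain a where a: "a \<in> R" "dist a (f t2) < r" using K[OF t2] by blast
  have conn: "connected (f ` K)"
    by (intro connected_continuous_image convex_connected continuous_on_subset[OF f(1)])
       (auto simp: K_def intro!: convex_Int H)
  let ?V = "\<Union>b\<in>R - {a}. ball b r"
  have "ball a r \<inter> f ` K = {} \<or> ?V \<inter> f ` K = {}"
  proof (rule connectedD[OF conn])
    show "open (ball a r)" "open ?V" by auto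
    show "ball a r \<inter> ?V \<inter> f ` K = {}" using same a(1) by auto
    show "f ` K \<subseteq> ball a r \<union> ?V"
    proof
      fix y assume "y \<in> f ` K"
      then obtain b where "b \<in> R" "dist b y < r" using K by blast
      then show "y \<in> ball a r \<union> ?V" by (cases "b = a") auto
    qed
  qed
  moreover have "f t2 \<in> ball a r \<inter> f ` K" using t2 a(2) by auto
  ultimately have V: "?V \<inter> f ` K = {}" by blast
  have inball: "dist a (f t) < r" if "t \<in> K" for t
  proof -
    from K[OF that] obtain b where "b \<in> R" "dist b (f t) < r" by blast
    moreover have "f t \<notin> ?V" using V that by blast
    ultimately show ?thesis by (cases "b = a") auto
  qed
  have "(f \<longlongrightarrow> a) (at t1 within H)"
    unfolding tendsto_iff
  proof (intro allI impI)
    fix r' :: real assume "r' > 0"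
    then have "\<forall>\<^sub>F t in nhds t1. t \<in> H \<longrightarrow> (\<exists>b\<in>R. dist b (f t) < min r r')" 
      using near[of "min r r'"] r by simp
    moreover have "\<forall>\<^sub>F t in nhds t1. t \<in> ball t1 e"
      using e(1) by (intro eventually_nhds_in_open) auto
    ultimately have "\<forall>\<^sub>F t in nhds t1. t \<in> H \<longrightarrow> dist (f t) a < r'"
    proof eventually_elim
      case (elim t)
      show ?case
      proof
        assume t: "t \<in> H"
        then obtain b where b: "b \<in> R" "dist b (f t) < min r r'" using elim(1) by blast
        have "t \<in> K" using t elim(2) by (simp add: K_def)
        then have "a = b" using same[OF a(1) b(1) inball] b(2) by simp
        then show "dist (f t) a < r'" using b(2) by (simp add: dist_commute)
      qed
    qed
    then show "\<forall>\<^sub>F t in at t1 within H. dist (f t) a < r'"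
      unfolding eventually_at_filter by (rule eventually_mono) simp
  qed
  then show ?thesis by blast
qed

text \<open>
The roots at real parameters may be multiple, and this is what reflection is for: it needs only that
the root function found above the real line has continuous real boundary values.
\<close>
lemma holomorphic_root_across_real_line:
  assumes d: "d > 0" and Sd: "S = {t. \<bar>Im t\<bar> < d}"
    and simple: "\<And>t. 0 < Im t \<Longrightarrow> Im t < d \<Longrightarrow> rsquarefree (P t)"
    and real: "\<And>t x. t \<in> \<real> \<Longrightarrow> poly (P t) x = 0 \<Longrightarrow> x \<in> \<real>"
  obtains f where "f holomorphic_on S" "\<And>t. t \<in> \<real> \<Longrightarrow> poly (P t) (f t) = 0"
proof -
  define H where "H = {t. 0 < Im t} \<inter> {t. Im t < d}"
  define K where "K = {t. 0 \<le> Im t} \<inter> {t. Im t < d}"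
  have convH: "convex H" unfolding H_def
    by (intro convex_Int convex_halfspace_Im_gt convex_halfspace_Im_lt)
  have opH: "open H" unfolding H_def 
    by (intro open_Int open_halfspace_Im_gt open_halfspace_Im_lt)
  have HS: "H \<subseteq> S" and KS: "K \<subseteq> S" and HK: "H \<subseteq> K" by (auto simp: H_def K_def Sd)
  have simpleH: "rsquarefree (P t)" if "t \<in> H" for t using that simple by (auto simp: H_def)
  obtain g where g: "continuous_on H g" "\<And>t. t \<in> H \<Longrightarrow> poly (P t) (g t) = 0"
    using continuous_root_exists[OF opH HS convex_imp_simply_connected[OF convH] simpleH] by blast
  have holg: "g holomorphic_on H" by (rule holomorphic_root[OF opH HS simpleH g])
  have KH: "K \<subseteq> closure H"
  proof
    fix t assume t: "t \<in> K"
    show "t \<in> closure H"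
      unfolding closure_approachable
    proof (intro allI impI)
      fix e :: real assume e: "e > 0"
      define h where "h = min (e / 2) ((d - Im t) / 2)"
      have h: "h > 0" "h < e" "h < d - Im t" using e t by (auto simp: h_def K_def min_def)
      have "t + \<i> * of_real h \<in> H" using h t by (auto simp: H_def K_def)
      moreover have "dist (t + \<i> * of_real h) t < e" using h by (simp add: dist_norm norm_mult)
      ultimately show "\<exists>y\<in>H. dist y t < e" by blast
    qed
  qed
  have lim: "\<exists>l. limitin euclidean g l (atin_within euclidean t H)" if "t \<in> K - H" for t
  proof -
    have "atin_within euclidean t H = at t within H"
      by (simp add: atin_within_def at_within_def nhdsin_def nhds_def)
    then show ?thesis
      using root_boundary_limit[OF _ convH _ g, of t] that KS KH by auto
  qed
  have KH': "K \<subseteq> euclidean closure_of H" using KH by simp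
  have "continuous_map (subtopology euclidean H) euclidean g" using g(1) by simp
  from continuous_map_extension_pointwise_alt[OF regular_space_euclidean HK KH' this lim]
  obtain h where "continuous_map (subtopology euclidean K) euclidean h" and hg: "\<And>t. t \<in> H \<Longrightarrow> h t = g t"
    by blast
  then have ch: "continuous_on K h" by simp
  have root: "poly (P t) (h t) = 0" if t: "t \<in> K" for t
  proof -
    have "continuous_on K (\<lambda>t. poly (P t) (h t))"
      using KS by (intro continuous_value ch) (auto intro: continuous_intros)
    then have "((\<lambda>t. poly (P t) (h t)) \<longlongrightarrow> poly (P t) (h t)) (at t within K)"
      using t by (simp add: continuous_on)
    then have 1: "((\<lambda>t. poly (P t) (h t)) \<longlongrightarrow> poly (P t) (h t)) (at t within H)"
      by (rule tendsto_within_subset[OF _ HK])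
    have "\<forall>\<^sub>F t in at t within H. 0 = poly (P t) (h t)"
      unfolding eventually_at_filter using hg g(2) by (intro always_eventually) auto
    then have 2: "((\<lambda>t. poly (P t) (h t)) \<longlongrightarrow> 0) (at t within H)"
      by (rule Lim_transform_eventually[OF tendsto_const])
    have "t islimpt H"
    proof -
      have "t islimpt H" if "t \<notin> H" using KH t that by (auto simp: closure_def)
      moreover have "t islimpt H" if "t \<in> H" using opH that by (simp add: interior_limit_point interior_open)
      ultimately show ?thesis by blast
    qed
    then have "at t within H \<noteq> bot" by (simp add: trivial_limit_within)
    from tendsto_unique[OF this 1 2] show ?thesis .
  qed
  have S1: "S \<inter> {z. 0 < Im z} = H" "S \<inter> {z. 0 \<le> Im z} = K" by (auto simp: Sd H_def K_def)
  have realK: "t \<in> K" if "t \<in> \<real>" for t using that d by (auto simp: K_def complex_is_Real_iff)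
  have "(\<lambda>z. if 0 \<le> Im z then h z else cnj (h (cnj z))) holomorphic_on S"
  proof (rule Schwarz_reflection[OF S])
    show "cnj ` S \<subseteq> S" by (auto simp: Sd)
    show "h holomorphic_on (S \<inter> {z. 0 < Im z})" 
      unfolding S1 using holg hg by (simp cong: holomorphic_cong)
    show "continuous_on (S \<inter> {z. 0 \<le> Im z}) h" unfolding S1 by (rule ch)
    show "h z \<in> \<real>" if "z \<in> S" "z \<in> \<real>" for z
      using real[OF that(2) root[OF realK[OF that(2)]]] .
  qed
  moreover have "poly (P t) (if 0 \<le> Im t then h t else cnj (h (cnj t))) = 0" if "t \<in> \<real>" for t
    using root[OF realK[OF that]] that by (auto simp: complex_is_Real_iff)
  ultimately show ?thesis using that by blast
qed

end

section \<open>Passing between the circle and its universal cover\<close>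

abbreviation strip :: "real \<Rightarrow> complex set" where "strip d \<equiv> {t. \<bar>Im t\<bar> < d}"

lemma strip_eq: "strip d = {t. - d < Im t} \<inter> {t. Im t < d}" by auto

lemma open_strip: "open (strip d)"
  unfolding strip_eq by (intro open_Int open_halfspace_Im_gt open_halfspace_Im_lt)

lemma connected_strip: "connected (strip d)"
  unfolding strip_eq
  by (intro convex_connected convex_Int convex_halfspace_Im_gt convex_halfspace_Im_lt)

lemma Reals_subset_strip: "d > 0 \<Longrightarrow> t \<in> \<real> \<Longrightarrow> t \<in> strip d"
  by (auto simp: complex_is_Real_iff)

lemma exp_ii_S1: "t \<in> \<real> \<Longrightarrow> exp (\<i> * t) \<in> S1"
  by (auto simp: complex_is_Real_iff)

lemma S1_exp_ii: "z \<in> S1 \<Longrightarrow> \<exists>t\<in>\<real>. z = exp (\<i> * t)"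
  using Arg_eq[of z] by (cases "z = 0") (auto intro!: bexI[of _ "of_real (Arg z)"])

lemma eq_on_strip:
  assumes d: "d > 0" and f: "f holomorphic_on strip d" and g: "g holomorphic_on strip d"
    and eq: "\<And>t. t \<in> T \<Longrightarrow> f t = g t" and T: "T \<subseteq> strip d" "p islimpt T" "p \<in> strip d"
    and t: "t \<in> strip d"
  shows "f t = g t"
proof -
  have "f t - g t = 0"
    by (rule analytic_continuation[OF _ open_strip connected_strip T(1,3,2) _ t])
       (use f g eq in \<open>auto intro: holomorphic_intros\<close>)
  then show ?thesis by simp
qed

lemma zero_islimpt_Reals: "(0::complex) islimpt \<real>"
  unfolding islimpt_approachable
proof (intro allI impI)
  fix e :: real assume "e > 0"
  then show "\<exists>x'\<in>\<real>. x' \<noteq> (0::complex) \<and> dist x' 0 < e"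
    by (intro bexI[of _ "of_real (e / 2)"]) auto
qed

lemma eq_on_strip_if_eq_on_Reals:
  assumes d: "d > 0" and f: "f holomorphic_on strip d" and g: "g holomorphic_on strip d"
    and eq: "\<And>t. t \<in> \<real> \<Longrightarrow> f t = g t" and t: "t \<in> strip d"
  shows "f t = g t"
  by (rule eq_on_strip[OF d f g eq _ zero_islimpt_Reals _ t]) (use d in \<open>auto simp: complex_is_Real_iff\<close>)

lemma holomorphic_on_strip_shift:
  assumes "g holomorphic_on strip d" "Im c = 0"
  shows "(\<lambda>t. g (t + c)) holomorphic_on strip d"
proof -
  have "(g \<circ> (\<lambda>t. t + c)) holomorphic_on strip d"
    by (rule holomorphic_on_compose_gen[OF _ assms(1)]) (use assms(2) in \<open>auto intro!: holomorphic_intros\<close>)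
  then show ?thesis by (simp add: o_def)
qed

lemma periodic_multiple:
  assumes per: "\<And>t. t \<in> strip d \<Longrightarrow> g (t + of_real c) = g t" and t: "t \<in> strip d"
  shows "g (t + of_int k * of_real c) = g t"
proof -
  have nat: "g (s + of_nat m * of_real c) = g s" if "s \<in> strip d" for m s
  proof (induction m)
    case (Suc m)
    have "s + of_nat m * of_real c \<in> strip d" using that by simp
    from per[OF this] Suc show ?case by (simp add: algebra_simps)
  qed simp
  show ?thesis
  proof (cases "k \<ge> 0")
    case True
    then show ?thesis using nat[OF t, of "nat k"] by simp
  next
    case False
    have "t + of_int k * of_real c \<in> strip d" using t by simp
    from nat[OF this, of "nat (- k)"] False show ?thesis by simp
  qed
qed

text \<open>
The function on the circle is \<open>g\<close> composed with \<open>- \<i>\<close> times a logarithm. Different branches of the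
logarithm give arguments of \<open>g\<close> that differ by multiples of the period, so each point of the circle can be
checked with a branch that is analytic near it.
\<close>
lemma periodic_descends_to_circle:
  assumes d: "d > 0" and g: "g holomorphic_on strip d"
    and per: "\<And>t. t \<in> \<real> \<Longrightarrow> g (t + 2 * of_real pi) = g t"
  obtains f where "f \<in> hol_circle" "\<And>t. t \<in> \<real> \<Longrightarrow> f (exp (\<i> * t)) = g t"
proof -
  have per1: "g (t + of_real (2 * pi)) = g t" if "t \<in> strip d" for t
    using eq_on_strip_if_eq_on_Reals[OF d holomorphic_on_strip_shift[OF g, of "of_real (2 * pi)"] g _ that] per by simp
  have per2: "g s = g t" if "s \<in> strip d" "exp (\<i> * s) = exp (\<i> * t)" for s t
  proof -
    from that(2)[symmetric] obtain k where "\<i> * t = \<i> * s + (of_int (2 * k) * pi) * \<i>"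
      by (auto simp: exp_eq)
    then have "\<i> * t = \<i> * (s + of_int k * of_real (2 * pi))" by (simp add: algebra_simps)
    then have "t = s + of_int k * of_real (2 * pi)" by simp
    then show ?thesis using periodic_multiple[of d g "2 * pi", OF per1 that(1)] by simp
  qed
  define f where "f z = g (- \<i> * Ln z)" for z
  have f_exp: "f (exp (\<i> * t)) = g t" if "t \<in> strip d" for t
    unfolding f_def
    by (rule per2[symmetric, OF that]) simp
  have "f analytic_on S1"
    unfolding analytic_on_analytic_at[of f S1]
  proof
    fix z0 :: complex assume "z0 \<in> S1"
    then obtain t0 where t0: "t0 \<in> \<real>" "z0 = exp (\<i> * t0)" using S1_exp_ii by blast
    \<comment> \<open>the branch of \<open>- \<i> * Ln z\<close> that is analytic at \<open>z0\<close> and takes the real value \<open>t0\<close> there\<close>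
    define L where "L z = - \<i> * Ln (z / z0) + t0" for z
    have Lz0: "L z0 = t0" by (simp add: L_def t0)
    have expL: "exp (\<i> * L z) = z" if "z \<noteq> 0" for z
      using that t0 by (simp add: L_def ring_distribs exp_add)
    have anL: "L analytic_on {z0}"
      unfolding L_def using t0 by (auto intro!: analytic_intros)
    have "(g \<circ> L) analytic_on {z0}"
    proof (rule analytic_on_compose_gen[OF anL])
      show "g analytic_on strip d" using g open_strip by (simp add: analytic_on_open)
      show "L z \<in> strip d" if "z \<in> {z0}" for z
        using that Lz0 t0(1) Reals_subset_strip[OF d] by simp
    qed
    moreover have "\<forall>\<^sub>F z in nhds z0. (g \<circ> L) z = f z"
    proof -
      have "isCont L z0" using anL by (rule analytic_at_imp_isCont)
      then have "(L \<longlongrightarrow> L z0) (nhds z0)" by (simp add: continuous_at tendsto_nhds_iff)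
      moreover have "L z0 \<in> strip d" using Lz0 t0(1) Reals_subset_strip[OF d] by simp
      ultimately have "\<forall>\<^sub>F z in nhds z0. L z \<in> strip d"
        using open_strip by (intro topological_tendstoD)
      moreover have "\<forall>\<^sub>F z in nhds z0. z \<in> - {0}"
        using t0 by (intro eventually_nhds_in_open) auto
      ultimately show ?thesis
      proof eventually_elim
        case (elim z)
        then show ?case using f_exp[OF elim(1)] expL[of z] by simp
      qed
    qed
    ultimately show "f analytic_on {z0}" by (metis analytic_at_cong)
  qed
  then show ?thesis using that[of f] f_exp Reals_subset_strip[OF d] by (simp add: hol_circle_def)
qed

text \<open>
The distance from \<open>exp (\<i> * t)\<close> to the circle depends on \<open>Im t\<close> alone.
\<close>
lemma strip_maps_into_neighbourhood:
  assumes "open W" "S1 \<subseteq> W"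
  obtains d where "d > 0" "\<And>t. t \<in> strip d \<Longrightarrow> exp (\<i> * t) \<in> W"
proof -
  obtain e where e: "e > 0" "(\<Union>x\<in>S1. ball x e) \<subseteq> W"
    using compact_subset_open_imp_ball_epsilon_subset[OF compact_sphere assms] by blast
  have "isCont (\<lambda>s::real. exp (- s)) 0" by (intro continuous_intros)
  then obtain d where d: "d > 0" "\<And>s::real. dist s 0 < d \<Longrightarrow> dist (exp (- s)) (exp (- 0)) < e"
    unfolding continuous_at_eps_delta using e(1) by (metis dist_real_def)
  show ?thesis
  proof (rule that[OF d(1)])
    fix t assume t: "t \<in> strip d"
    have "exp (\<i> * t) = exp (\<i> * of_real (Re t)) * of_real (exp (- Im t))"
    proof -
      have "\<i> * t = \<i> * of_real (Re t) + of_real (- Im t)" by (simp add: complex_eq_iff)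
      then show ?thesis by (simp only: exp_add exp_of_real)
    qed
    then have "dist (exp (\<i> * of_real (Re t))) (exp (\<i> * t))
        = cmod (exp (\<i> * of_real (Re t)) * of_real (1 - exp (- Im t)))"
      by (simp add: dist_norm algebra_simps)
    also have "\<dots> = \<bar>1 - exp (- Im t)\<bar>" by (simp only: norm_mult norm_of_real) simp
    also have "\<dots> < e" using d(2)[of "Im t"] t by (simp add: dist_real_def abs_minus_commute)
    finally have "exp (\<i> * t) \<in> ball (exp (\<i> * of_real (Re t))) e" by simp
    then show "exp (\<i> * t) \<in> W"
      by (intro subsetD[OF e(2)] UN_I[OF exp_ii_S1[of "of_real (Re t)"]]) simp_all
  qed
qed

lemma circle_to_strip:
  assumes "f \<in> hol_circle"
  obtains d where "d > 0" "(\<lambda>t. f (exp (\<i> * t))) holomorphic_on strip d"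
proof -
  obtain V where V: "open V" "S1 \<subseteq> V" "f holomorphic_on V"
    using assms by (auto simp: hol_circle_iff_extension)
  obtain d where d: "d > 0" "\<And>t. t \<in> strip d \<Longrightarrow> exp (\<i> * t) \<in> V"
    using strip_maps_into_neighbourhood[OF V(1,2)] by blast
  have "(f \<circ> (\<lambda>t. exp (\<i> * t))) holomorphic_on strip d"
    by (rule holomorphic_on_compose_gen[OF _ V(3)]) (use d in \<open>auto intro!: holomorphic_intros\<close>)
  then show ?thesis using that d by (simp add: o_def)
qed

text \<open>
A function of \<open>w\<close> that is invariant under rotation by an \<open>N\<close>-th root of unity is a function of
\<open>w ^ N\<close>. On the universal cover this is descent for a function of period \<open>2 * pi\<close>.
\<close>
lemma rotation_invariant_descends:
  assumes g: "g \<in> hol_circle" and N: "N > 0"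
    and inv: "\<And>w. w \<in> S1 \<Longrightarrow> g (exp (2 * of_real pi * \<i> / of_nat N) * w) = g w"
  obtains f where "f \<in> hol_circle" "\<And>w. w \<in> S1 \<Longrightarrow> f (w ^ N) = g w"
proof -
  obtain d where d: "d > 0" "(\<lambda>t. g (exp (\<i> * t))) holomorphic_on strip d"
    using circle_to_strip[OF g] by blast
  have "((\<lambda>t. g (exp (\<i> * t))) \<circ> (\<lambda>t. t / of_nat N)) holomorphic_on strip d"
  proof (rule holomorphic_on_compose_gen[OF _ d(2)])
    show "(\<lambda>t. t / of_nat N) ` strip d \<subseteq> strip d"
    proof (rule image_subsetI)
      fix t assume "t \<in> strip d"
      moreover have "\<bar>Im t\<bar> / real N \<le> \<bar>Im t\<bar>" using N by (simp add: divide_le_eq mult_le_cancel_left1)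
      ultimately show "t / of_nat N \<in> strip d" using N by (simp add: Im_divide_of_nat)
    qed
  qed (use N in \<open>auto intro!: holomorphic_intros\<close>)
  then have hol: "(\<lambda>t. g (exp (\<i> * (t / of_nat N)))) holomorphic_on strip d" by (simp add: o_def)
  have "g (exp (\<i> * ((t + 2 * of_real pi) / of_nat N))) = g (exp (\<i> * (t / of_nat N)))" if "t \<in> \<real>" for t
  proof -
    have "exp (\<i> * (t / of_nat N)) \<in> S1" using that by (intro exp_ii_S1) auto
    from inv[OF this] show ?thesis by (simp add: exp_add[symmetric] add_divide_distrib ring_distribs algebra_simps)
  qed
  from periodic_descends_to_circle[OF d(1) hol this]
  obtain f where f: "f \<in> hol_circle" "\<And>t. t \<in> \<real> \<Longrightarrow> f (exp (\<i> * t)) = g (exp (\<i> * (t / of_nat N)))" by blast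
  show ?thesis
  proof (rule that[OF f(1)])
    fix w :: complex assume "w \<in> S1"
    then obtain t where t: "t \<in> \<real>" "w = exp (\<i> * t)" using S1_exp_ii by blast
    have "w ^ N = exp (\<i> * (of_nat N * t))"
      unfolding t(2) by (simp add: exp_of_nat_mult[symmetric] mult.left_commute)
    moreover have "of_nat N * t \<in> \<real>" using t(1) by simp
    ultimately show "f (w ^ N) = g w" using f(2)[of "of_nat N * t"] N t(2) by simp
  qed
qed

section \<open>An analytic eigenvalue on the line\<close>

lemma hol_circle_det:
  assumes "\<And>z. M z \<in> carrier_mat n n" "\<And>i j. i < n \<Longrightarrow> j < n \<Longrightarrow> (\<lambda>z. M z $$ (i, j)) \<in> hol_circle"
  shows "(\<lambda>z. Determinant.det (M z)) \<in> hol_circle"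
proof -
  have "(\<lambda>z. \<Sum>p | p permutes {0..<n}. signof p * (\<Prod>i = 0..<n. M z $$ (i, p i))) \<in> hol_circle"
  proof (intro hol_circle_sum hol_circle_mult hol_circle_const hol_circle_prod)
    fix p i assume "p \<in> {p. p permutes {0..<n}}" "i \<in> {0..<n}"
    then have "i < n" "p i < n" using permutes_in_image[of p "{0..<n}" i] by auto
    then show "(\<lambda>z. M z $$ (i, p i)) \<in> hol_circle" by (rule assms(2))
  qed
  then show ?thesis by (simp add: det_def'[OF assms(1)])
qed

definition hol_poly :: "(complex \<Rightarrow> complex poly) \<Rightarrow> bool" where
  "hol_poly p \<longleftrightarrow> (\<forall>k. (\<lambda>z. coeff (p z) k) \<in> hol_circle)"

lemma hol_poly_const: "hol_poly (\<lambda>_. p)"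
  by (simp add: hol_poly_def)

lemma hol_poly_scalar: "f \<in> hol_circle \<Longrightarrow> hol_poly (\<lambda>z. [:f z:])"
  unfolding hol_poly_def
proof
  fix k
  assume "f \<in> hol_circle"
  then show "(\<lambda>z. coeff [:f z:] k) \<in> hol_circle" by (cases k) simp_all
qed

lemma hol_poly_add: "hol_poly p \<Longrightarrow> hol_poly q \<Longrightarrow> hol_poly (\<lambda>z. p z + q z)"
  by (auto simp: hol_poly_def intro: hol_circle_add)

lemma hol_poly_mult: "hol_poly p \<Longrightarrow> hol_poly q \<Longrightarrow> hol_poly (\<lambda>z. p z * q z)"
  by (auto simp: hol_poly_def coeff_mult intro!: hol_circle_sum hol_circle_mult)

lemma hol_poly_sum: "(\<And>i. i \<in> I \<Longrightarrow> hol_poly (p i)) \<Longrightarrow> hol_poly (\<lambda>z. \<Sum>i\<in>I. p i z)"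
  by (auto simp: hol_poly_def coeff_sum intro!: hol_circle_sum)

lemma hol_poly_prod: "(\<And>i. i \<in> I \<Longrightarrow> hol_poly (p i)) \<Longrightarrow> hol_poly (\<lambda>z. \<Prod>i\<in>I. p i z)"
  by (induction I rule: infinite_finite_induct) (simp_all add: hol_poly_const hol_poly_mult)

lemma hol_poly_char_poly:
  assumes "\<And>z. M z \<in> carrier_mat n n" "\<And>i j. i < n \<Longrightarrow> j < n \<Longrightarrow> (\<lambda>z. M z $$ (i, j)) \<in> hol_circle"
  shows "hol_poly (\<lambda>z. char_poly (M z))"
proof -
  have carr: "char_poly_matrix (M z) \<in> carrier_mat n n" for z
    using assms(1) by (rule char_poly_matrix_closed)
  have "hol_poly (\<lambda>z. \<Sum>p | p permutes {0..<n}. signof p * (\<Prod>i = 0..<n. char_poly_matrix (M z) $$ (i, p i)))"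
  proof (intro hol_poly_sum hol_poly_mult hol_poly_const hol_poly_prod)
    fix p i assume "p \<in> {p. p permutes {0..<n}}" "i \<in> {0..<n}"
    then have i: "i < n" "p i < n" using permutes_in_image[of p "{0..<n}" i] by auto
    have "(\<lambda>z. char_poly_matrix (M z) $$ (i, p i)) = (\<lambda>z. (if i = p i then [:0, 1:] else 0) + [:- (M z $$ (i, p i)):])"
      using i assms(1) by (auto simp: char_poly_matrix_def fun_eq_iff carrier_matD[OF assms(1)])
    then show "hol_poly (\<lambda>z. char_poly_matrix (M z) $$ (i, p i))"
      using assms(2)[OF i] by (simp only:) (intro hol_poly_add hol_poly_const hol_poly_scalar hol_circle_uminus)
  qed
  then show ?thesis by (simp add: char_poly_def det_def'[OF carr])
qed

text \<open>
The resultant vanishes exactly when \<open>p\<close> and its derivative have a common factor, which over the complex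
numbers means a common root.
\<close>
lemma rsquarefree_iff_resultant:
  fixes p :: "complex poly"
  assumes "p \<noteq> 0"
  shows "rsquarefree p \<longleftrightarrow> resultant p (pderiv p) \<noteq> 0"
proof -
  let ?g = "gcd p (pderiv p)"
  have g0: "?g \<noteq> 0" using assms by simp
  have "degree ?g = 0 \<longleftrightarrow> (\<forall>a. poly ?g a \<noteq> 0)"
  proof
    assume "degree ?g = 0"
    then obtain c where "?g = [:c:]" by (rule degree_eq_zeroE)
    with g0 show "\<forall>a. poly ?g a \<noteq> 0" by auto
  next
    assume *: "\<forall>a. poly ?g a \<noteq> 0"
    show "degree ?g = 0"
    proof (rule ccontr)
      assume "degree ?g \<noteq> 0"
      then have "\<not> constant (poly ?g)" by (simp add: constant_degree)
      with fundamental_theorem_of_algebra * show False by blast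
    qed
  qed
  also have "\<dots> \<longleftrightarrow> (\<forall>a. \<not> (poly p a = 0 \<and> poly (pderiv p) a = 0))"
    by (simp add: poly_eq_0_iff_dvd)
  finally show ?thesis by (simp add: resultant_0_gcd rsquarefree_roots)
qed

text \<open>
The constant degree fixes the shape of the Sylvester matrix, so that its determinant is a fixed
polynomial expression in the coefficients.
\<close>
lemma hol_circle_discriminant:
  assumes P: "hol_poly P" and deg: "\<And>z. degree (P z) = n"
  shows "(\<lambda>z. resultant (P z) (pderiv (P z))) \<in> hol_circle"
proof -
  have co: "(\<lambda>z. coeff (P z) k) \<in> hol_circle" for k using P by (simp add: hol_poly_def)
  have co': "(\<lambda>z. coeff (pderiv (P z)) k) \<in> hol_circle" for k
    unfolding coeff_pderiv by (intro hol_circle_intros co)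
  have deg': "degree (pderiv (P z)) = n - 1" for z by (simp add: degree_pderiv deg)
  have "(\<lambda>z. Determinant.det (sylvester_mat_sub n (n - 1) (P z) (pderiv (P z)))) \<in> hol_circle"
  proof (rule hol_circle_det[where n = "n + (n - 1)"])
    show "sylvester_mat_sub n (n - 1) (P z) (pderiv (P z)) \<in> carrier_mat (n + (n - 1)) (n + (n - 1))" for z
      by (simp add: sylvester_mat_sub_def)
    fix i j assume "i < n + (n - 1)" "j < n + (n - 1)"
    then have "(\<lambda>z. sylvester_mat_sub n (n - 1) (P z) (pderiv (P z)) $$ (i, j)) =
       (if i < n - 1 then if i \<le> j \<and> j - i \<le> n then (\<lambda>z. coeff (P z) (n + i - j)) else (\<lambda>_. 0)
        else if i - (n - 1) \<le> j \<and> j \<le> i then (\<lambda>z. coeff (pderiv (P z)) (i - j)) else (\<lambda>_. 0))"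
      by (auto simp: sylvester_mat_sub_def fun_eq_iff)
    then show "(\<lambda>z. sylvester_mat_sub n (n - 1) (P z) (pderiv (P z)) $$ (i, j)) \<in> hol_circle"
      by (simp add: co co')
  qed
  then show ?thesis by (simp add: resultant_def sylvester_mat_def deg deg')
qed

text \<open>
The zeros are isolated, so every point of the circle has a neighbourhood that contains no zero except
possibly the point itself.
\<close>
lemma zeros_near_circle_lie_on_circle:
  assumes f: "f \<in> hol_circle" "z0 \<in> S1" "f z0 \<noteq> 0"
  obtains W where "open W" "S1 \<subseteq> W" "\<And>z. z \<in> W \<Longrightarrow> f z = 0 \<Longrightarrow> z \<in> S1"
proof -
  obtain V where V: "open V" "connected V" "S1 \<subseteq> V" "f holomorphic_on V"
    using hol_circle_connected_domain[OF f(1)] .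
  have "\<exists>e>0. \<forall>z\<in>ball p e - {p}. f z \<noteq> 0" if p: "p \<in> S1" for p
  proof (cases "f p = 0")
    case True
    show ?thesis
      using isolated_zeros[OF V(4,1,2) subsetD[OF V(3) p] True subsetD[OF V(3) f(2)] f(3)] by metis
  next
    case False
    have "isCont f p"
      using holomorphic_on_imp_continuous_on[OF V(4)] V(1) subsetD[OF V(3) p]
      by (simp add: continuous_on_eq_continuous_at)
    from continuous_at_avoid[OF this False] show ?thesis by (metis DiffD1 mem_ball)
  qed
  then obtain e where e: "\<And>p. p \<in> S1 \<Longrightarrow> e p > 0" "\<And>p z. p \<in> S1 \<Longrightarrow> z \<in> ball p (e p) - {p} \<Longrightarrow> f z \<noteq> 0"
    by metis
  show ?thesis
  proof (rule that[of "\<Union>p\<in>S1. ball p (e p)"])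
    show "open (\<Union>p\<in>S1. ball p (e p))" by auto
    show "S1 \<subseteq> (\<Union>p\<in>S1. ball p (e p))"
    proof
      fix p assume "p \<in> S1"
      then show "p \<in> (\<Union>p\<in>S1. ball p (e p))" using e(1)[of p] by (intro UN_I[of p]) auto
    qed
    fix z assume "z \<in> (\<Union>p\<in>S1. ball p (e p))" "f z = 0"
    then obtain p where p: "p \<in> S1" "z \<in> ball p (e p)" by blast
    then have "z = p" using e(2)[OF p(1), of z] \<open>f z = 0\<close> by blast
    then show "z \<in> S1" using p(1) by simp
  qed
qed

lemma mat_vec_sum:
  assumes "A \<in> carrier_mat n n" "i < n" "v \<in> carrier_vec n"
  shows "(A *\<^sub>v v) $ i = (\<Sum>j<n. A $$ (i, j) * v $ j)"
  using assms by (simp add: scalar_prod_def lessThan_atLeast0)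

text \<open>
Vectors are functions on the index range from here on, as their entries will vary with a point of the
circle.
\<close>
lemma char_poly_root_iff:
  fixes A :: "complex mat"
  assumes A: "A \<in> carrier_mat n n"
  shows "poly (char_poly A) x = 0 \<longleftrightarrow>
     (\<exists>v. (\<exists>j<n. v j \<noteq> 0) \<and> (\<forall>i<n. (\<Sum>j<n. A $$ (i, j) * v j) = x * v i))"
    (is "?L \<longleftrightarrow> ?R")
proof
  assume ?L
  then obtain v where v: "v \<in> carrier_vec n" "v \<noteq> 0\<^sub>v n" "A *\<^sub>v v = x \<cdot>\<^sub>v v"
    using eigenvalue_root_char_poly[OF A, of x] A by (auto simp: eigenvalue_def eigenvector_def)
  have "\<exists>j<n. v $ j \<noteq> 0" using v(1,2) by (metis carrier_vecD eq_vecI index_zero_vec)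
  moreover have "(\<Sum>j<n. A $$ (i, j) * v $ j) = x * v $ i" if "i < n" for i
    using mat_vec_sum[OF A that v(1)] v(1,3) that by simp
  ultimately show ?R by (intro exI[of _ "\<lambda>j. v $ j"]) auto
next
  assume ?R
  then obtain v where v: "\<exists>j<n. v j \<noteq> 0" "\<And>i. i < n \<Longrightarrow> (\<Sum>j<n. A $$ (i, j) * v j) = x * v i" by auto
  have "vec n v \<noteq> 0\<^sub>v n" using v(1) by (metis index_vec index_zero_vec(1))
  moreover have "A *\<^sub>v vec n v = x \<cdot>\<^sub>v vec n v"
  proof (rule eq_vecI)
    fix i assume "i < dim_vec (x \<cdot>\<^sub>v vec n v)"
    then have i: "i < n" by simp
    show "(A *\<^sub>v vec n v) $ i = (x \<cdot>\<^sub>v vec n v) $ i"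
      using mat_vec_sum[OF A i vec_carrier] v(2)[OF i] i by simp
  qed (use A in auto)
  ultimately have "eigenvalue A x"
    using A unfolding eigenvalue_def eigenvector_def by (intro exI[of _ "vec n v"]) simp
  then show ?L using eigenvalue_root_char_poly[OF A] by simp
qed

text \<open>
The entrywise form of \<open>para_hermitian\<close>, which replaces the para-Hermitian conjugate by the conjugate
transpose.
\<close>
definition hermitian_on_circle :: "nat \<Rightarrow> (complex \<Rightarrow> complex mat) \<Rightarrow> bool" where
  "hermitian_on_circle n A \<longleftrightarrow>
     A \<in> hol_circle_mat n n \<and> (\<forall>z\<in>S1. \<forall>i<n. \<forall>j<n. cnj (A z $$ (i, j)) = A z $$ (j, i))"

lemma hermitian_on_circleD:
  assumes "hermitian_on_circle n A"
  shows "A z \<in> carrier_mat n n" "i < n \<Longrightarrow> j < n \<Longrightarrow> (\<lambda>z. A z $$ (i, j)) \<in> hol_circle"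
    "z \<in> S1 \<Longrightarrow> i < n \<Longrightarrow> j < n \<Longrightarrow> cnj (A z $$ (i, j)) = A z $$ (j, i)"
  using assms unfolding hermitian_on_circle_def hol_circle_mat_def by simp_all

lemma para_conj_carrier: "A (inverse (cnj z)) \<in> carrier_mat m n \<Longrightarrow> para_conj A z \<in> carrier_mat n m"
  by (simp add: para_conj_def)

lemma para_conj_index:
  assumes "A z \<in> carrier_mat m n" "z \<in> S1" "i < n" "j < m"
  shows "para_conj A z $$ (i, j) = cnj (A z $$ (j, i))"
  using assms by (simp add: para_conj_def inverse_cnj_S1)

lemma para_hermitian_iff: "para_hermitian n A \<longleftrightarrow> hermitian_on_circle n A"
proof -
  have "A z = para_conj A z \<longleftrightarrow> (\<forall>i<n. \<forall>j<n. cnj (A z $$ (i, j)) = A z $$ (j, i))"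
    if A: "A \<in> hol_circle_mat n n" and z: "z \<in> S1" for z
  proof -
    have c: "A z \<in> carrier_mat n n" for z using A unfolding hol_circle_mat_def by simp
    have c': "para_conj A z \<in> carrier_mat n n" using c by (rule para_conj_carrier)
    have "A z = para_conj A z \<longleftrightarrow> (\<forall>i<n. \<forall>j<n. A z $$ (j, i) = para_conj A z $$ (j, i))"
      using c[of z] c' by (metis carrier_matD eq_matI)
    also have "\<dots> \<longleftrightarrow> (\<forall>i<n. \<forall>j<n. cnj (A z $$ (i, j)) = A z $$ (j, i))"
    proof -
      have "para_conj A z $$ (j, i) = cnj (A z $$ (i, j))" if "i < n" "j < n" for i j
        by (rule para_conj_index[OF c z that(2,1)])
      then show ?thesis by metis
    qed
    finally show ?thesis .
  qed
  then show ?thesis unfolding para_hermitian_def hermitian_on_circle_def by blast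
qed

lemma hermitian_form_swap:
  fixes n :: nat
  assumes "\<And>i j. i < n \<Longrightarrow> j < n \<Longrightarrow> cnj (a i j) = a j i"
  shows "(\<Sum>i<n. cnj (\<Sum>j<n. a i j * v j) * w i) = (\<Sum>i<n. cnj (v i) * (\<Sum>j<n. a i j * w j))"
proof -
  have "(\<Sum>i<n. cnj (\<Sum>j<n. a i j * v j) * w i) = (\<Sum>i<n. \<Sum>j<n. cnj (v j) * (a j i * w i))"
    by (intro sum.cong refl) (simp add: sum_distrib_right assms mult.assoc mult.left_commute)
  also have "\<dots> = (\<Sum>j<n. \<Sum>i<n. cnj (v j) * (a j i * w i))" by (rule sum.swap)
  finally show ?thesis by (simp add: sum_distrib_left)
qed

lemma sum_cnj_self_eq_0_iff:
  fixes n :: nat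
  shows
  "(\<Sum>j<n. cnj (v j) * v j) = 0 \<longleftrightarrow> (\<forall>j<n. v j = (0::complex))"
proof -
  have "(\<Sum>j<n. cnj (v j) * v j) = of_real (\<Sum>j<n. (cmod (v j))\<^sup>2)"
    by (simp add: complex_norm_square[unfolded of_real_power] mult.commute)
  moreover have "(\<Sum>j<n. (cmod (v j))\<^sup>2) = 0 \<longleftrightarrow> (\<forall>j<n. v j = 0)"
    by (subst sum_nonneg_eq_0_iff) auto
  ultimately show ?thesis by (simp only: of_real_eq_0_iff)
qed

lemma hermitian_eigenvalue_real:
  fixes n :: nat
  assumes herm: "\<And>i j. i < n \<Longrightarrow> j < n \<Longrightarrow> cnj (a i j) = a j i"
    and v: "\<exists>j<n. v j \<noteq> 0" "\<And>i. i < n \<Longrightarrow> (\<Sum>j<n. a i j * v j) = x * v i"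
  shows "x \<in> \<real>"
proof -
  have "cnj x * (\<Sum>i<n. cnj (v i) * v i) = x * (\<Sum>i<n. cnj (v i) * v i)"
    using hermitian_form_swap[where n=n and a=a and v=v and w=v, OF herm] v(2)
    by (simp add: sum_distrib_left mult.assoc mult.left_commute)
  moreover have "(\<Sum>i<n. cnj (v i) * v i) \<noteq> 0" using v(1) unfolding sum_cnj_self_eq_0_iff by blast
  ultimately show ?thesis by (simp add: Reals_cnj_iff)
qed

text \<open>
A point \<open>z0\<close> with simple spectrum makes the discriminant a nonzero element of the ring. For a thin
enough strip, \<open>exp (\<i> * t)\<close> then avoids its zeros when \<open>Im t > 0\<close>.
\<close>
lemma analytic_eigenvalue_on_line:
  assumes A: "hermitian_on_circle n A" and n: "n > 0"
    and z0: "z0 \<in> S1" "rsquarefree (char_poly (A z0))"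
  obtains d f where "d > 0" "f holomorphic_on strip d"
    "\<And>t. t \<in> \<real> \<Longrightarrow> poly (char_poly (A (exp (\<i> * t)))) (f t) = 0"
proof -
  note A = hermitian_on_circleD[OF A]
  define P where "P z = char_poly (A z)" for z
  have deg: "degree (P z) = n" "coeff (P z) n = 1" for z
    using degree_monic_char_poly[OF A(1)] by (auto simp: P_def)
  have P0: "P z \<noteq> 0" for z using deg(1)[of z] n by auto
  have holP: "hol_poly P" unfolding P_def using A(1,2) by (rule hol_poly_char_poly)
  obtain W where W: "open W" "S1 \<subseteq> W" "\<And>z. z \<in> W \<Longrightarrow> resultant (P z) (pderiv (P z)) = 0 \<Longrightarrow> z \<in> S1"
    using zeros_near_circle_lie_on_circle[OF hol_circle_discriminant[OF holP deg(1)] z0(1)]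
      z0(2) rsquarefree_iff_resultant[OF P0] by (metis P_def)
  have "\<forall>k. \<exists>V. open V \<and> S1 \<subseteq> V \<and> (\<lambda>z. coeff (P z) k) holomorphic_on V"
    using holP by (simp add: hol_poly_def hol_circle_iff_extension)
  then obtain V where V: "\<And>k. open (V k)" "\<And>k. S1 \<subseteq> V k" "\<And>k. (\<lambda>z. coeff (P z) k) holomorphic_on V k"
    by metis
  define X where "X = W \<inter> (\<Inter>k\<le>n. V k)"
  have X: "open X" "S1 \<subseteq> X"
    unfolding X_def by (intro open_Int open_INT W(1) V(1) ballI finite_atMost) (use W(2) V(2) in blast)
  obtain d where d: "d > 0" "\<And>t. t \<in> strip d \<Longrightarrow> exp (\<i> * t) \<in> X"
    using strip_maps_into_neighbourhood[OF X] by blast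
  interpret monic_family "\<lambda>t. P (exp (\<i> * t))" n "strip d"
  proof
    show "(\<lambda>t. coeff (P (exp (\<i> * t))) k) holomorphic_on strip d" for k
    proof (cases "k \<le> n")
      case True
      have "((\<lambda>z. coeff (P z) k) \<circ> (\<lambda>t. exp (\<i> * t))) holomorphic_on strip d"
        by (rule holomorphic_on_compose_gen[OF _ V(3)[of k]])
           (use d True in \<open>auto simp: X_def intro!: holomorphic_intros\<close>)
      then show ?thesis by (simp add: o_def)
    next
      case False
      then have "(\<lambda>t. coeff (P (exp (\<i> * t))) k) = (\<lambda>_. 0)"
        using deg(1) by (simp add: fun_eq_iff coeff_eq_0)
      then show ?thesis by simp
    qed
  qed (use n open_strip deg in auto)
  have simple: "rsquarefree (P (exp (\<i> * t)))" if t: "0 < Im t" "Im t < d" for t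
  proof -
    have "exp (\<i> * t) \<in> W" using d(2)[of t] t by (simp add: X_def)
    moreover have "cmod (exp (\<i> * t)) < 1" using t by simp
    ultimately show ?thesis using W(3) rsquarefree_iff_resultant[OF P0] by force
  qed
  have real: "x \<in> \<real>" if "t \<in> \<real>" "poly (P (exp (\<i> * t))) x = 0" for t x
  proof -
    have "\<exists>v. (\<exists>j<n. v j \<noteq> 0) \<and> (\<forall>i<n. (\<Sum>j<n. A (exp (\<i> * t)) $$ (i, j) * v j) = x * v i)"
      using that(2) char_poly_root_iff[OF A(1)] unfolding P_def by simp
    then obtain v where v: "\<exists>j<n. v j \<noteq> 0" "\<And>i. i < n \<Longrightarrow> (\<Sum>j<n. A (exp (\<i> * t)) $$ (i, j) * v j) = x * v i"
      by auto
    show ?thesis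
      by (rule hermitian_eigenvalue_real[OF _ v]) (use A(3)[OF exp_ii_S1[OF that(1)]] in auto)
  qed
  show ?thesis
  proof (rule holomorphic_root_across_real_line[OF d(1) refl])
    fix t assume "0 < Im t" "Im t < d"
    then show "rsquarefree (P (exp (\<i> * t)))" by (rule simple)
  next
    fix t x assume "t \<in> \<real>" "poly (P (exp (\<i> * t))) x = 0"
    then show "x \<in> \<real>" by (rule real)
  next
    fix f assume "f holomorphic_on strip d" "\<And>t. t \<in> \<real> \<Longrightarrow> poly (P (exp (\<i> * t))) (f t) = 0"
    then show thesis using that[OF d(1)] by (simp add: P_def)
  qed
qed

section \<open>The cycle of an eigenvalue and its discrete Fourier transform\<close>

text \<open>
At each point two of the translates of \<open>f\<close> by \<open>0, ..., n\<close> turns agree, because a polynomial of degree \<open>n\<close>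
has at most \<open>n\<close> roots. One pair of translates agrees at infinitely many points of a compact interval and
therefore everywhere.
\<close>
lemma root_function_period:
  assumes d: "d > 0" and f: "f holomorphic_on strip d" and n: "n > 0"
    and P: "\<And>z. degree (P z) = n"
    and root: "\<And>t. t \<in> \<real> \<Longrightarrow> poly (P (exp (\<i> * t))) (f t) = 0"
  obtains N where "N > 0" "\<And>t. t \<in> \<real> \<Longrightarrow> f (t + of_nat N * (2 * of_real pi)) = f t"
proof -
  let ?p = "2 * complex_of_real pi"
  have P0: "P z \<noteq> 0" for z using P[of z] n by auto
  define T where "T = complex_of_real ` {0..1}"
  define B where "B = {(j, k). j \<le> n \<and> k \<le> n \<and> j < k}"
  have shift: "poly (P (exp (\<i> * t))) (f (t + of_nat k * ?p)) = 0" if "t \<in> \<real>" for t k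
  proof -
    have "exp (\<i> * (t + of_nat k * ?p)) = exp (\<i> * t)"
    proof -
      have "\<i> * (t + of_nat k * ?p) = \<i> * t + (of_int (2 * int k) * pi) * \<i>" by (simp add: algebra_simps)
      then show ?thesis unfolding exp_eq by blast
    qed
    moreover have "t + of_nat k * ?p \<in> \<real>" using that by (intro Reals_add Reals_mult) auto
    ultimately show ?thesis using root[of "t + of_nat k * ?p"] by simp
  qed
  have "\<exists>b\<in>B. infinite {t\<in>T. case b of (j, k) \<Rightarrow> f (t + of_nat j * ?p) = f (t + of_nat k * ?p)}"
  proof (rule pigeonhole_infinite_rel)
    show "infinite T" unfolding T_def
      by (subst finite_image_iff) (auto simp: inj_on_def infinite_Icc_iff)
    show "finite B" unfolding B_def by (rule finite_subset[of _ "{..n} \<times> {..n}"]) auto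
    show "\<forall>t\<in>T. \<exists>b\<in>B. case b of (j, k) \<Rightarrow> f (t + of_nat j * ?p) = f (t + of_nat k * ?p)"
    proof
      fix t assume "t \<in> T"
      then have t: "t \<in> \<real>" by (auto simp: T_def)
      define h where "h k = f (t + of_nat k * ?p)" for k :: nat
      have "h ` {..n} \<subseteq> {x. poly (P (exp (\<i> * t))) x = 0}" using shift[OF t] by (auto simp: h_def)
      then have "card (h ` {..n}) \<le> card {x. poly (P (exp (\<i> * t))) x = 0}"
        by (intro card_mono poly_roots_finite P0)
      also have "\<dots> \<le> n" using card_poly_roots_bound[OF P0, of "exp (\<i> * t)"] P by simp
      finally have "\<not> inj_on h {..n}" by (intro pigeonhole) simp
      then obtain j k where jk: "j \<le> n" "k \<le> n" "j \<noteq> k" "h j = h k" by (auto simp: inj_on_def)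
      show "\<exists>b\<in>B. case b of (j, k) \<Rightarrow> f (t + of_nat j * ?p) = f (t + of_nat k * ?p)"
      proof (cases "j < k")
        case True
        with jk show ?thesis by (intro bexI[of _ "(j, k)"]) (auto simp: B_def h_def)
      next
        case False
        with jk show ?thesis by (intro bexI[of _ "(k, j)"]) (auto simp: B_def h_def)
      qed
    qed
  qed
  then obtain j k where jk: "j < k" and
    inf: "infinite {t\<in>T. f (t + of_nat j * ?p) = f (t + of_nat k * ?p)}" (is "infinite ?Z")
    by (auto simp: B_def)
  have "compact T" unfolding T_def by (intro compact_continuous_image continuous_intros compact_Icc)
  then obtain p where p: "p \<in> T" "p islimpt ?Z"
    using Heine_Borel_imp_Bolzano_Weierstrass[OF _ inf] by auto
  have TS: "T \<subseteq> strip d" using d by (auto simp: T_def)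
  have eq: "f (t + of_nat j * ?p) = f (t + of_nat k * ?p)" if "t \<in> strip d" for t
    by (rule eq_on_strip[OF d, of "\<lambda>t. f (t + of_nat j * ?p)" "\<lambda>t. f (t + of_nat k * ?p)" ?Z p])
       (use p TS that in \<open>auto intro!: holomorphic_on_strip_shift f\<close>)
  show ?thesis
  proof (rule that[of "k - j"])
    show "k - j > 0" using jk by simp
    fix t :: complex assume t: "t \<in> \<real>"
    have "t - of_nat j * ?p \<in> strip d" using t d by (auto simp: complex_is_Real_iff)
    from eq[OF this] show "f (t + of_nat (k - j) * ?p) = f t"
      using jk by (simp add: of_nat_diff algebra_simps)
  qed
qed

definition root_unity :: "nat \<Rightarrow> complex" where
  "root_unity N = exp (2 * of_real pi * \<i> / of_nat N)"

lemma root_unity_power: "root_unity N ^ k = exp (2 * of_real pi * \<i> * of_nat k / of_nat N)"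
  by (simp add: root_unity_def exp_of_nat_mult[symmetric] mult_ac)

lemma root_unity_power_N: "N > 0 \<Longrightarrow> root_unity N ^ N = 1"
  by (simp add: root_unity_power)

lemma root_unity_power_inj:
  assumes "j < N" "k < N" "root_unity N ^ j = root_unity N ^ k"
  shows "j = k"
  using assms complex_root_unity_eq[of N j k] by (simp add: root_unity_power)

lemma root_unity_S1: "root_unity N ^ k \<in> S1"
  by (simp add: root_unity_def norm_power)

lemma root_unity_nonzero: "root_unity N \<noteq> 0"
  by (simp add: root_unity_def)

lemma S1_mult: "x \<in> S1 \<Longrightarrow> y \<in> S1 \<Longrightarrow> x * y \<in> S1"
  by (simp add: norm_mult)

lemma rotation_S1: "w \<in> S1 \<Longrightarrow> root_unity N ^ k * w \<in> S1"
  by (rule S1_mult[OF root_unity_S1])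

lemma rotation_power_N:
  assumes "N > 0"
  shows "(root_unity N ^ k * w) ^ N = w ^ N"
proof -
  have "(root_unity N ^ k * w) ^ N = (root_unity N ^ N) ^ k * w ^ N"
    by (simp add: power_mult_distrib power_mult[symmetric] mult.commute)
  then show ?thesis using assms by (simp add: root_unity_power_N)
qed

lemma S1_power: "x \<in> S1 \<Longrightarrow> x ^ k \<in> S1"
  by (simp add: norm_power)

lemma S1_nonzero: "x \<in> S1 \<Longrightarrow> x \<noteq> 0"
  by auto

lemma S1_cnj: "x \<in> S1 \<Longrightarrow> cnj x = inverse x"
  by (metis complex_cnj_cnj complex_cnj_inverse inverse_cnj_S1 inverse_inverse_eq)

lemma sum_powers_root_1:
  assumes "y ^ N = 1" "y \<noteq> (1::complex)"
  shows "(\<Sum>k<N. y ^ k) = 0"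
  using assms by (simp add: geometric_sum)

lemma sum_rotation_shift:
  fixes h :: "complex \<Rightarrow> complex"
  assumes N: "N > 0"
  shows "(\<Sum>k<N. h (root_unity N ^ k * (root_unity N * w))) = (\<Sum>k<N. h (root_unity N ^ k * w))"
proof -
  let ?g = "\<lambda>k. h (root_unity N ^ k * w)"
  have "(\<Sum>k<N. h (root_unity N ^ k * (root_unity N * w))) = (\<Sum>k<N. ?g (Suc k))"
    by (simp add: mult_ac)
  moreover have "(\<Sum>k<N. ?g (Suc k)) = (\<Sum>k<N. ?g k)"
  proof -
    have "?g N = ?g 0" using N by (simp add: root_unity_power_N)
    moreover have "?g 0 + (\<Sum>k<N. ?g (Suc k)) = ?g N + (\<Sum>k<N. ?g k)"
      using sum.lessThan_Suc_shift[of ?g N] by (simp only: sum.lessThan_Suc add.commute)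
    ultimately have "?g 0 + (\<Sum>k<N. ?g (Suc k)) = ?g 0 + (\<Sum>k<N. ?g k)" by (simp only:)
    then show ?thesis by (rule add_left_imp_eq)
  qed
  ultimately show ?thesis by (rule trans)
qed

text \<open>
Summation over all rotations makes a function invariant.
\<close>
lemma sum_rotations_descends:
  assumes h: "h \<in> hol_circle" and N: "N > 0"
  obtains f where "f \<in> hol_circle" "\<And>w. w \<in> S1 \<Longrightarrow> f (w ^ N) = (\<Sum>k<N. h (root_unity N ^ k * w))"
proof -
  have hol: "(\<lambda>w. \<Sum>k<N. h (root_unity N ^ k * w)) \<in> hol_circle"
    by (intro hol_circle_sum hol_circle_compose[OF _ h] hol_circle_intros rotation_S1)
  show ?thesis
  proof (rule rotation_invariant_descends[OF hol N])
    show "(\<Sum>k<N. h (root_unity N ^ k * (exp (2 * of_real pi * \<i> / of_nat N) * w))) =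
        (\<Sum>k<N. h (root_unity N ^ k * w))" for w
      using sum_rotation_shift[OF N, of h w] by (simp only: root_unity_def)
  qed (rule that)
qed

lemma sum_root_unity_ratio:
  assumes N: "N > 0" and ab: "a < N" "b < N"
  shows "(\<Sum>k<N. (root_unity N ^ a * inverse (root_unity N) ^ b) ^ k) = (if a = b then of_nat N else 0)"
proof -
  let ?y = "root_unity N ^ a * inverse (root_unity N) ^ b"
  have "?y ^ N = (root_unity N ^ N) ^ a * inverse ((root_unity N ^ N) ^ b)"
    by (simp add: power_mult_distrib power_inverse power_mult[symmetric] mult_ac)
  then have "?y ^ N = 1" using N by (simp add: root_unity_power_N)
  moreover have "?y \<noteq> 1" if "a \<noteq> b"
  proof
    assume "?y = 1"
    then have "root_unity N ^ a = root_unity N ^ b" using root_unity_nonzero by (simp add: field_simps)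
    then show False using root_unity_power_inj ab that by blast
  qed
  moreover have "?y = 1" if "a = b"
    using that root_unity_nonzero by (simp add: field_simps)
  ultimately show ?thesis using sum_powers_root_1[of ?y N] by auto
qed

text \<open>
For \<open>w\<close> on the circle the inverse is the conjugate, so these are the inner products of the columns of a
discrete Fourier matrix that is twisted by powers of \<open>w\<close>.
\<close>
lemma dft_columns_orthonormal:
  assumes N: "N > 0" and ab: "a < N" "b < N" and w: "w \<in> S1"
  shows "(\<Sum>k<N. (root_unity N ^ k * w) ^ a * inverse (root_unity N ^ k * w) ^ b) = (if a = b then of_nat N else 0)"
proof -
  let ?y = "root_unity N ^ a * inverse (root_unity N) ^ b"
  have "(\<Sum>k<N. (root_unity N ^ k * w) ^ a * inverse (root_unity N ^ k * w) ^ b)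
      = w ^ a * inverse w ^ b * (\<Sum>k<N. ?y ^ k)"
    unfolding sum_distrib_left
    by (intro sum.cong refl) (simp add: power_mult_distrib power_inverse power_mult[symmetric] mult_ac)
  moreover have "w ^ a * inverse w ^ b = 1" if "a = b"
    using that S1_nonzero[OF w] by (simp add: field_simps)
  ultimately show ?thesis unfolding sum_root_unity_ratio[OF N ab] by auto
qed

lemma dft_rows_orthonormal:
  assumes N: "N > 0" and ab: "a < N" "b < N" and w: "w \<in> S1"
  shows "(\<Sum>l<N. (root_unity N ^ a * w) ^ l * inverse (root_unity N ^ b * w) ^ l) = (if a = b then of_nat N else 0)"
proof -
  let ?y = "root_unity N ^ a * inverse (root_unity N) ^ b"
  have "root_unity N ^ a * w * inverse (root_unity N ^ b * w) = ?y"
    using S1_nonzero[OF w] by (simp add: power_inverse)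
  then have "(\<Sum>l<N. (root_unity N ^ a * w) ^ l * inverse (root_unity N ^ b * w) ^ l) = (\<Sum>l<N. ?y ^ l)"
    by (simp only: power_mult_distrib[symmetric])
  then show ?thesis unfolding sum_root_unity_ratio[OF N ab] .
qed

definition orthonormal :: "nat \<Rightarrow> nat \<Rightarrow> (nat \<Rightarrow> nat \<Rightarrow> complex \<Rightarrow> complex) \<Rightarrow> bool" where
  "orthonormal n m u \<longleftrightarrow> (\<forall>k<m. \<forall>j<n. u k j \<in> hol_circle) \<and>
     (\<forall>z\<in>S1. \<forall>k<m. \<forall>l<m. (\<Sum>j<n. cnj (u k j z) * u l j z) = (if k = l then 1 else 0))"

lemma orthonormalD:
  assumes "orthonormal n m u"
  shows "k < m \<Longrightarrow> j < n \<Longrightarrow> u k j \<in> hol_circle"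
    "z \<in> S1 \<Longrightarrow> k < m \<Longrightarrow> l < m \<Longrightarrow> (\<Sum>j<n. cnj (u k j z) * u l j z) = (if k = l then 1 else 0)"
  using assms unfolding orthonormal_def by simp_all

lemma hermitian_eigenvectors_orthogonal:
  fixes n :: nat
  assumes herm: "\<And>i j. i < n \<Longrightarrow> j < n \<Longrightarrow> cnj (a i j) = a j i"
    and v: "\<And>i. i < n \<Longrightarrow> (\<Sum>j<n. a i j * v j) = x * v i" and x: "x \<in> \<real>"
    and w: "\<And>i. i < n \<Longrightarrow> (\<Sum>j<n. a i j * w j) = y * w i"
  shows "(x - y) * (\<Sum>i<n. cnj (v i) * w i) = 0"
proof -
  have "(\<Sum>i<n. cnj (\<Sum>j<n. a i j * v j) * w i) = x * (\<Sum>i<n. cnj (v i) * w i)"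
    using x by (simp add: v sum_distrib_left mult.assoc Reals_cnj_iff)
  moreover have "(\<Sum>i<n. cnj (v i) * (\<Sum>j<n. a i j * w j)) = y * (\<Sum>i<n. cnj (v i) * w i)"
    by (simp add: w sum_distrib_left mult.left_commute)
  ultimately have "x * (\<Sum>i<n. cnj (v i) * w i) = y * (\<Sum>i<n. cnj (v i) * w i)"
    using hermitian_form_swap[where n=n and a=a and v=v and w=w, OF herm] by simp
  then show ?thesis by (simp add: left_diff_distrib)
qed

text \<open>
With the least period \<open>2 * pi * N\<close> the eigenvalue becomes a function of \<open>w\<close>, where \<open>w ^ N = z\<close>, whose
\<open>N\<close> rotations are distinct elements of the ring: two equal rotations would give a smaller period.
\<close>
lemma eigenvalue_cover:
  assumes A: "hermitian_on_circle n A" and n: "n > 0"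
    and z0: "z0 \<in> S1" "rsquarefree (char_poly (A z0))"
  obtains N ell where "N > 0" "ell \<in> hol_circle"
    "\<And>w. w \<in> S1 \<Longrightarrow> poly (char_poly (A (w ^ N))) (ell w) = 0"
    "\<And>k l. k < l \<Longrightarrow> l < N \<Longrightarrow> \<exists>w\<in>S1. ell (root_unity N ^ k * w) \<noteq> ell (root_unity N ^ l * w)"
proof -
  let ?p = "2 * complex_of_real pi"
  obtain d f where d: "d > 0" and f: "f holomorphic_on strip d"
    "\<And>t. t \<in> \<real> \<Longrightarrow> poly (char_poly (A (exp (\<i> * t)))) (f t) = 0"
    using analytic_eigenvalue_on_line[OF A n z0] by blast
  have deg: "degree (char_poly (A z)) = n" for z
    using degree_monic_char_poly[OF hermitian_on_circleD(1)[OF A]] by simp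
  define Q where "Q N \<longleftrightarrow> N > 0 \<and> (\<forall>t\<in>\<real>. f (t + of_nat N * ?p) = f t)" for N :: nat
  have "\<exists>N. Q N"
  proof (rule root_function_period[OF d f(1) n deg f(2)])
    fix N :: nat assume "N > 0" "\<And>t. t \<in> \<real> \<Longrightarrow> f (t + of_nat N * ?p) = f t"
    then show "\<exists>N. Q N" unfolding Q_def by (intro exI[of _ N]) simp
  qed
  define N where "N = (LEAST N. Q N)"
  have "Q N" unfolding N_def using \<open>\<exists>N. Q N\<close> by (rule LeastI_ex)
  then have N: "N > 0" and per: "\<And>t. t \<in> \<real> \<Longrightarrow> f (t + of_nat N * ?p) = f t"
    by (auto simp: Q_def)
  have least: "\<not> Q m" if "m < N" for m using that unfolding N_def by (rule not_less_Least)
  have "(f \<circ> (\<lambda>t. of_nat N * t)) holomorphic_on strip (d / N)"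
  proof (rule holomorphic_on_compose_gen[OF _ f(1)])
    show "(\<lambda>t. of_nat N * t) ` strip (d / N) \<subseteq> strip d"
      using N by (auto simp: abs_mult pos_less_divide_eq mult.commute)
  qed (auto intro!: holomorphic_intros)
  then have hol: "(\<lambda>t. f (of_nat N * t)) holomorphic_on strip (d / N)" by (simp add: o_def)
  have per': "f (of_nat N * (t + ?p)) = f (of_nat N * t)" if "t \<in> \<real>" for t
    using per[of "of_nat N * t"] that by (simp add: ring_distribs)
  have dN: "d / N > 0" using d N by simp
  obtain ell where ell: "ell \<in> hol_circle" "\<And>t. t \<in> \<real> \<Longrightarrow> ell (exp (\<i> * t)) = f (of_nat N * t)"
    using periodic_descends_to_circle[OF dN hol per'] by blast
  show ?thesis
  proof (rule that[OF N ell(1)])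
    fix w :: complex assume "w \<in> S1"
    then obtain t where t: "t \<in> \<real>" "w = exp (\<i> * t)" using S1_exp_ii by blast
    have "w ^ N = exp (\<i> * (of_nat N * t))"
      unfolding t(2) by (simp add: exp_of_nat_mult[symmetric] mult.left_commute)
    moreover have "of_nat N * t \<in> \<real>" using t(1) by simp
    ultimately show "poly (char_poly (A (w ^ N))) (ell w) = 0"
      using f(2)[of "of_nat N * t"] ell(2)[OF t(1)] t(2) by simp
  next
    fix k l assume kl: "k < l" "l < N"
    have rot: "ell (root_unity N ^ m * exp (\<i> * (s / of_nat N))) = f (s + of_nat m * ?p)" if "s \<in> \<real>" for s m
    proof -
      have "root_unity N ^ m * exp (\<i> * (s / of_nat N)) = exp (\<i> * ((s + of_nat m * ?p) / of_nat N))"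
        unfolding root_unity_power by (simp add: exp_add[symmetric] add_divide_distrib ring_distribs mult_ac add.commute)
      moreover have "(s + of_nat m * ?p) / of_nat N \<in> \<real>" using that by (intro Reals_divide Reals_add Reals_mult) auto
      ultimately show ?thesis using ell(2)[of "(s + of_nat m * ?p) / of_nat N"] N by simp
    qed
    show "\<exists>w\<in>S1. ell (root_unity N ^ k * w) \<noteq> ell (root_unity N ^ l * w)"
    proof (rule ccontr)
      assume "\<not> ?thesis"
      then have eq: "ell (root_unity N ^ k * w) = ell (root_unity N ^ l * w)" if "w \<in> S1" for w using that by blast
      have "f (t + of_nat (l - k) * ?p) = f t" if t: "t \<in> \<real>" for t
      proof -
        let ?s = "t - of_nat k * ?p"
        have s: "?s \<in> \<real>" using t by (intro Reals_diff Reals_mult) auto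
        have "exp (\<i> * (?s / of_nat N)) \<in> S1" using s by (intro exp_ii_S1 Reals_divide) auto
        from eq[OF this] have "f (?s + of_nat k * ?p) = f (?s + of_nat l * ?p)" by (simp only: rot[OF s])
        then show ?thesis using kl by (simp add: of_nat_diff algebra_simps)
      qed
      then have "Q (l - k)" using kl by (simp add: Q_def)
      moreover have "l - k < N" using kl by simp
      ultimately show False using least by blast
    qed
  qed
qed

text \<open>
Distinct eigenvalues of a Hermitian matrix have orthogonal eigenvectors. Two rotations of \<open>ell\<close> may
coincide at some points of the circle, but their difference is not the zero of the ring, and cancelling
it gives orthogonality at every point.
\<close>
lemma eigenvector_cycle:
  assumes A: "hermitian_on_circle n A" and n: "n > 0"
    and z0: "z0 \<in> S1" "rsquarefree (char_poly (A z0))"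
  obtains N ell v where "N > 0" "ell \<in> hol_circle" "\<And>j. j < n \<Longrightarrow> v j \<in> hol_circle"
    "\<And>w i. w \<in> S1 \<Longrightarrow> i < n \<Longrightarrow> (\<Sum>j<n. A (w ^ N) $$ (i, j) * v j w) = ell w * v i w"
    "\<And>w k l. w \<in> S1 \<Longrightarrow> k < N \<Longrightarrow> l < N \<Longrightarrow>
       (\<Sum>i<n. cnj (v i (root_unity N ^ k * w)) * v i (root_unity N ^ l * w)) = (if k = l then 1 else 0)"
proof -
  note AD = hermitian_on_circleD[OF A]
  obtain N ell where N: "N > 0" and ell: "ell \<in> hol_circle"
    and root: "\<And>w. w \<in> S1 \<Longrightarrow> poly (char_poly (A (w ^ N))) (ell w) = 0"
    and dist: "\<And>k l. k < l \<Longrightarrow> l < N \<Longrightarrow> \<exists>w\<in>S1. ell (root_unity N ^ k * w) \<noteq> ell (root_unity N ^ l * w)"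
    using eigenvalue_cover[OF A n z0] by blast
  define a where "a i j w = A (w ^ N) $$ (i, j) - (if i = j then ell w else 0)" for i j w
  have AN: "(\<lambda>w. A (w ^ N) $$ (i, j)) \<in> hol_circle" if "i < n" "j < n" for i j
    by (rule hol_circle_compose[OF _ AD(2)[OF that]]) (intro hol_circle_intros S1_power)+
  have ah: "a i j \<in> hol_circle" if "i \<in> {..<n}" "j \<in> {..<n}" for i j
    using that ell AN unfolding a_def by (cases "i = j") (auto intro!: hol_circle_diff)
  have asum: "(\<Sum>j<n. a i j w * x j) = (\<Sum>j<n. A (w ^ N) $$ (i, j) * x j) - ell w * x i" if "i < n" for i w x
  proof -
    have "(\<Sum>j<n. a i j w * x j) = (\<Sum>j<n. A (w ^ N) $$ (i, j) * x j - (if j = i then ell w * x i else 0))"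
      by (intro sum.cong) (auto simp: a_def left_diff_distrib)
    then show ?thesis using that by (simp add: sum_subtractf sum.delta)
  qed
  have ker: "\<exists>x. (\<exists>j\<in>{..<n}. x j \<noteq> 0) \<and> (\<forall>i\<in>{..<n}. (\<Sum>j<n. a i j w * x j) = 0)" if w: "w \<in> S1" for w
  proof -
    obtain x where x0: "(\<exists>j<n. x j \<noteq> 0) \<and> (\<forall>i<n. (\<Sum>j<n. A (w ^ N) $$ (i, j) * x j) = ell w * x i)"
      using root[OF w] unfolding char_poly_root_iff[OF AD(1)] ..
    note x = x0[THEN conjunct1] x0[THEN conjunct2]
    show ?thesis
    proof (intro exI[of _ x] conjI ballI)
      show "\<exists>j\<in>{..<n}. x j \<noteq> 0" using x(1) by auto
      show "(\<Sum>j<n. a i j w * x j) = 0" if "i \<in> {..<n}" for i using that x(2) by (simp add: asum)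
    qed
  qed
  have real: "ell w \<in> \<real>" if w: "w \<in> S1" for w
  proof -
    obtain x where x0: "(\<exists>j<n. x j \<noteq> 0) \<and> (\<forall>i<n. (\<Sum>j<n. A (w ^ N) $$ (i, j) * x j) = ell w * x i)"
      using root[OF w] unfolding char_poly_root_iff[OF AD(1)] ..
    note x = x0[THEN conjunct1] x0[THEN conjunct2]
    show ?thesis
      by (rule hermitian_eigenvalue_real[where a = "\<lambda>i j. A (w ^ N) $$ (i, j)", OF _ x(1)])
         (use x(2) AD(3)[OF S1_power[OF w]] in auto)
  qed
  show ?thesis
  proof (rule unit_kernel_vector[where J = "{..<n}" and I = "{..<n}" and a = a, OF _ ah ker])
    fix v
    assume vh: "\<And>j. j \<in> {..<n} \<Longrightarrow> v j \<in> hol_circle"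
      and v1: "\<And>z. z \<in> S1 \<Longrightarrow> (\<Sum>j<n. cnj (v j z) * v j z) = 1"
      and v0: "\<And>i z. i \<in> {..<n} \<Longrightarrow> z \<in> S1 \<Longrightarrow> (\<Sum>j<n. a i j z * v j z) = 0"
    have eig: "(\<Sum>j<n. A (w ^ N) $$ (i, j) * v j w) = ell w * v i w" if "w \<in> S1" "i < n" for w i
      using v0[of i w] that asum[OF that(2), of w "\<lambda>j. v j w"] by simp
    let ?r = "\<lambda>k w. root_unity N ^ k * w"
    note rS1 = rotation_S1[of _ N] and rN = rotation_power_N[OF N]
    have rh: "(\<lambda>w. f (?r k w)) \<in> hol_circle" if "f \<in> hol_circle" for f k
      by (rule hol_circle_compose[OF _ that]) (intro hol_circle_intros rS1)+
    have orth: "(\<Sum>i<n. cnj (v i (?r k w)) * v i (?r l w)) = 0" if kl: "k < N" "l < N" "k \<noteq> l" and w: "w \<in> S1" for k l w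
    proof -
      \<comment> \<open>the inner product in the form that lies in the ring\<close>
      define G where "G w = (\<Sum>i<n. cnj (v i (?r k (inverse (cnj w)))) * v i (?r l w))" for w
      have Gh: "G \<in> hol_circle" unfolding G_def
        by (intro hol_circle_sum hol_circle_mult hol_circle_cnj[of "\<lambda>w. v _ (?r k w)"] rh vh)
      have Geq: "G w = (\<Sum>i<n. cnj (v i (?r k w)) * v i (?r l w))" if "w \<in> S1" for w
        using that by (simp only: G_def inverse_cnj_S1)
      have "\<exists>w\<in>S1. ell (?r k w) \<noteq> ell (?r l w)"
        using dist[of k l] dist[of l k] kl by (metis linorder_neqE_nat)
      then obtain w1 where w1: "w1 \<in> S1" "ell (?r k w1) - ell (?r l w1) \<noteq> 0" by auto
      have "G w = 0"
      proof (rule hol_circle_cancel[where f = "\<lambda>w. ell (?r k w) - ell (?r l w)", OF _ Gh w1 _ w])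
        show "(\<lambda>w. ell (?r k w) - ell (?r l w)) \<in> hol_circle" by (intro hol_circle_diff rh ell)
        fix w assume w: "w \<in> S1"
        have "(ell (?r k w) - ell (?r l w)) * (\<Sum>i<n. cnj (v i (?r k w)) * v i (?r l w)) = 0"
        proof (rule hermitian_eigenvectors_orthogonal[where a = "\<lambda>i j. A (w ^ N) $$ (i, j)"])
          show "cnj (A (w ^ N) $$ (i, j)) = A (w ^ N) $$ (j, i)" if "i < n" "j < n" for i j
            using AD(3)[OF S1_power[OF w] that] .
          show "(\<Sum>j<n. A (w ^ N) $$ (i, j) * v j (?r k w)) = ell (?r k w) * v i (?r k w)" if "i < n" for i
            using eig[OF rS1[OF w] that, of k] by (simp only: rN)
          show "(\<Sum>j<n. A (w ^ N) $$ (i, j) * v j (?r l w)) = ell (?r l w) * v i (?r l w)" if "i < n" for i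
            using eig[OF rS1[OF w] that, of l] by (simp only: rN)
          show "ell (?r k w) \<in> \<real>" by (rule real[OF rS1[OF w]])
        qed
        then show "(ell (?r k w) - ell (?r l w)) * G w = 0" by (simp only: Geq[OF w])
      qed
      then show ?thesis using Geq[OF w] by simp
    qed
    have on: "(\<Sum>i<n. cnj (v i (?r k w)) * v i (?r l w)) = (if k = l then 1 else 0)"
      if "w \<in> S1" "k < N" "l < N" for w k l
      using orth[OF that(2,3) _ that(1)] v1[OF rS1[OF that(1)]] by (cases "k = l") auto
    show thesis
      by (rule that[OF N ell _ eig on]) (use vh in auto)
  qed simp
qed

lemma exists_root_S1:
  assumes "z \<in> S1" "N > 0"
  obtains w where "w \<in> S1" "w ^ N = z"
proof -
  obtain t where t: "t \<in> \<real>" "z = exp (\<i> * t)" using S1_exp_ii[OF assms(1)] by blast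
  have "exp (\<i> * (t / of_nat N)) \<in> S1" using t(1) by (intro exp_ii_S1 Reals_divide) auto
  moreover have "exp (\<i> * (t / of_nat N)) ^ N = z"
    using assms(2) unfolding t(2) by (simp add: exp_of_nat_mult[symmetric])
  ultimately show ?thesis using that by blast
qed

text \<open>
The transformed vectors are
\<open>u b = (\<Sum>k<N. (root_unity N ^ k * w) powi (- b) * v (root_unity N ^ k * w)) / sqrt N\<close>.
They are sums over all rotations of \<open>w\<close>, so they depend on \<open>z = w ^ N\<close> only, and they are orthonormal as
the rotated eigenvectors are. The matrix of \<open>A\<close> in this family has the entry
\<open>(\<Sum>k<N. (root_unity N ^ k * w) powi (l - b) * ell (root_unity N ^ k * w)) / N\<close>
in row \<open>l\<close> and column \<open>b\<close>, a function of \<open>z\<close> that depends only on \<open>l - b\<close>. Adding \<open>N\<close> to a negative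
exponent multiplies the entry by \<open>z\<close>, which explains the factor \<open>inverse z\<close> above the diagonal.
\<close>
lemma pseudo_circulant_of_eigenvector_cycle:
  assumes N: "N > 0" and ell: "ell \<in> hol_circle" and vh: "\<And>j. j < n \<Longrightarrow> v j \<in> hol_circle"
    and eig: "\<And>w i. w \<in> S1 \<Longrightarrow> i < n \<Longrightarrow> (\<Sum>j<n. A (w ^ N) $$ (i, j) * v j w) = ell w * v i w"
    and on: "\<And>w k l. w \<in> S1 \<Longrightarrow> k < N \<Longrightarrow> l < N \<Longrightarrow>
       (\<Sum>i<n. cnj (v i (root_unity N ^ k * w)) * v i (root_unity N ^ l * w)) = (if k = l then 1 else 0)"
  obtains u \<phi> where "orthonormal n N u" "\<And>m. \<phi> m \<in> hol_circle"
    "\<And>z i b. z \<in> S1 \<Longrightarrow> i < n \<Longrightarrow> b < N \<Longrightarrow> (\<Sum>j<n. A z $$ (i, j) * u b j z) =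
       (\<Sum>l<N. (if l \<ge> b then \<phi> (l - b) z else inverse z * \<phi> (N + l - b) z) * u l i z)"
proof -
  let ?r = "\<lambda>k w. root_unity N ^ k * w"
  let ?c = "complex_of_real (1 / sqrt N)"
  have cc: "?c * ?c = 1 / of_nat N"
  proof -
    have "?c * ?c = complex_of_real (1 / sqrt N * (1 / sqrt N))" by (simp only: of_real_mult)
    then show ?thesis by simp
  qed
  note rS1 = rotation_S1[of _ N] and rN = rotation_power_N[OF N]
  have "\<exists>f. f \<in> hol_circle \<and> (\<forall>w\<in>S1. f (w ^ N) = (\<Sum>k<N. ?c * inverse (?r k w) ^ b * v i (?r k w)))" if "i < n" for b i
  proof (rule sum_rotations_descends[where h = "\<lambda>w. ?c * inverse w ^ b * v i w", OF _ N])
    show "(\<lambda>w. ?c * inverse w ^ b * v i w) \<in> hol_circle"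
      by (intro hol_circle_mult hol_circle_power hol_circle_const hol_circle_inverse_ident vh that)
  qed (intro exI conjI ballI)
  then have "\<forall>b i. \<exists>f. i < n \<longrightarrow> f \<in> hol_circle \<and> (\<forall>w\<in>S1. f (w ^ N) = (\<Sum>k<N. ?c * inverse (?r k w) ^ b * v i (?r k w)))" by blast
  then obtain u where "\<forall>b i. i < n \<longrightarrow> u b i \<in> hol_circle \<and> (\<forall>w\<in>S1. u b i (w ^ N) = (\<Sum>k<N. ?c * inverse (?r k w) ^ b * v i (?r k w)))"
    unfolding choice_iff by (elim exE)
  then have uh: "i < n \<Longrightarrow> u b i \<in> hol_circle"
    and u: "i < n \<Longrightarrow> w \<in> S1 \<Longrightarrow> u b i (w ^ N) = (\<Sum>k<N. ?c * inverse (?r k w) ^ b * v i (?r k w))" for b i w by simp_all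
  have "\<exists>f. f \<in> hol_circle \<and> (\<forall>w\<in>S1. f (w ^ N) = (\<Sum>k<N. 1 / of_nat N * ?r k w ^ m * ell (?r k w)))" for m
  proof (rule sum_rotations_descends[where h = "\<lambda>w. 1 / of_nat N * w ^ m * ell w", OF _ N])
    show "(\<lambda>w. 1 / of_nat N * w ^ m * ell w) \<in> hol_circle"
      by (intro hol_circle_mult hol_circle_power hol_circle_const hol_circle_ident ell)
  qed (intro exI conjI ballI)
  then have "\<forall>m. \<exists>f. f \<in> hol_circle \<and> (\<forall>w\<in>S1. f (w ^ N) = (\<Sum>k<N. 1 / of_nat N * ?r k w ^ m * ell (?r k w)))" by (rule allI)
  then obtain \<phi> where "\<forall>m. \<phi> m \<in> hol_circle \<and> (\<forall>w\<in>S1. \<phi> m (w ^ N) = (\<Sum>k<N. 1 / of_nat N * ?r k w ^ m * ell (?r k w)))"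
    unfolding choice_iff by (elim exE)
  then have ph: "\<phi> m \<in> hol_circle"
    and phi: "w \<in> S1 \<Longrightarrow> \<phi> m (w ^ N) = (\<Sum>k<N. 1 / of_nat N * ?r k w ^ m * ell (?r k w))" for m w by simp_all
  have ortho: "(\<Sum>j<n. cnj (u a j z) * u b j z) = (if a = b then 1 else 0)"
    if z: "z \<in> S1" and ab: "a < N" "b < N" for z a b
  proof -
    obtain w where w: "w \<in> S1" "w ^ N = z" using exists_root_S1[OF z N] .
    have cu: "cnj (u a j z) = (\<Sum>k<N. ?c * ?r k w ^ a * cnj (v j (?r k w)))" if "j < n" for j
    proof -
      have "cnj (inverse (?r k w)) = ?r k w" for k
        using S1_cnj[OF rS1[OF w(1)], of k] by (metis complex_cnj_cnj)
      then show ?thesis unfolding w(2)[symmetric] u[OF that w(1)] by simp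
    qed
    let ?T = "\<lambda>j k k'. (?c * ?c) * (?r k w ^ a * inverse (?r k' w) ^ b) * (cnj (v j (?r k w)) * v j (?r k' w))"
    have "(\<Sum>j<n. cnj (u a j z) * u b j z) = (\<Sum>j<n. \<Sum>k<N. \<Sum>k'<N. ?T j k k')"
    proof (intro sum.cong refl)
      fix j assume "j \<in> {..<n}"
      then have j: "j < n" by simp
      have "u b j z = (\<Sum>k<N. ?c * inverse (?r k w) ^ b * v j (?r k w))"
        using u[OF j w(1)] w(2) by simp
      then show "cnj (u a j z) * u b j z = (\<Sum>k<N. \<Sum>k'<N. ?T j k k')"
        unfolding cu[OF j] by (simp only: sum_product mult_ac)
    qed
    also have "\<dots> = (\<Sum>k<N. \<Sum>j<n. \<Sum>k'<N. ?T j k k')"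
      by (rule sum.swap)
    also have "\<dots> = (\<Sum>k<N. \<Sum>k'<N. \<Sum>j<n. ?T j k k')"
      by (intro sum.cong refl sum.swap)
    also have "\<dots> = (\<Sum>k<N. \<Sum>k'<N. 
        (?c * ?c) * (?r k w ^ a * inverse (?r k' w) ^ b) * (if k = k' then 1 else 0))"
      by (intro sum.cong refl) (simp only: sum_distrib_left[symmetric] on[OF w(1)] lessThan_iff)
    also have "\<dots> = (\<Sum>k<N. (?c * ?c) * (?r k w ^ a * inverse (?r k w) ^ b))"
      by (intro sum.cong refl) (simp add: if_distrib[of "\<lambda>x. _ * x"] cong: if_cong)
    also have "\<dots> = 1 / of_nat N * (\<Sum>k<N. ?r k w ^ a * inverse (?r k w) ^ b)"
      unfolding cc sum_distrib_left ..
    also have "\<dots> = (if a = b then 1 else 0)"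
      unfolding dft_columns_orthonormal[OF N ab w(1)] using N by simp
    finally show ?thesis .
  qed
  have on_u: "orthonormal n N u"
    unfolding orthonormal_def using uh ortho by simp
  have main: "(\<Sum>j<n. A z $$ (i, j) * u b j z) =
       (\<Sum>l<N. (if l \<ge> b then \<phi> (l - b) z else inverse z * \<phi> (N + l - b) z) * u l i z)"
    if z: "z \<in> S1" and i: "i < n" and b: "b < N" for z i b
  proof -
    obtain w where w: "w \<in> S1" "w ^ N = z" using exists_root_S1[OF z N] .
    have uz: "u b j z = (\<Sum>k<N. ?c * inverse (?r k w) ^ b * v j (?r k w))" if "j < n" for j b
      using u[OF that w(1)] w(2) by simp
    \<comment> \<open>the inverse transform expresses the rotated eigenvectors by the vectors \<open>u l\<close>\<close>
    have inv: "v i (?r k w) = (\<Sum>l<N. ?c * ?r k w ^ l * u l i z)" if k: "k < N" for k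
    proof -
      have "(\<Sum>l<N. ?c * ?r k w ^ l * u l i z) = (\<Sum>l<N. \<Sum>k'<N. (?c * ?c) * (?r k w ^ l * inverse (?r k' w) ^ l) * v i (?r k' w))"
        unfolding uz[OF i] by (simp only: sum_distrib_left mult_ac)
      also have "\<dots> = (\<Sum>k'<N. \<Sum>l<N. (?c * ?c) * (?r k w ^ l * inverse (?r k' w) ^ l) * v i (?r k' w))"
        by (rule sum.swap)
      also have "\<dots> = (\<Sum>k'<N. (?c * ?c) * (if k = k' then of_nat N else 0) * v i (?r k' w))"
        by (intro sum.cong refl)
           (simp only: sum_distrib_left[symmetric] sum_distrib_right[symmetric] dft_rows_orthonormal[OF N k _ w(1)] lessThan_iff)
      also have "\<dots> = v i (?r k w)"
        unfolding cc using k N by (simp add: if_distrib[of "\<lambda>x. _ * x"] if_distrib[of "\<lambda>x. x * _"] cong: if_cong)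
      finally show ?thesis by simp
    qed
    have coeff: "(\<Sum>k<N. 1 / of_nat N * (inverse (?r k w) ^ b * ?r k w ^ l) * ell (?r k w)) =
        (if l \<ge> b then \<phi> (l - b) z else inverse z * \<phi> (N + l - b) z)" if l: "l < N" for l
    proof (cases "l \<ge> b")
      case True
      have "inverse y ^ b * y ^ l = y ^ (l - b)" if "y \<noteq> 0" for y :: complex
        using that True by (simp add: power_diff power_inverse divide_inverse mult.commute)
      then have "inverse (?r k w) ^ b * ?r k w ^ l = ?r k w ^ (l - b)" for k
        using S1_nonzero[OF rS1[OF w(1)]] by blast
      then show ?thesis using True phi[OF w(1), of "l - b"] w(2) by (simp only: if_True)
    next
      case False
      have shift: "inverse y ^ b * y ^ l = inverse (y ^ N) * y ^ (N + l - b)" if "y \<noteq> 0" for y :: complex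
        using that b by (simp add: power_diff power_add power_inverse divide_inverse)
      have "inverse (?r k w) ^ b * ?r k w ^ l = inverse z * ?r k w ^ (N + l - b)" for k
        using shift[OF S1_nonzero[OF rS1[OF w(1)]], of k] unfolding rN w(2) .
      then show ?thesis using False phi[OF w(1), of "N + l - b"] w(2)
        by (simp only: if_False sum_distrib_left mult_ac)
    qed
    have "(\<Sum>j<n. A z $$ (i, j) * u b j z) = (\<Sum>j<n. \<Sum>k<N. ?c * inverse (?r k w) ^ b * (A z $$ (i, j) * v j (?r k w)))"
      by (intro sum.cong refl) (simp only: uz lessThan_iff sum_distrib_left mult_ac)
    also have "\<dots> = (\<Sum>k<N. \<Sum>j<n. ?c * inverse (?r k w) ^ b * (A z $$ (i, j) * v j (?r k w)))"
      by (rule sum.swap)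
    also have "\<dots> = (\<Sum>k<N. ?c * inverse (?r k w) ^ b * (ell (?r k w) * v i (?r k w)))"
    proof (intro sum.cong refl)
      fix k
      show "(\<Sum>j<n. ?c * inverse (?r k w) ^ b * (A z $$ (i, j) * v j (?r k w))) = ?c * inverse (?r k w) ^ b * (ell (?r k w) * v i (?r k w))"
        using eig[OF rS1[OF w(1)] i, of k] unfolding rN w(2) by (simp only: sum_distrib_left[symmetric])
    qed
    also have "\<dots> = (\<Sum>k<N. \<Sum>l<N. (?c * ?c) * (inverse (?r k w) ^ b * ?r k w ^ l) * ell (?r k w) * u l i z)"
      by (intro sum.cong refl) (simp only: inv lessThan_iff, simp only: sum_distrib_left mult_ac)
    also have "\<dots> = (\<Sum>l<N. \<Sum>k<N. (?c * ?c) * (inverse (?r k w) ^ b * ?r k w ^ l) * ell (?r k w) * u l i z)"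
      by (rule sum.swap)
    also have "\<dots> = (\<Sum>l<N. (if l \<ge> b then \<phi> (l - b) z else inverse z * \<phi> (N + l - b) z) * u l i z)"
      unfolding cc by (intro sum.cong refl) (simp only: sum_distrib_right[symmetric] coeff lessThan_iff)
    finally show ?thesis .
  qed
  show ?thesis by (rule that[OF on_u ph main])
qed

lemma pseudo_circulant_invariant_subspace:
  assumes A: "hermitian_on_circle n A" and n: "n > 0"
    and z0: "z0 \<in> S1" "rsquarefree (char_poly (A z0))"
  obtains N u \<phi> where "N > 0" "orthonormal n N u" "\<And>m. \<phi> m \<in> hol_circle"
    "\<And>z i b. z \<in> S1 \<Longrightarrow> i < n \<Longrightarrow> b < N \<Longrightarrow> (\<Sum>j<n. A z $$ (i, j) * u b j z) =
       (\<Sum>l<N. (if l \<ge> b then \<phi> (l - b) z else inverse z * \<phi> (N + l - b) z) * u l i z)"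
proof (rule eigenvector_cycle[OF A n z0])
  fix N ell v
  assume N: "N > 0" and cyc: "ell \<in> hol_circle" "\<And>j. j < n \<Longrightarrow> v j \<in> hol_circle"
    "\<And>w i. w \<in> S1 \<Longrightarrow> i < n \<Longrightarrow> (\<Sum>j<n. A (w ^ N) $$ (i, j) * v j w) = ell w * v i w"
    "\<And>w k l. w \<in> S1 \<Longrightarrow> k < N \<Longrightarrow> l < N \<Longrightarrow>
       (\<Sum>i<n. cnj (v i (root_unity N ^ k * w)) * v i (root_unity N ^ l * w)) = (if k = l then 1 else 0)"
  show thesis
    by (rule pseudo_circulant_of_eigenvector_cycle[OF N cyc]) (assumption | rule that[OF N])+
qed

section \<open>Orthonormal families and multiple eigenvalues\<close>

lemma underdetermined_system:
  fixes b :: "nat \<Rightarrow> nat \<Rightarrow> complex"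
  assumes "m < n"
  shows "\<exists>x. (\<exists>j<n. x j \<noteq> 0) \<and> (\<forall>i<m. (\<Sum>j<n. b i j * x j) = 0)"
proof -
  define M where "M = mat n n (\<lambda>(i, j). if i < m then b i j else 0)"
  have M: "M \<in> carrier_mat n n" by (simp add: M_def)
  have MT: "transpose_mat M \<in> carrier_mat n n" using M by simp
  have "transpose_mat M *\<^sub>v unit_vec n (n - 1) = 0\<^sub>v n"
    using assms by (intro eq_vecI) (auto simp: M_def)
  moreover have "unit_vec n (n - 1) \<noteq> (0\<^sub>v n :: complex vec)"
    using assms by (intro unit_vec_nonzero) simp
  ultimately have "Determinant.det (transpose_mat M) = 0"
    unfolding det_0_iff_vec_prod_zero[OF MT] by (intro exI[of _ "unit_vec n (n - 1)"]) simp
  then have "Determinant.det M = 0" using det_transpose[OF M] by simp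
  then obtain v where v0: "v \<in> carrier_vec n \<and> v \<noteq> 0\<^sub>v n \<and> M *\<^sub>v v = 0\<^sub>v n"
    unfolding det_0_iff_vec_prod_zero[OF M] ..
  then have v: "v \<in> carrier_vec n" "v \<noteq> 0\<^sub>v n" "M *\<^sub>v v = 0\<^sub>v n" by auto
  show ?thesis
  proof (intro exI[of _ "\<lambda>j. v $ j"] conjI allI impI)
    show "\<exists>j<n. v $ j \<noteq> 0" using v(1,2) by (metis carrier_vecD eq_vecI index_zero_vec)
    fix i assume i: "i < m"
    have "(M *\<^sub>v v) $ i = (\<Sum>j<n. M $$ (i, j) * v $ j)"
      using mat_vec_sum[OF M _ v(1), of i] i assms by simp
    also have "\<dots> = (\<Sum>j<n. b i j * v $ j)"
      using i assms by (intro sum.cong) (auto simp: M_def)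
    finally show "(\<Sum>j<n. b i j * v $ j) = 0" using v(3) i assms by simp
  qed
qed

text \<open>
Taking only the first \<open>m\<close> of the \<open>p\<close> vectors in the sum covers two uses at once: the coefficients of a
linear combination, and orthogonality of the remaining vectors to it.
\<close>
lemma orthonormal_coefficient:
  assumes u: "orthonormal n p u" and z: "z \<in> S1" and l: "l < p" and m: "m \<le> p"
  shows "(\<Sum>j<n. cnj (u l j z) * (\<Sum>k<m. c k * u k j z)) = (if l < m then c l else 0)"
proof -
  have "(\<Sum>j<n. cnj (u l j z) * (\<Sum>k<m. c k * u k j z)) =
      (\<Sum>j<n. \<Sum>k<m. c k * (cnj (u l j z) * u k j z))"
    by (simp only: sum_distrib_left mult_ac)
  also have "\<dots> = (\<Sum>k<m. \<Sum>j<n. c k * (cnj (u l j z) * u k j z))" by (rule sum.swap)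
  also have "\<dots> = (\<Sum>k<m. c k * (if l = k then 1 else 0))"
  proof (intro sum.cong refl)
    fix k assume "k \<in> {..<m}"
    then have "k < p" using m by simp
    from orthonormalD(2)[OF u z l this]
    show "(\<Sum>j<n. c k * (cnj (u l j z) * u k j z)) = c k * (if l = k then 1 else 0)"
      by (simp only: sum_distrib_left[symmetric])
  qed
  also have "\<dots> = (if l < m then c l else 0)"
    by (simp add: if_distrib[of "\<lambda>y. _ * y"] cong: if_cong)
  finally show ?thesis .
qed

lemma orthonormal_bound:
  assumes "orthonormal n m u"
  shows "m \<le> n"
proof (rule ccontr)
  assume "\<not> m \<le> n"
  then have "n < m" by simp
  from underdetermined_system[OF this, of "\<lambda>j k. u k j 1"]
  obtain x where x0: "(\<exists>k<m. x k \<noteq> 0) \<and> (\<forall>j<n. (\<Sum>k<m. u k j 1 * x k) = 0)" ..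
  have "x l = 0" if l: "l < m" for l
  proof -
    have "x l = (\<Sum>j<n. cnj (u l j 1) * (\<Sum>k<m. x k * u k j 1))"
      using orthonormal_coefficient[OF assms _ l, of 1 m x] l by simp
    also have "\<dots> = 0" using x0 by (intro sum.neutral) (simp add: mult.commute)
    finally show ?thesis .
  qed
  with x0 show False by blast
qed

lemma orthonormal_snoc:
  assumes u: "orthonormal n m u"
    and vh: "\<And>j. j < n \<Longrightarrow> v j \<in> hol_circle"
    and v1: "\<And>z. z \<in> S1 \<Longrightarrow> (\<Sum>j<n. cnj (v j z) * v j z) = 1"
    and v0: "\<And>k z. k < m \<Longrightarrow> z \<in> S1 \<Longrightarrow> (\<Sum>j<n. cnj (u k j z) * v j z) = 0"
  shows "orthonormal n (Suc m) (u(m := v))"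
  unfolding orthonormal_def
proof (intro conjI allI impI ballI)
  show "(u(m := v)) k j \<in> hol_circle" if "k < Suc m" "j < n" for k j
    using that vh orthonormalD(1)[OF u] by (cases "k = m") auto
  fix z k l assume z: "z \<in> S1" and kl: "k < Suc m" "l < Suc m"
  have v0': "(\<Sum>j<n. cnj (v j z) * u k j z) = 0" if "k < m" for k
  proof -
    have "(\<Sum>j<n. cnj (v j z) * u k j z) = cnj (\<Sum>j<n. cnj (u k j z) * v j z)"
      by (simp add: mult.commute)
    then show ?thesis using v0[OF that z] by simp
  qed
  show "(\<Sum>j<n. cnj ((u(m := v)) k j z) * (u(m := v)) l j z) = (if k = l then 1 else 0)"
    using kl v0[OF _ z] v0' v1[OF z] orthonormalD(2)[OF u z]
    by (cases "k = m"; cases "l = m") auto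
qed

text \<open>
At each point there are fewer equations than unknowns for a vector that is orthogonal to the family.
\<close>
lemma orthonormal_extend:
  assumes u: "orthonormal n m u" and mn: "m < n"
  obtains v where "orthonormal n (Suc m) (u(m := v))"
proof -
  define a where "a k j z = cnj (u k j (inverse (cnj z)))" for k j z
  have ah: "a k j \<in> hol_circle" if "k \<in> {..<m}" "j \<in> {..<n}" for k j
    unfolding a_def using that orthonormalD(1)[OF u] by (intro hol_circle_cnj) auto
  have aeq: "a k j z = cnj (u k j z)" if "z \<in> S1" for k j z
    using that by (simp only: a_def inverse_cnj_S1)
  show ?thesis
  proof (rule unit_kernel_vector[where J = "{..<n}" and I = "{..<m}" and a = a, OF _ ah])
    fix z assume "z \<in> S1"
    show "\<exists>x. (\<exists>j\<in>{..<n}. x j \<noteq> 0) \<and> (\<forall>i\<in>{..<m}. (\<Sum>j<n. a i j z * x j) = 0)"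
      using underdetermined_system[OF mn, of "\<lambda>i j. a i j z"] by (simp only: lessThan_iff Ball_def Bex_def)
  next
    fix v
    assume v: "\<And>j. j \<in> {..<n} \<Longrightarrow> v j \<in> hol_circle"
      "\<And>z. z \<in> S1 \<Longrightarrow> (\<Sum>j<n. cnj (v j z) * v j z) = 1"
      "\<And>i z. i \<in> {..<m} \<Longrightarrow> z \<in> S1 \<Longrightarrow> (\<Sum>j<n. a i j z * v j z) = 0"
    show thesis
    proof (rule that, rule orthonormal_snoc[OF u])
      show "v j \<in> hol_circle" if "j < n" for j using v(1) that by simp
      show "(\<Sum>j<n. cnj (v j z) * v j z) = 1" if "z \<in> S1" for z using v(2) that .
      show "(\<Sum>j<n. cnj (u k j z) * v j z) = 0" if "k < m" "z \<in> S1" for k z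
        using v(3)[of k z] that by (simp only: aeq lessThan_iff)
    qed
  qed simp
qed

lemma orthonormal_complete:
  assumes "orthonormal n m u"
  shows "\<exists>u'. orthonormal n n u' \<and> (\<forall>k<m. u' k = u k)"
  using assms
proof (induction "n - m" arbitrary: m u)
  case 0
  then have "m = n" using orthonormal_bound[OF 0(2)] by simp
  with 0 show ?case by (intro exI[of _ u]) simp
next
  case (Suc d)
  then have mn: "m < n" by simp
  obtain v where v: "orthonormal n (Suc m) (u(m := v))"
    by (rule orthonormal_extend[OF Suc.prems mn])
  have "d = n - Suc m" using Suc.hyps(2) by simp
  from Suc.hyps(1)[OF this v] obtain u' where
    u': "orthonormal n n u' \<and> (\<forall>k<Suc m. u' k = (u(m := v)) k)" ..
  then show ?case by (intro exI[of _ u']) auto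
qed

definition column_mat :: "nat \<Rightarrow> (nat \<Rightarrow> nat \<Rightarrow> complex \<Rightarrow> complex) \<Rightarrow> complex \<Rightarrow> complex mat" where
  "column_mat n u z = mat n n (\<lambda>(i, j). u j i z)"

lemma hol_circle_matI:
  assumes "\<And>z. A z \<in> carrier_mat m n" "\<And>i j. i < m \<Longrightarrow> j < n \<Longrightarrow> (\<lambda>z. A z $$ (i, j)) \<in> hol_circle"
  shows "A \<in> hol_circle_mat m n"
  using assms unfolding hol_circle_mat_def by simp

lemma hol_circle_matD:
  assumes "A \<in> hol_circle_mat m n"
  shows "A z \<in> carrier_mat m n" "i < m \<Longrightarrow> j < n \<Longrightarrow> (\<lambda>z. A z $$ (i, j)) \<in> hol_circle"
  using assms unfolding hol_circle_mat_def by simp_all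

lemma mat_mult_index_sum:
  assumes "A \<in> carrier_mat m n" "B \<in> carrier_mat n p" "i < m" "j < p"
  shows "(A * B) $$ (i, j) = (\<Sum>k<n. A $$ (i, k) * B $$ (k, j))"
  using assms by (simp add: scalar_prod_def lessThan_atLeast0)

lemma hol_circle_mat_mult:
  assumes "A \<in> hol_circle_mat m n" "B \<in> hol_circle_mat n p"
  shows "(\<lambda>z. A z * B z) \<in> hol_circle_mat m p"
proof (rule hol_circle_matI)
  note A = hol_circle_matD[OF assms(1)] and B = hol_circle_matD[OF assms(2)]
  show "A z * B z \<in> carrier_mat m p" for z using A(1)[of z] B(1)[of z] by simp
  fix i j assume ij: "i < m" "j < p"
  have "(\<lambda>z. \<Sum>k<n. A z $$ (i, k) * B z $$ (k, j)) \<in> hol_circle"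
    using ij by (intro hol_circle_sum hol_circle_mult A(2) B(2)) auto
  then show "(\<lambda>z. (A z * B z) $$ (i, j)) \<in> hol_circle"
    by (simp only: mat_mult_index_sum[OF A(1) B(1) ij])
qed

lemma hol_circle_mat_para_conj:
  assumes "A \<in> hol_circle_mat m n"
  shows "para_conj A \<in> hol_circle_mat n m"
proof (rule hol_circle_matI)
  note A = hol_circle_matD[OF assms]
  show "para_conj A z \<in> carrier_mat n m" for z by (rule para_conj_carrier[where A = A, OF A(1)])
  fix i j assume ij: "i < n" "j < m"
  have "para_conj A z $$ (i, j) = cnj (A (inverse (cnj z)) $$ (j, i))" for z
    using ij A(1)[of "inverse (cnj z)"] by (simp add: para_conj_def)
  then show "(\<lambda>z. para_conj A z $$ (i, j)) \<in> hol_circle"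
    using hol_circle_cnj[OF A(2)[OF ij(2,1)]] by simp
qed

lemma para_conj_mult:
  assumes "A \<in> hol_circle_mat m n" "B \<in> hol_circle_mat n p"
  shows "para_conj (\<lambda>z. A z * B z) z = para_conj B z * para_conj A z"
proof -
  let ?w = "inverse (cnj z)"
  note A = hol_circle_matD(1)[OF assms(1), of ?w] and B = hol_circle_matD(1)[OF assms(2), of ?w]
  interpret cnj_hom: comm_ring_hom cnj by unfold_locales auto
  have "transpose_mat (A ?w * B ?w) = transpose_mat (B ?w) * transpose_mat (A ?w)"
    by (rule transpose_mult[OF A B])
  then show ?thesis unfolding para_conj_def
    using cnj_hom.mat_hom_mult[of "transpose_mat (B ?w)" p n "transpose_mat (A ?w)" m] A B by simp
qed

text \<open>
One of the two products is the Gram matrix of the columns; for square matrices a one-sided inverse is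
two-sided.
\<close>
lemma column_mat_para_unitary:
  assumes u: "orthonormal n n u"
  shows "para_unitary n (column_mat n u)"
proof -
  have U: "column_mat n u z \<in> carrier_mat n n" for z by (simp add: column_mat_def)
  have hol: "column_mat n u \<in> hol_circle_mat n n"
    by (rule hol_circle_matI[OF U]) (simp add: column_mat_def orthonormalD(1)[OF u])
  have 1: "para_conj (column_mat n u) z * column_mat n u z = 1\<^sub>m n" if z: "z \<in> S1" for z
  proof (rule eq_matI)
    fix i j assume "i < dim_row (1\<^sub>m n :: complex mat)" "j < dim_col (1\<^sub>m n :: complex mat)"
    then have ij: "i < n" "j < n" by auto
    have "(para_conj (column_mat n u) z * column_mat n u z) $$ (i, j)
       = (\<Sum>k<n. para_conj (column_mat n u) z $$ (i, k) * column_mat n u z $$ (k, j))"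
      by (rule mat_mult_index_sum[OF para_conj_carrier[where A = "column_mat n u", OF U] U ij])
    also have "\<dots> = (\<Sum>k<n. cnj (u i k z) * u j k z)"
      using ij by (intro sum.cong refl) (simp add: para_conj_index[where A = "column_mat n u", OF U z] column_mat_def)
    finally show "(para_conj (column_mat n u) z * column_mat n u z) $$ (i, j) = 1\<^sub>m n $$ (i, j)"
      using orthonormalD(2)[OF u z ij] ij by simp
  qed (use U para_conj_carrier[where A = "column_mat n u", OF U] in auto)
  then show ?thesis unfolding para_unitary_def
    using hol mat_mult_left_right_inverse[OF para_conj_carrier[where A = "column_mat n u", OF U] U] by blast
qed

lemma orthonormal_completeness:
  assumes u: "orthonormal n n u" and z: "z \<in> S1" and ij: "i < n" "j < n"
  shows "(\<Sum>k<n. u k i z * cnj (u k j z)) = (if i = j then 1 else 0)"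
proof -
  have U: "column_mat n u z \<in> carrier_mat n n" for z by (simp add: column_mat_def)
  have "column_mat n u z * para_conj (column_mat n u) z = 1\<^sub>m n"
    using column_mat_para_unitary[OF u] z by (simp add: para_unitary_def)
  then have "(column_mat n u z * para_conj (column_mat n u) z) $$ (i, j) = (if i = j then 1 else 0)"
    using ij by simp
  also have "(column_mat n u z * para_conj (column_mat n u) z) $$ (i, j)
       = (\<Sum>k<n. column_mat n u z $$ (i, k) * para_conj (column_mat n u) z $$ (k, j))"
    by (rule mat_mult_index_sum[OF U para_conj_carrier[where A = "column_mat n u", OF U] ij])
  also have "\<dots> = (\<Sum>k<n. u k i z * cnj (u k j z))"
    using ij by (intro sum.cong refl) (simp add: para_conj_index[where A = "column_mat n u", OF U z] column_mat_def)
  finally show ?thesis .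
qed

lemma orthonormal_expansion:
  assumes u: "orthonormal n n u" and z: "z \<in> S1" and i: "i < n"
  shows "x i = (\<Sum>k<n. (\<Sum>j<n. cnj (u k j z) * x j) * u k i z)"
proof -
  have "(\<Sum>k<n. (\<Sum>j<n. cnj (u k j z) * x j) * u k i z) = (\<Sum>k<n. \<Sum>j<n. x j * (u k i z * cnj (u k j z)))"
    by (simp only: sum_distrib_left sum_distrib_right mult_ac)
  also have "\<dots> = (\<Sum>j<n. \<Sum>k<n. x j * (u k i z * cnj (u k j z)))" by (rule sum.swap)
  also have "\<dots> = (\<Sum>j<n. x j * (if i = j then 1 else 0))"
    using orthonormal_completeness[OF u z i]
    by (intro sum.cong refl) (simp only: sum_distrib_left[symmetric] lessThan_iff)
  also have "\<dots> = x i" using i by (simp add: if_distrib[of "\<lambda>y. _ * y"] cong: if_cong)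
  finally show ?thesis by simp
qed

text \<open>
Change of basis at a single point, where \<open>B\<close> is the matrix of \<open>A\<close> in the basis \<open>u\<close>.
\<close>
lemma conjugate_by_column_mat:
  assumes A: "hermitian_on_circle n A" and u: "orthonormal n n u" and z: "z \<in> S1"
    and B: "B \<in> carrier_mat n n"
    and AB: "\<And>i k. i < n \<Longrightarrow> k < n \<Longrightarrow> (\<Sum>j<n. A z $$ (i, j) * u k j z) = (\<Sum>l<n. B $$ (l, k) * u l i z)"
  shows "A z = column_mat n u z * B * para_conj (column_mat n u) z"
proof -
  note AD = hermitian_on_circleD[OF A]
  let ?U = "column_mat n u z" and ?V = "para_conj (column_mat n u) z"
  have pu: "para_unitary n (column_mat n u)" by (rule column_mat_para_unitary[OF u])
  have U: "?U \<in> carrier_mat n n" by (simp add: column_mat_def)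
  have V: "?V \<in> carrier_mat n n"
    using pu hol_circle_matD(1)[OF hol_circle_mat_para_conj] unfolding para_unitary_def by blast
  have AU: "A z * ?U = ?U * B"
  proof (rule eq_matI)
    fix i j assume "i < dim_row (?U * B)" "j < dim_col (?U * B)"
    then have ij: "i < n" "j < n" using U B by auto
    have "(A z * ?U) $$ (i, j) = (\<Sum>q<n. A z $$ (i, q) * u j q z)"
      unfolding mat_mult_index_sum[OF AD(1) U ij] using ij by (intro sum.cong refl) (simp add: column_mat_def)
    moreover have "(?U * B) $$ (i, j) = (\<Sum>l<n. B $$ (l, j) * u l i z)"
      unfolding mat_mult_index_sum[OF U B ij] using ij by (intro sum.cong refl) (simp add: column_mat_def)
    ultimately show "(A z * ?U) $$ (i, j) = (?U * B) $$ (i, j)" using AB[OF ij] by simp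
  qed (use AD(1)[of z] U B in auto)
  have "A z = A z * (?U * ?V)" using AD(1)[of z] pu z by (simp add: para_unitary_def)
  also have "\<dots> = A z * ?U * ?V" by (rule assoc_mult_mat[OF AD(1) U V, symmetric])
  finally show ?thesis by (simp only: AU)
qed

text \<open>
A multiple eigenvalue of a Hermitian matrix has two independent eigenvectors, and some combination of
them has first entry 0. The second eigenvector comes from deflation: in an orthonormal basis that starts
with a unit eigenvector the characteristic polynomial splits off one linear factor, and the eigenvalue is
still a root of what is left.
\<close>
lemma hermitian_multiple_eigenvalue:
  assumes A: "hermitian_on_circle n A" and n: "n > 0" and z: "z \<in> S1"
    and nsq: "\<not> rsquarefree (char_poly (A z))"
  obtains y a where "\<exists>j<n. y j \<noteq> 0" "y 0 = 0" "\<And>i. i < n \<Longrightarrow> (\<Sum>j<n. A z $$ (i, j) * y j) = a * y i"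
proof -
  note AD = hermitian_on_circleD[OF A]
  let ?H = "\<lambda>i j. A z $$ (i, j)"
  obtain a where a: "poly (char_poly (A z)) a = 0" "poly (pderiv (char_poly (A z))) a = 0"
    using nsq by (auto simp: rsquarefree_roots)
  obtain x where x0: "(\<exists>j<n. x j \<noteq> 0) \<and> (\<forall>i<n. (\<Sum>j<n. ?H i j * x j) = a * x i)"
    using a(1) unfolding char_poly_root_iff[OF AD(1)] ..
  then obtain j0 where j0: "j0 < n" "x j0 \<noteq> 0" by blast
  have ax: "(\<Sum>j<n. ?H i j * x j) = a * x i" if "i < n" for i using x0 that by blast
  define s where "s = sqrt (\<Sum>j<n. (cmod (x j))\<^sup>2)"
  have "(\<Sum>j<n. (cmod (x j))\<^sup>2) > 0"
    by (rule sum_pos2[of _ j0]) (use j0 in auto)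
  then have s: "s > 0" "s * s = (\<Sum>j<n. (cmod (x j))\<^sup>2)" by (auto simp: s_def)
  define v where "v j = x j / of_real s" for j
  have v1: "(\<Sum>j<n. cnj (v j) * v j) = 1"
  proof -
    have "(\<Sum>j<n. cnj (v j) * v j) = (\<Sum>j<n. cnj (x j) * x j) / of_real (s * s)"
      by (simp add: v_def sum_divide_distrib)
    also have "(\<Sum>j<n. cnj (x j) * x j) = of_real (s * s)"
      unfolding s(2) by (simp add: complex_norm_square[unfolded of_real_power] mult.commute)
    finally show ?thesis using s(1) by simp
  qed
  have av: "(\<Sum>j<n. ?H i j * v j) = a * v i" if "i < n" for i
    using ax[OF that] by (simp add: v_def sum_divide_distrib[symmetric])
  have "orthonormal n 1 (\<lambda>_ j _. v j)"
    unfolding orthonormal_def using v1 by simp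
  from orthonormal_complete[OF this] obtain u where
    u0: "orthonormal n n u \<and> (\<forall>k<1. u k = (\<lambda>j _. v j))" ..
  then have u: "orthonormal n n u" and uv: "u 0 = (\<lambda>j _. v j)" by auto
  define B where "B i k = (\<Sum>p<n. cnj (u i p z) * (\<Sum>q<n. ?H p q * u k q z))" for i k
  have Bherm: "B i k = cnj (B k i)" for i k
  proof -
    have "cnj (B k i) = (\<Sum>p<n. cnj (\<Sum>q<n. ?H p q * u i q z) * u k p z)"
      unfolding B_def by (simp add: mult.commute)
    also have "\<dots> = B i k" unfolding B_def
      by (rule hermitian_form_swap) (rule AD(3)[OF z])
    finally show ?thesis by simp
  qed
  have B0: "B i 0 = (if i = 0 then a else 0)" if "i < n" for i
  proof -
    have "B i 0 = (\<Sum>p<n. cnj (u i p z) * (a * u 0 p z))"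
      unfolding B_def uv by (intro sum.cong refl) (simp add: av)
    also have "\<dots> = a * (\<Sum>p<n. cnj (u i p z) * u 0 p z)" by (simp only: sum_distrib_left mult_ac)
    finally show ?thesis using orthonormalD(2)[OF u z that n] by simp
  qed
  have Hu: "(\<Sum>q<n. ?H i q * u k q z) = (\<Sum>l<n. B l k * u l i z)" if "i < n" for i k
    using orthonormal_expansion[OF u z that, of "\<lambda>i. \<Sum>q<n. ?H i q * u k q z"] unfolding B_def .
  let ?U = "column_mat n u z" and ?V = "para_conj (column_mat n u) z"
  have U: "column_mat n u z \<in> carrier_mat n n" for z by (simp add: column_mat_def)
  note V = para_conj_carrier[where A = "column_mat n u", OF U, of z]
  have UV: "?U * ?V = 1\<^sub>m n" "?V * ?U = 1\<^sub>m n"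
    using column_mat_para_unitary[OF u] z by (auto simp: para_unitary_def)
  define M where "M = mat n n (\<lambda>(i, k). B i k)"
  have M: "M \<in> carrier_mat n n" by (simp add: M_def)
  have "A z = ?U * M * ?V"
    by (rule conjugate_by_column_mat[OF A u z M]) (simp add: M_def Hu)
  then have "similar_mat (A z) M"
    by (intro similar_matI[OF _ UV]) (use AD(1)[of z] U[of z] V M in auto)
  then have cp: "char_poly (A z) = char_poly M" by (rule char_poly_similar)
  define A1 A2 A3 where "A1 = mat 1 1 (\<lambda>_. a)" and "A2 = mat 1 (n - 1) (\<lambda>(i, k). B 0 (Suc k))"
    and "A3 = mat (n - 1) (n - 1) (\<lambda>(i, k). B (Suc i) (Suc k))"
  have Mblock: "M = four_block_mat A1 A2 (0\<^sub>m (n - 1) 1) A3"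
    by (rule eq_matI) (use n B0 in \<open>auto simp: M_def A1_def A2_def A3_def\<close>)
  have A3: "A3 \<in> carrier_mat (n - 1) (n - 1)" by (simp add: A3_def)
  have "char_poly M = char_poly A1 * char_poly A3"
    unfolding Mblock by (rule char_poly_four_block_zeros_col) (auto simp: A1_def A2_def A3_def)
  moreover have "char_poly A1 = [:- a, 1:]"
  proof -
    have "upper_triangular A1" by (auto simp: A1_def upper_triangular_def)
    then show ?thesis using char_poly_upper_triangular[of A1 1] by (simp add: A1_def diag_mat_def)
  qed
  ultimately have cp2: "char_poly (A z) = [:- a, 1:] * char_poly A3" by (simp add: cp)
  have "poly (char_poly A3) a = 0"
    using a(2) unfolding cp2 pderiv_mult by (simp add: pderiv_pCons)
  then obtain y2 where y20: "(\<exists>j<n - 1. y2 j \<noteq> 0) \<and> (\<forall>i<n - 1. (\<Sum>j<n - 1. A3 $$ (i, j) * y2 j) = a * y2 i)"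
    unfolding char_poly_root_iff[OF A3] ..
  \<comment> \<open>coordinates of the second eigenvector \<open>y\<close>: it is orthogonal to \<open>v\<close> and given by \<open>y2\<close> elsewhere\<close>
  define c where "c l = (case l of 0 \<Rightarrow> 0 | Suc l' \<Rightarrow> y2 l')" for l
  define y where "y i = (\<Sum>l<n. c l * u l i z)" for i
  have sum_c: "(\<Sum>l<n. h l * c l) = (\<Sum>l<n - 1. h (Suc l) * y2 l)" for h :: "nat \<Rightarrow> complex"
  proof -
    have "{..<n} = {..<Suc (n - 1)}" using n by simp
    then show ?thesis by (simp only: sum.lessThan_Suc_shift) (simp add: c_def)
  qed
  have Bc: "(\<Sum>k<n. B l k * c k) = a * c l" if l: "l < n" for l
  proof (cases l)
    case 0
    have "B 0 (Suc k) = 0" if "k < n - 1" for k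
      using B0[of "Suc k"] Bherm[of 0 "Suc k"] that by simp
    then show ?thesis unfolding sum_c 0 by (simp add: c_def)
  next
    case (Suc l')
    then have l': "l' < n - 1" using l by simp
    have "(\<Sum>j<n - 1. A3 $$ (l', j) * y2 j) = a * y2 l'" using y20 l' by blast
    moreover have "(\<Sum>j<n - 1. A3 $$ (l', j) * y2 j) = (\<Sum>j<n - 1. B (Suc l') (Suc j) * y2 j)"
      using l' by (intro sum.cong refl) (simp add: A3_def)
    ultimately show ?thesis unfolding sum_c Suc by (simp add: c_def)
  qed
  have ay: "(\<Sum>j<n. ?H i j * y j) = a * y i" if i: "i < n" for i
  proof -
    have "(\<Sum>j<n. ?H i j * y j) = (\<Sum>j<n. \<Sum>k<n. c k * (?H i j * u k j z))"
      by (simp only: y_def sum_distrib_left mult_ac)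
    also have "\<dots> = (\<Sum>k<n. \<Sum>j<n. c k * (?H i j * u k j z))" by (rule sum.swap)
    also have "\<dots> = (\<Sum>k<n. c k * (\<Sum>l<n. B l k * u l i z))"
      by (simp only: sum_distrib_left[symmetric] Hu[OF i])
    also have "\<dots> = (\<Sum>k<n. \<Sum>l<n. u l i z * (B l k * c k))"
      by (simp only: sum_distrib_left mult_ac)
    also have "\<dots> = (\<Sum>l<n. \<Sum>k<n. u l i z * (B l k * c k))" by (rule sum.swap)
    also have "\<dots> = (\<Sum>l<n. u l i z * (a * c l))"
      by (intro sum.cong refl) (simp only: sum_distrib_left[symmetric] Bc lessThan_iff)
    also have "\<dots> = a * y i" by (simp only: y_def sum_distrib_left mult_ac)
    finally show ?thesis .
  qed
  have coord: "(\<Sum>j<n. cnj (u l j z) * y j) = c l" if "l < n" for l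
    unfolding y_def using orthonormal_coefficient[OF u z that order_refl, of c] that by simp
  obtain l0 where l0: "l0 < n - 1" "y2 l0 \<noteq> 0" using y20 by blast
  then have cl0: "Suc l0 < n" "c (Suc l0) \<noteq> 0" by (auto simp: c_def)
  show ?thesis
  proof (cases "y 0 = 0")
    case True
    have "\<exists>j<n. y j \<noteq> 0"
    proof (rule ccontr)
      assume "\<not> (\<exists>j<n. y j \<noteq> 0)"
      then have "(\<Sum>j<n. cnj (u (Suc l0) j z) * y j) = 0" by (intro sum.neutral) auto
      then show False using coord[OF cl0(1)] cl0(2) by simp
    qed
    then show ?thesis using that[of y a] True ay by blast
  next
    case False
    define y' where "y' j = v j - v 0 / y 0 * y j" for j
    have "\<exists>j<n. y' j \<noteq> 0"
    proof (rule ccontr)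
      assume "\<not> (\<exists>j<n. y' j \<noteq> 0)"
      then have "(\<Sum>j<n. cnj (u 0 j z) * y' j) = 0" by (intro sum.neutral) auto
      moreover have "(\<Sum>j<n. cnj (u 0 j z) * y' j) =
          (\<Sum>j<n. cnj (v j) * v j) - v 0 / y 0 * (\<Sum>j<n. cnj (u 0 j z) * y j)"
        unfolding y'_def uv by (simp only: right_diff_distrib sum_subtractf sum_distrib_left mult_ac)
      ultimately show False using v1 coord[OF n] by (simp add: c_def)
    qed
    moreover have "y' 0 = 0" using False by (simp add: y'_def)
    moreover have "(\<Sum>j<n. ?H i j * y' j) = a * y' i" if "i < n" for i
    proof -
      have "(\<Sum>j<n. ?H i j * y' j) = (\<Sum>j<n. ?H i j * v j) - v 0 / y 0 * (\<Sum>j<n. ?H i j * y j)"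
        unfolding y'_def by (simp only: right_diff_distrib sum_subtractf sum_distrib_left mult_ac)
      then show ?thesis by (simp add: av[OF that] ay[OF that] y'_def right_diff_distrib)
    qed
    ultimately show ?thesis using that[of y' a] by blast
  qed
qed

section \<open>Reduction to the irreducible case\<close>

text \<open>
The coefficients \<open>c\<close> may depend on the point in any way; that they are analytic follows from
orthonormality.
\<close>
definition reducible_on_circle :: "nat \<Rightarrow> (complex \<Rightarrow> complex mat) \<Rightarrow> bool" where
  "reducible_on_circle n A \<longleftrightarrow> (\<exists>m u. 0 < m \<and> m < n \<and> orthonormal n m u \<and>
     (\<forall>z\<in>S1. \<forall>k<m. \<exists>c. \<forall>i<n. (\<Sum>j<n. A z $$ (i, j) * u k j z) = (\<Sum>l<m. c l * u l i z)))"

text \<open>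
The \<open>k\<close>-th row is the first row of the \<open>k\<close>-th power of \<open>A\<close>. For a Hermitian matrix it is the conjugate
of the image of the first basis vector under this power, so the common kernel of all rows is the
orthogonal complement of the cyclic subspace that this vector generates.
\<close>
fun krylov_row :: "nat \<Rightarrow> (complex \<Rightarrow> complex mat) \<Rightarrow> nat \<Rightarrow> nat \<Rightarrow> complex \<Rightarrow> complex" where
  "krylov_row n A 0 j z = (if j = 0 then 1 else 0)"
| "krylov_row n A (Suc k) j z = (\<Sum>i<n. krylov_row n A k i z * A z $$ (i, j))"

lemma krylov_row_hol:
  assumes A: "hermitian_on_circle n A" and "j < n"
  shows "krylov_row n A k j \<in> hol_circle"
  using assms(2)
proof (induction k arbitrary: j)
  case 0
  have "krylov_row n A 0 j = (\<lambda>_. if j = 0 then 1 else 0)" by (rule ext) simp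
  then show ?case by (simp only: hol_circle_const)
next
  case (Suc k)
  have "krylov_row n A (Suc k) j = (\<lambda>z. \<Sum>i<n. krylov_row n A k i z * A z $$ (i, j))" by (rule ext) simp
  moreover have "(\<lambda>z. \<Sum>i<n. krylov_row n A k i z * A z $$ (i, j)) \<in> hol_circle"
    using Suc hermitian_on_circleD(2)[OF A]
    by (intro hol_circle_sum hol_circle_mult) auto
  ultimately show ?case by (simp only:)
qed

lemma krylov_row_Suc_apply:
  "(\<Sum>j<n. krylov_row n A (Suc k) j z * y j) = (\<Sum>i<n. krylov_row n A k i z * (\<Sum>j<n. A z $$ (i, j) * y j))"
proof -
  have "(\<Sum>j<n. krylov_row n A (Suc k) j z * y j) = (\<Sum>j<n. \<Sum>i<n. krylov_row n A k i z * (A z $$ (i, j) * y j))"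
    by (simp add: sum_distrib_right mult.assoc)
  also have "\<dots> = (\<Sum>i<n. \<Sum>j<n. krylov_row n A k i z * (A z $$ (i, j) * y j))" by (rule sum.swap)
  finally show ?thesis by (simp only: sum_distrib_left)
qed

lemma krylov_row_eigenvector:
  assumes "\<And>i. i < n \<Longrightarrow> (\<Sum>j<n. A z $$ (i, j) * y j) = a * y i" "y 0 = 0"
  shows "(\<Sum>j<n. krylov_row n A k j z * y j) = 0"
proof (induction k)
  case 0
  show ?case using assms(2) by (intro sum.neutral) auto
next
  case (Suc k)
  have "(\<Sum>j<n. krylov_row n A (Suc k) j z * y j) = (\<Sum>i<n. krylov_row n A k i z * (a * y i))"
    unfolding krylov_row_Suc_apply by (intro sum.cong refl) (simp add: assms(1))
  also have "\<dots> = a * (\<Sum>i<n. krylov_row n A k i z * y i)"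
    by (simp only: sum_distrib_left mult.left_commute)
  finally show ?case using Suc by simp
qed

text \<open>
The common kernel of the rows is invariant under \<open>A\<close>, and it is proper because all its vectors have first
entry 0. A maximal orthonormal family inside it spans it over the ring: otherwise the component of some
\<open>A u\<close> orthogonal to the family would, after normalisation, extend the family.
\<close>
lemma reducible_if_krylov_degenerate:
  assumes A: "hermitian_on_circle n A" and n: "n > 0"
    and deg: "\<And>z. z \<in> S1 \<Longrightarrow> \<exists>y. (\<exists>j<n. y j \<noteq> 0) \<and> (\<forall>k. (\<Sum>j<n. krylov_row n A k j z * y j) = 0)"
  shows "reducible_on_circle n A"
proof -
  note AD = hermitian_on_circleD[OF A]
  let ?r = "krylov_row n A"
  define Q where "Q m \<longleftrightarrow> (\<exists>u. orthonormal n m u \<and>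
     (\<forall>z\<in>S1. \<forall>l<m. \<forall>k. (\<Sum>j<n. ?r k j z * u l j z) = 0))" for m
  have "Q 1"
  proof (rule unit_kernel_vector[where J = "{..<n}" and I = UNIV and a = ?r])
    fix v
    assume v: "\<And>j. j \<in> {..<n} \<Longrightarrow> v j \<in> hol_circle"
      "\<And>z. z \<in> S1 \<Longrightarrow> (\<Sum>j<n. cnj (v j z) * v j z) = 1"
      "\<And>i z. i \<in> UNIV \<Longrightarrow> z \<in> S1 \<Longrightarrow> (\<Sum>j<n. ?r i j z * v j z) = 0"
    show "Q 1" unfolding Q_def orthonormal_def
      by (rule exI[of _ "\<lambda>_. v"]) (use v in auto)
  qed (use krylov_row_hol[OF A] deg in \<open>auto simp: Bex_def\<close>)
  have bound: "\<forall>m. Q m \<longrightarrow> m \<le> n" unfolding Q_def using orthonormal_bound by blast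
  define m where "m = (GREATEST m. Q m)"
  have Qm: "Q m" unfolding m_def by (rule GreatestI_nat[of Q 1 n]) (use \<open>Q 1\<close> bound in auto)
  have not_QS: "\<not> Q (Suc m)"
    using Greatest_le_nat[of Q "Suc m" n] bound unfolding m_def[symmetric] by auto
  have m1: "1 \<le> m" unfolding m_def by (rule Greatest_le_nat[of Q 1 n]) (use \<open>Q 1\<close> bound in auto)
  obtain u where u0: "orthonormal n m u \<and>
     (\<forall>z\<in>S1. \<forall>l<m. \<forall>k. (\<Sum>j<n. ?r k j z * u l j z) = 0)" using Qm unfolding Q_def ..
  then have u: "orthonormal n m u"
    and ru: "\<And>z l k. z \<in> S1 \<Longrightarrow> l < m \<Longrightarrow> (\<Sum>j<n. ?r k j z * u l j z) = 0" by auto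
  have "m \<noteq> n"
  proof
    assume mn: "m = n"
    have "u l 0 1 = 0" if l: "l < n" for l
    proof -
      have "(\<Sum>j<n. ?r 0 j 1 * u l j 1) = (\<Sum>j<n. if j = 0 then u l j 1 else 0)"
        by (intro sum.cong) auto
      then show ?thesis using ru[of 1 l 0] l mn n by simp
    qed
    then have "(\<Sum>k<n. u k 0 1 * cnj (u k 0 1)) = 0" by (intro sum.neutral) auto
    then show False using orthonormal_completeness[of n u 1 0 0] u mn n by simp
  qed
  then have mn: "m < n" using bound Qm by (simp add: order_less_le)
  define c where "c k l z = (\<Sum>p<n. cnj (u l p (inverse (cnj z))) * (\<Sum>j<n. A z $$ (p, j) * u k j z))" for k l z
  \<comment> \<open>the component of \<open>A (u k)\<close> orthogonal to the family\<close>
  define x where "x k i z = (\<Sum>j<n. A z $$ (i, j) * u k j z) - (\<Sum>l<m. c k l z * u l i z)" for k i z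
  have ceq: "c k l z = (\<Sum>p<n. cnj (u l p z) * (\<Sum>j<n. A z $$ (p, j) * u k j z))" if "z \<in> S1" for k l z
    unfolding c_def inverse_cnj_S1[OF that] ..
  have x0: "x k i z0 = 0" if k: "k < m" and i: "i < n" and z0: "z0 \<in> S1" for k i z0
  proof (rule ccontr)
    assume nz: "x k i z0 \<noteq> 0"
    have ch: "c k l \<in> hol_circle" if "l < m" for l
      unfolding c_def using that k
      by (intro hol_circle_sum hol_circle_mult hol_circle_cnj[of "u l _"] orthonormalD(1)[OF u] AD(2)) auto
    have xh: "x k j \<in> hol_circle" if "j \<in> {..<n}" for j
      unfolding x_def using that k
      by (intro hol_circle_diff hol_circle_sum hol_circle_mult orthonormalD(1)[OF u] AD(2) ch) auto
    have rx: "(\<Sum>j<n. ?r k' j z * x k j z) = 0" if z: "z \<in> S1" for k' z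
    proof -
      have "(\<Sum>j<n. ?r k' j z * x k j z) = (\<Sum>j<n. ?r (Suc k') j z * u k j z)
          - (\<Sum>j<n. \<Sum>l<m. c k l z * (?r k' j z * u l j z))"
        unfolding x_def krylov_row_Suc_apply
        by (simp only: right_diff_distrib sum_subtractf sum_distrib_left mult_ac)
      also have "(\<Sum>j<n. \<Sum>l<m. c k l z * (?r k' j z * u l j z)) = (\<Sum>l<m. \<Sum>j<n. c k l z * (?r k' j z * u l j z))"
        by (rule sum.swap)
      also have "\<dots> = (\<Sum>l<m. c k l z * (\<Sum>j<n. ?r k' j z * u l j z))" by (simp only: sum_distrib_left)
      also have "\<dots> = 0" using ru[OF z] by (intro sum.neutral) auto
      finally show ?thesis using ru[OF z k, of "Suc k'"] by (simp only: diff_zero)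
    qed
    have ux: "(\<Sum>j<n. cnj (u l j z) * x k j z) = 0" if z: "z \<in> S1" and l: "l < m" for l z
    proof -
      have "(\<Sum>j<n. cnj (u l j z) * x k j z) =
          c k l z - (\<Sum>j<n. cnj (u l j z) * (\<Sum>l'<m. c k l' z * u l' j z))"
        unfolding x_def ceq[OF z, of k l] by (simp only: right_diff_distrib sum_subtractf)
      then show ?thesis
        using orthonormal_coefficient[OF u z l order_refl, of "\<lambda>l. c k l z"] l by simp
    qed
    have iJ: "i \<in> {..<n}" using i by simp
    have False
    proof (rule normalize_vector[where x = "x k", OF finite_lessThan xh iJ z0 nz])
      fix f w
      assume f: "f \<in> hol_circle" "f z0 \<noteq> 0" and w: "\<And>j. j \<in> {..<n} \<Longrightarrow> w j \<in> hol_circle"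
        "\<And>j z. j \<in> {..<n} \<Longrightarrow> z \<in> S1 \<Longrightarrow> x k j z = f z * w j z"
        "\<And>z. z \<in> S1 \<Longrightarrow> (\<Sum>j<n. cnj (w j z) * w j z) = 1"
      have fw: "f z * (\<Sum>j<n. h j * w j z) = (\<Sum>j<n. h j * x k j z)" if "z \<in> S1" for h z
        unfolding sum_distrib_left by (intro sum.cong refl) (simp add: w(2)[OF _ that])
      have rw: "(\<Sum>j<n. ?r k' j z * w j z) = 0" if z: "z \<in> S1" for k' z
      proof (rule hol_circle_cancel[where g = "\<lambda>z. \<Sum>j<n. ?r k' j z * w j z", OF f(1) _ z0 f(2) _ z])
        show "(\<lambda>z. \<Sum>j<n. ?r k' j z * w j z) \<in> hol_circle"
          by (intro hol_circle_sum hol_circle_mult krylov_row_hol[OF A] w(1)) auto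
        show "f z * (\<Sum>j<n. ?r k' j z * w j z) = 0" if "z \<in> S1" for z
          unfolding fw[OF that] using rx[OF that] .
      qed
      have uw: "(\<Sum>j<n. cnj (u l j z) * w j z) = 0" if l: "l < m" and z: "z \<in> S1" for l z
      proof -
        have "(\<Sum>j<n. cnj (u l j (inverse (cnj z))) * w j z) = 0"
        proof (rule hol_circle_cancel[where g = "\<lambda>z. \<Sum>j<n. cnj (u l j (inverse (cnj z))) * w j z", OF f(1) _ z0 f(2) _ z])
          show "(\<lambda>z. \<Sum>j<n. cnj (u l j (inverse (cnj z))) * w j z) \<in> hol_circle"
            using l by (intro hol_circle_sum hol_circle_mult hol_circle_cnj[of "u l _"] orthonormalD(1)[OF u] w(1)) auto
          show "f z * (\<Sum>j<n. cnj (u l j (inverse (cnj z))) * w j z) = 0" if "z \<in> S1" for z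
            unfolding fw[OF that] inverse_cnj_S1[OF that] using ux[OF that l] .
        qed
        then show ?thesis unfolding inverse_cnj_S1[OF z] .
      qed
      have "orthonormal n (Suc m) (u(m := w))"
        by (rule orthonormal_snoc[OF u _ w(3) uw]) (simp_all add: w(1))
      moreover have "(\<Sum>j<n. ?r k' j z * (u(m := w)) l j z) = 0" if "z \<in> S1" "l < Suc m" for z l k'
        using rw[OF that(1)] ru[OF that(1), of l] that(2) by (cases "l = m") auto
      ultimately have "Q (Suc m)" unfolding Q_def by (intro exI[of _ "u(m := w)"]) blast
      with not_QS show False ..
    qed
    then show False .
  qed
  show ?thesis
    unfolding reducible_on_circle_def
  proof (intro exI[of _ m] exI[of _ u] conjI ballI allI impI)
    fix z k assume z: "z \<in> S1" and k: "k < m"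
    show "\<exists>c. \<forall>i<n. (\<Sum>j<n. A z $$ (i, j) * u k j z) = (\<Sum>l<m. c l * u l i z)"
    proof (intro exI[of _ "\<lambda>l. c k l z"] allI impI)
      fix i assume i: "i < n"
      show "(\<Sum>j<n. A z $$ (i, j) * u k j z) = (\<Sum>l<m. c k l z * u l i z)"
        using x0[OF k i z] unfolding x_def by simp
    qed
  qed (use m1 mn u in auto)
qed

text \<open>
An eigenvector with first entry 0 is annihilated by all rows, as these are the first rows of the powers of
\<open>A\<close>.
\<close>
lemma irreducible_imp_simple_spectrum:
  assumes A: "hermitian_on_circle n A" and n: "n > 0" and irr: "\<not> reducible_on_circle n A"
  obtains z0 where "z0 \<in> S1" "rsquarefree (char_poly (A z0))"
proof -
  have "\<exists>z0\<in>S1. rsquarefree (char_poly (A z0))"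
  proof (rule ccontr)
    assume *: "\<not> ?thesis"
    have "reducible_on_circle n A"
    proof (rule reducible_if_krylov_degenerate[OF A n])
      fix z assume z: "z \<in> S1"
      with * have nsq: "\<not> rsquarefree (char_poly (A z))" by blast
      show "\<exists>y. (\<exists>j<n. y j \<noteq> 0) \<and> (\<forall>k. (\<Sum>j<n. krylov_row n A k j z * y j) = 0)"
      proof (rule hermitian_multiple_eigenvalue[OF A n z nsq])
        fix y a
        assume y: "\<exists>j<n. y j \<noteq> 0" "y 0 = 0"
          "\<And>i. i < n \<Longrightarrow> (\<Sum>j<n. A z $$ (i, j) * y j) = a * y i"
        show ?thesis
        proof (intro exI[of _ y] conjI allI y(1))
          show "(\<Sum>j<n. krylov_row n A k j z * y j) = 0" for k
            using y(3,2) by (rule krylov_row_eigenvector)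
        qed
      qed
    qed
    with irr show False ..
  qed
  then show ?thesis using that by blast
qed

lemma hol_circle_mat_four_block:
  assumes "A \<in> hol_circle_mat m m" "B \<in> hol_circle_mat p p"
  shows "(\<lambda>z. four_block_mat (A z) (0\<^sub>m m p) (0\<^sub>m p m) (B z)) \<in> hol_circle_mat (m + p) (m + p)"
proof (rule hol_circle_matI)
  note A = hol_circle_matD[OF assms(1)] and B = hol_circle_matD[OF assms(2)]
  show "four_block_mat (A z) (0\<^sub>m m p) (0\<^sub>m p m) (B z) \<in> carrier_mat (m + p) (m + p)" for z
    using A(1)[of z] B(1)[of z] by simp
  fix i j assume ij: "i < m + p" "j < m + p"
  have d: "dim_row (A z) = m" "dim_col (A z) = m" "dim_row (B z) = p" "dim_col (B z) = p" for z
    using A(1)[of z] B(1)[of z] by auto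
  have "(\<lambda>z. four_block_mat (A z) (0\<^sub>m m p) (0\<^sub>m p m) (B z) $$ (i, j)) =
    (if i < m then if j < m then (\<lambda>z. A z $$ (i, j)) else (\<lambda>_. 0)
     else if j < m then (\<lambda>_. 0) else (\<lambda>z. B z $$ (i - m, j - m)))"
    using ij by (auto simp: fun_eq_iff d)
  then show "(\<lambda>z. four_block_mat (A z) (0\<^sub>m m p) (0\<^sub>m p m) (B z) $$ (i, j)) \<in> hol_circle"
    using A(2)[of i j] B(2)[of "i - m" "j - m"] ij by auto
qed

lemma four_block_diag_mult:
  assumes "A \<in> carrier_mat m m" "B \<in> carrier_mat p p" "A' \<in> carrier_mat m m" "B' \<in> carrier_mat p p"
  shows "four_block_mat A (0\<^sub>m m p) (0\<^sub>m p m) B * four_block_mat A' (0\<^sub>m m p) (0\<^sub>m p m) B' =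
    four_block_mat (A * A') (0\<^sub>m m p) (0\<^sub>m p m) (B * B' :: complex mat)"
proof -
  have "four_block_mat A (0\<^sub>m m p) (0\<^sub>m p m) B * four_block_mat A' (0\<^sub>m m p) (0\<^sub>m p m) B' =
     four_block_mat (A * A' + 0\<^sub>m m p * 0\<^sub>m p m) (A * 0\<^sub>m m p + 0\<^sub>m m p * B')
       (0\<^sub>m p m * A' + B * 0\<^sub>m p m) (0\<^sub>m p m * 0\<^sub>m m p + B * B')"
    by (rule mult_four_block_mat) (use assms in auto)
  also have "\<dots> = four_block_mat (A * A') (0\<^sub>m m p) (0\<^sub>m p m) (B * B')"
    by (intro cong_four_block_mat) (use assms in auto)
  finally show ?thesis .
qed

lemma para_conj_four_block:
  assumes "A \<in> hol_circle_mat m m" "B \<in> hol_circle_mat p p"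
  shows "para_conj (\<lambda>z. four_block_mat (A z) (0\<^sub>m m p) (0\<^sub>m p m) (B z)) z =
    four_block_mat (para_conj A z) (0\<^sub>m m p) (0\<^sub>m p m) (para_conj B z)"
proof -
  let ?w = "inverse (cnj z)"
  have "A ?w \<in> carrier_mat m m" "B ?w \<in> carrier_mat p p"
    using hol_circle_matD(1)[OF assms(1)] hol_circle_matD(1)[OF assms(2)] by auto
  then show ?thesis unfolding para_conj_def
    by (intro eq_matI) auto
qed

lemma para_unitary_four_block:
  assumes "para_unitary m U" "para_unitary p V"
  shows "para_unitary (m + p) (\<lambda>z. four_block_mat (U z) (0\<^sub>m m p) (0\<^sub>m p m) (V z))"
proof -
  have U: "U \<in> hol_circle_mat m m" and V: "V \<in> hol_circle_mat p p"
    using assms by (auto simp: para_unitary_def)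
  note c = hol_circle_matD(1)[OF U] hol_circle_matD(1)[OF V]
    hol_circle_matD(1)[OF hol_circle_mat_para_conj[OF U]] hol_circle_matD(1)[OF hol_circle_mat_para_conj[OF V]]
  show ?thesis
    unfolding para_unitary_def para_conj_four_block[OF U V]
    using assms hol_circle_mat_four_block[OF U V]
    by (simp add: para_unitary_def four_block_diag_mult[OF c(1,2,3,4)] four_block_diag_mult[OF c(3,4,1,2)])
qed

lemma mult_mat_regroup:
  fixes a :: "complex mat"
  assumes "a \<in> carrier_mat n n" "b \<in> carrier_mat n n" "c \<in> carrier_mat n n" "d \<in> carrier_mat n n"
  shows "(a * b) * (c * d) = a * ((b * c) * d)"
proof -
  have "(a * b) * (c * d) = a * (b * (c * d))"
    by (rule assoc_mult_mat[OF assms(1,2) mult_carrier_mat[OF assms(3,4)]])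
  also have "b * (c * d) = (b * c) * d" by (rule assoc_mult_mat[OF assms(2,3,4), symmetric])
  finally show ?thesis .
qed

lemma para_unitary_mult:
  assumes "para_unitary n U" "para_unitary n V"
  shows "para_unitary n (\<lambda>z. U z * V z)"
proof -
  have U: "U \<in> hol_circle_mat n n" and V: "V \<in> hol_circle_mat n n"
    using assms by (auto simp: para_unitary_def)
  have c: "U z \<in> carrier_mat n n" "V z \<in> carrier_mat n n" "para_conj U z \<in> carrier_mat n n" "para_conj V z \<in> carrier_mat n n" for z
    using hol_circle_matD(1) U V hol_circle_mat_para_conj by blast+
  have u: "U z * para_conj U z = 1\<^sub>m n" "para_conj U z * U z = 1\<^sub>m n"
      "V z * para_conj V z = 1\<^sub>m n" "para_conj V z * V z = 1\<^sub>m n" if "z \<in> S1" for z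
    using assms that unfolding para_unitary_def by simp_all
  have "(U z * V z) * (para_conj V z * para_conj U z) = 1\<^sub>m n" if z: "z \<in> S1" for z
    unfolding mult_mat_regroup[OF c(1,2,4,3)] u[OF z] left_mult_one_mat[OF c(3)] ..
  moreover have "(para_conj V z * para_conj U z) * (U z * V z) = 1\<^sub>m n" if z: "z \<in> S1" for z
    unfolding mult_mat_regroup[OF c(4,3,1,2)] u[OF z] left_mult_one_mat[OF c(2)] u[OF z] ..
  ultimately show ?thesis
    unfolding para_unitary_def para_conj_mult[OF U V] using hol_circle_mat_mult[OF U V] by blast
qed

lemma block_diag_pseudo_circulant_four_block:
  assumes "block_diag_pseudo_circulant m D" "block_diag_pseudo_circulant p E"
  shows "block_diag_pseudo_circulant (m + p) (\<lambda>z. four_block_mat (D z) (0\<^sub>m m p) (0\<^sub>m p m) (E z))"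
proof -
  obtain Cs where D: "D \<in> hol_circle_mat m m" and Cs: "\<forall>C\<in>set Cs. \<exists>N>0. pseudo_circulant N C"
    "\<forall>z\<in>S1. D z = diag_block_mat (map (\<lambda>C. C z) Cs)"
    using assms(1) unfolding block_diag_pseudo_circulant_def by blast
  obtain Ds where E: "E \<in> hol_circle_mat p p" and Ds: "\<forall>C\<in>set Ds. \<exists>N>0. pseudo_circulant N C"
    "\<forall>z\<in>S1. E z = diag_block_mat (map (\<lambda>C. C z) Ds)"
    using assms(2) unfolding block_diag_pseudo_circulant_def by blast
  have "four_block_mat (D z) (0\<^sub>m m p) (0\<^sub>m p m) (E z) = diag_block_mat (map (\<lambda>C. C z) (Cs @ Ds))" if z: "z \<in> S1" for z
  proof -
    have "D z = diag_block_mat (map (\<lambda>C. C z) Cs)" "E z = diag_block_mat (map (\<lambda>C. C z) Ds)"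
      using Cs(2) Ds(2) z by auto
    moreover have "D z \<in> carrier_mat m m" "E z \<in> carrier_mat p p"
      using hol_circle_matD(1)[OF D] hol_circle_matD(1)[OF E] by auto
    ultimately show ?thesis by (auto simp: diag_block_mat_append Let_def)
  qed
  then show ?thesis
    unfolding block_diag_pseudo_circulant_def
    using hol_circle_mat_four_block[OF D E] Cs(1) Ds(1)
    by (intro conjI exI[of _ "Cs @ Ds"]) auto
qed

text \<open>
The lower left block vanishes by invariance and the upper right block because the matrix stays Hermitian
in an orthonormal basis.
\<close>
lemma reducible_splits:
  assumes A: "hermitian_on_circle n A" and red: "reducible_on_circle n A"
  obtains m W A1 A2 where "0 < m" "m < n" "para_unitary n W"
    "hermitian_on_circle m A1" "hermitian_on_circle (n - m) A2"
    "\<And>z. z \<in> S1 \<Longrightarrow> A z = W z * four_block_mat (A1 z) (0\<^sub>m m (n - m)) (0\<^sub>m (n - m) m) (A2 z) * para_conj W z"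
proof -
  note AD = hermitian_on_circleD[OF A]
  obtain m u0 where m: "0 < m" "m < n" and u0: "orthonormal n m u0"
    and inv0: "\<And>z k. z \<in> S1 \<Longrightarrow> k < m \<Longrightarrow> \<exists>c. \<forall>i<n. (\<Sum>j<n. A z $$ (i, j) * u0 k j z) = (\<Sum>l<m. c l * u0 l i z)"
    using red unfolding reducible_on_circle_def by (elim exE conjE) simp
  obtain u where u_all: "orthonormal n n u \<and> (\<forall>k<m. u k = u0 k)"
    using orthonormal_complete[OF u0] ..
  then have u: "orthonormal n n u" and uu: "\<And>k. k < m \<Longrightarrow> u k = u0 k" by auto
  define b where "b i k z = (\<Sum>p<n. cnj (u i p (inverse (cnj z))) * (\<Sum>q<n. A z $$ (p, q) * u k q z))" for i k z
  have beq: "b i k z = (\<Sum>p<n. cnj (u i p z) * (\<Sum>q<n. A z $$ (p, q) * u k q z))" if "z \<in> S1" for i k z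
    unfolding b_def inverse_cnj_S1[OF that] ..
  have bh: "b i k \<in> hol_circle" if "i < n" "k < n" for i k
    unfolding b_def using that
    by (intro hol_circle_sum hol_circle_mult hol_circle_cnj[of "u i _"] orthonormalD(1)[OF u] AD(2)) auto
  have bherm: "cnj (b k i z) = b i k z" if z: "z \<in> S1" for i k z
  proof -
    have "cnj (b k i z) = (\<Sum>p<n. cnj (\<Sum>q<n. A z $$ (p, q) * u i q z) * u k p z)"
      unfolding beq[OF z] by (simp add: mult.commute)
    also have "\<dots> = b i k z" unfolding beq[OF z]
      by (rule hermitian_form_swap) (rule AD(3)[OF z])
    finally show ?thesis .
  qed
  have b0: "b i k z = 0" if z: "z \<in> S1" and k: "k < m" and i: "m \<le> i" "i < n" for i k z
  proof -
    obtain c where c: "\<forall>i<n. (\<Sum>j<n. A z $$ (i, j) * u0 k j z) = (\<Sum>l<m. c l * u0 l i z)"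
      using inv0[OF z k] ..
    have "b i k z = (\<Sum>p<n. cnj (u i p z) * (\<Sum>l<m. c l * u l p z))"
      unfolding beq[OF z] using c uu[OF k] by (intro sum.cong refl) (simp add: uu)
    then show ?thesis using orthonormal_coefficient[OF u z i(2), of m c] i m by simp
  qed
  define A1 A2 where "A1 z = mat m m (\<lambda>(i, k). b i k z)"
    and "A2 z = mat (n - m) (n - m) (\<lambda>(i, k). b (i + m) (k + m) z)" for z
  have h1: "hermitian_on_circle m A1"
    unfolding hermitian_on_circle_def
  proof (intro conjI ballI allI impI)
    show "A1 \<in> hol_circle_mat m m"
      by (rule hol_circle_matI) (use bh m in \<open>auto simp: A1_def\<close>)
    show "cnj (A1 z $$ (i, j)) = A1 z $$ (j, i)" if "z \<in> S1" "i < m" "j < m" for z i j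
      using that(2,3) bherm[OF that(1)] by (simp add: A1_def)
  qed
  have h2: "hermitian_on_circle (n - m) A2"
    unfolding hermitian_on_circle_def
  proof (intro conjI ballI allI impI)
    show "A2 \<in> hol_circle_mat (n - m) (n - m)"
      by (rule hol_circle_matI) (use bh m in \<open>auto simp: A2_def\<close>)
    show "cnj (A2 z $$ (i, j)) = A2 z $$ (j, i)" if "z \<in> S1" "i < (n - m)" "j < (n - m)" for z i j
      using that(2,3) bherm[OF that(1)] by (simp add: A2_def)
  qed
  show ?thesis
  proof (rule that[OF m column_mat_para_unitary[OF u] h1 h2])
    fix z assume z: "z \<in> S1"
    let ?B = "four_block_mat (A1 z) (0\<^sub>m m (n - m)) (0\<^sub>m (n - m) m) (A2 z)"
    have Bidx: "?B $$ (l, k) = b l k z" if "l < n" "k < n" for l k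
    proof -
      have "b l k z = 0" if "l < m" "\<not> k < m" 
        using b0[OF z that(1), of k] bherm[OF z, of k l] \<open>k < n\<close> that(2) by simp
      then show ?thesis using that m b0[OF z, of k l]
        by (auto simp: A1_def A2_def)
    qed
    have "?B \<in> carrier_mat (m + (n - m)) (m + (n - m))"
      by (rule four_block_carrier_mat) (simp_all add: A1_def A2_def)
    then have Bc: "?B \<in> carrier_mat n n" using m by simp
    show "A z = column_mat n u z * ?B * para_conj (column_mat n u) z"
    proof (rule conjugate_by_column_mat[where B = ?B, OF A u z Bc])
      fix i k assume ik: "i < n" "k < n"
      have "(\<Sum>j<n. A z $$ (i, j) * u k j z) = (\<Sum>l<n. b l k z * u l i z)"
        using orthonormal_expansion[OF u z ik(1), of "\<lambda>i. \<Sum>j<n. A z $$ (i, j) * u k j z"]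
        unfolding beq[OF z] .
      also have "\<dots> = (\<Sum>l<n. ?B $$ (l, k) * u l i z)"
        using ik by (intro sum.cong refl) (simp only: Bidx lessThan_iff)
      finally show "(\<Sum>j<n. A z $$ (i, j) * u k j z) = (\<Sum>l<n. ?B $$ (l, k) * u l i z)" .
    qed
  qed
qed

text \<open>
The subspace that belongs to one cycle of eigenvalues is invariant, so by irreducibility it is the whole
space.
\<close>
lemma irreducible_is_pseudo_circulant:
  assumes A: "hermitian_on_circle n A" and n: "n > 0" and irr: "\<not> reducible_on_circle n A"
  obtains U D where "para_unitary n U" "pseudo_circulant n D"
    "\<And>z. z \<in> S1 \<Longrightarrow> A z = U z * D z * para_conj U z"
proof -
  obtain z0 where z0: "z0 \<in> S1" "rsquarefree (char_poly (A z0))"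
    using irreducible_imp_simple_spectrum[OF A n irr] .
  show ?thesis
  proof (rule pseudo_circulant_invariant_subspace[OF A n z0])
    fix N :: nat and u \<phi>
    assume N: "N > 0" and u: "orthonormal n N u" and phi: "\<And>m. \<phi> m \<in> hol_circle"
      and inv: "\<And>z i b. z \<in> S1 \<Longrightarrow> i < n \<Longrightarrow> b < N \<Longrightarrow> (\<Sum>j<n. A z $$ (i, j) * u b j z) =
       (\<Sum>l<N. (if l \<ge> b then \<phi> (l - b) z else inverse z * \<phi> (N + l - b) z) * u l i z)"
    have "\<not> N < n"
    proof
      assume "N < n"
      have "reducible_on_circle n A"
        unfolding reducible_on_circle_def
      proof (intro exI[of _ N] exI[of _ u] conjI ballI allI impI N \<open>N < n\<close> u)
        fix z b assume "z \<in> S1" "b < N"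
        then show "\<exists>c. \<forall>i<n. (\<Sum>j<n. A z $$ (i, j) * u b j z) = (\<Sum>l<N. c l * u l i z)"
          by (intro exI[of _ "\<lambda>l. if l \<ge> b then \<phi> (l - b) z else inverse z * \<phi> (N + l - b) z"] allI impI inv)
      qed
      with irr show False ..
    qed
    then have Nn: "N = n" using orthonormal_bound[OF u] by simp
    define D where "D z = mat n n (\<lambda>(l, b). if l \<ge> b then \<phi> (l - b) z else inverse z * \<phi> (n + l - b) z)" for z
    have "pseudo_circulant n D"
      unfolding pseudo_circulant_def
    proof (intro conjI exI[of _ \<phi>] allI impI ballI phi)
      show "D \<in> hol_circle_mat n n"
      proof (rule hol_circle_matI)
        show "D z \<in> carrier_mat n n" for z by (simp add: D_def)
        fix i j assume "i < n" "j < n"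
        then show "(\<lambda>z. D z $$ (i, j)) \<in> hol_circle"
          by (cases "j \<le> i") (simp_all add: D_def phi hol_circle_mult)
      qed
    qed (simp add: D_def)
    moreover have "A z = column_mat n u z * D z * para_conj (column_mat n u) z" if z: "z \<in> S1" for z
    proof (rule conjugate_by_column_mat[OF A u[unfolded Nn] z])
      fix i k assume ik: "i < n" "k < n"
      show "(\<Sum>j<n. A z $$ (i, j) * u k j z) = (\<Sum>l<n. D z $$ (l, k) * u l i z)"
        using inv[OF z ik(1), of k] ik unfolding Nn by (simp add: D_def)
    qed (simp add: D_def)
    ultimately show thesis using that[OF column_mat_para_unitary[OF u[unfolded Nn]]] by blast
  qed
qed

text \<open>
Induction on the size. Products of para-unitary matrices are para-unitary, and the lists of diagonal
blocks of the two parts are concatenated; the empty matrix has the empty list of blocks.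
\<close>
lemma hermitian_on_circle_decomposition:
  assumes "hermitian_on_circle n A"
  shows "\<exists>U D. para_unitary n U \<and> block_diag_pseudo_circulant n D \<and>
           (\<forall>z\<in>S1. A z = U z * D z * para_conj U z)"
  using assms
proof (induction n arbitrary: A rule: less_induct)
  case (less n)
  note A = less.prems
  consider "n = 0" | "n > 0" "reducible_on_circle n A" | "n > 0" "\<not> reducible_on_circle n A" by blast
  then show ?case
  proof cases
    case 1
    have c: "A z \<in> carrier_mat 0 0" for z using hermitian_on_circleD(1)[OF A] 1 by simp
    have eq: "X = Y" if "X \<in> carrier_mat 0 0" "Y \<in> carrier_mat 0 0" for X Y :: "complex mat"
      using that by (intro eq_matI) auto
    have hol: "A \<in> hol_circle_mat 0 0" by (rule hol_circle_matI[OF c]) auto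
    have cP: "para_conj A z \<in> carrier_mat 0 0" for z
      by (rule hol_circle_matD(1)[OF hol_circle_mat_para_conj[OF hol]])
    have "para_unitary 0 A" unfolding para_unitary_def
      using hol mult_carrier_mat[OF c cP] mult_carrier_mat[OF cP c] by (auto intro!: eq)
    moreover have "block_diag_pseudo_circulant 0 A"
      unfolding block_diag_pseudo_circulant_def using hol c by (intro conjI exI[of _ "[]"]) (auto intro!: eq)
    moreover have "\<forall>z\<in>S1. A z = A z * A z * para_conj A z"
      using mult_carrier_mat[OF mult_carrier_mat[OF c c] cP] c by (auto intro!: eq)
    ultimately show ?thesis using 1 by blast
  next
    case 2
    show ?thesis
    proof (rule reducible_splits[OF A 2(2)])
      fix m W A1 A2
      assume m: "0 < m" "m < n" and W: "para_unitary n W"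
        and h: "hermitian_on_circle m A1" "hermitian_on_circle (n - m) A2"
        and AW: "\<And>z. z \<in> S1 \<Longrightarrow> A z = W z * four_block_mat (A1 z) (0\<^sub>m m (n - m)) (0\<^sub>m (n - m) m) (A2 z) * para_conj W z"
      obtain U1 D1 where 1: "para_unitary m U1" "block_diag_pseudo_circulant m D1"
        "\<forall>z\<in>S1. A1 z = U1 z * D1 z * para_conj U1 z"
        using less.IH[OF m(2) h(1)] by (elim exE conjE)
      have "n - m < n" using m by simp
      from less.IH[OF this h(2)] obtain U2 D2 where 2: "para_unitary (n - m) U2"
        "block_diag_pseudo_circulant (n - m) D2" "\<forall>z\<in>S1. A2 z = U2 z * D2 z * para_conj U2 z"
        by (elim exE conjE)
      let ?p = "n - m"
      have mp: "m + ?p = n" using m by simp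
      define V where "V z = four_block_mat (U1 z) (0\<^sub>m m ?p) (0\<^sub>m ?p m) (U2 z)" for z
      define D where "D z = four_block_mat (D1 z) (0\<^sub>m m ?p) (0\<^sub>m ?p m) (D2 z)" for z
      have puV: "para_unitary n V" using para_unitary_four_block[OF 1(1) 2(1)] unfolding V_def mp .
      have bD: "block_diag_pseudo_circulant n D"
        using block_diag_pseudo_circulant_four_block[OF 1(2) 2(2)] unfolding D_def mp .
      have hol: "U1 \<in> hol_circle_mat m m" "U2 \<in> hol_circle_mat ?p ?p" "D1 \<in> hol_circle_mat m m"
          "D2 \<in> hol_circle_mat ?p ?p" "V \<in> hol_circle_mat n n" "W \<in> hol_circle_mat n n" "D \<in> hol_circle_mat n n"
        using 1 2 puV W bD by (simp_all add: para_unitary_def block_diag_pseudo_circulant_def)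
      note c = hol_circle_matD(1)[OF hol(1)] hol_circle_matD(1)[OF hol(2)] hol_circle_matD(1)[OF hol(3)]
        hol_circle_matD(1)[OF hol(4)] hol_circle_matD(1)[OF hol(5)] hol_circle_matD(1)[OF hol(6)]
        hol_circle_matD(1)[OF hol(7)] hol_circle_matD(1)[OF hol_circle_mat_para_conj[OF hol(1)]]
        hol_circle_matD(1)[OF hol_circle_mat_para_conj[OF hol(2)]]
        hol_circle_matD(1)[OF hol_circle_mat_para_conj[OF hol(5)]]
        hol_circle_matD(1)[OF hol_circle_mat_para_conj[OF hol(6)]]
      have "A z = (W z * V z) * D z * para_conj (\<lambda>z. W z * V z) z" if z: "z \<in> S1" for z
      proof -
        have "V z * D z * para_conj V z = four_block_mat (U1 z * D1 z * para_conj U1 z) (0\<^sub>m m ?p) (0\<^sub>m ?p m) (U2 z * D2 z * para_conj U2 z)"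
        proof -
          have "para_conj V z = four_block_mat (para_conj U1 z) (0\<^sub>m m ?p) (0\<^sub>m ?p m) (para_conj U2 z)"
            using para_conj_four_block[OF hol(1,2), of z] by (simp only: V_def[abs_def])
          moreover have "V z * D z = four_block_mat (U1 z * D1 z) (0\<^sub>m m ?p) (0\<^sub>m ?p m) (U2 z * D2 z)"
            unfolding V_def D_def by (rule four_block_diag_mult[OF c(1,2,3,4)])
          moreover have "U1 z * D1 z \<in> carrier_mat m m" "U2 z * D2 z \<in> carrier_mat ?p ?p"
            using c(1,2,3,4)[of z] by auto
          ultimately show ?thesis using four_block_diag_mult[OF _ _ c(8,9)] by simp
        qed
        then have "A z = W z * (V z * D z * para_conj V z) * para_conj W z"
          using AW[OF z] 1(3) 2(3) z by simp
        also have "\<dots> = (W z * V z) * D z * (para_conj V z * para_conj W z)"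
          using c(5,6,7,10,11)[of z] by (simp add: assoc_mult_mat[of _ n n _ n _ n])
        finally show ?thesis by (simp only: para_conj_mult[OF hol(6,5)])
      qed
      then show ?thesis using para_unitary_mult[OF W puV] bD
        by (intro exI[of _ "\<lambda>z. W z * V z"] exI[of _ D]) blast
    qed
  next
    case 3
    show ?thesis
    proof (rule irreducible_is_pseudo_circulant[OF A 3])
      fix U D
      assume U: "para_unitary n U" and D: "pseudo_circulant n D"
        and eq: "\<And>z. z \<in> S1 \<Longrightarrow> A z = U z * D z * para_conj U z"
      have "D \<in> hol_circle_mat n n" using D unfolding pseudo_circulant_def by (rule conjunct1)
      moreover have "\<exists>N>0. pseudo_circulant N D" using D 3(1) by blast
      moreover have "D z = diag_block_mat (map (\<lambda>C. C z) [D])" for z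
        by (simp only: list.map diag_block_mat_singleton)
      ultimately have "block_diag_pseudo_circulant n D"
        unfolding block_diag_pseudo_circulant_def
        by (intro conjI exI[of _ "[D]"]) (simp_all del: diag_block_mat.simps)
      with U eq show ?thesis by (intro exI[of _ U] exI[of _ D]) blast
    qed
  qed
qed

theorem theorem3p14:
  fixes n :: nat and A :: "complex \<Rightarrow> complex mat"
  assumes "para_hermitian n A"
  shows "\<exists>U D. para_unitary n U \<and> block_diag_pseudo_circulant n D \<and>
           (\<forall>z\<in>sphere 0 1. A z = U z * D z * para_conj U z)"
  using hermitian_on_circle_decomposition assms by (simp only: para_hermitian_iff)

end
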